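(* Let $\Omega \subseteq \mathbb{R}^d$ be a domain, $\rho$ a probability measure on $\Omega$, $P \subset L^2(\Omega,\rho)$ a subspace of finite dimension $N$ with (not necessarily orthogonal) basis $\{\psi_1,\ldots,\psi_N\}$, and let $M \ge N$, $K \ge N$ be integers. Let $\boldsymbol{z}_1,\ldots,\boldsymbol{z}_K$, $\boldsymbol{B}$, $\boldsymbol{Q}$, $\boldsymbol{R}$, $\pi$, $i_1,\ldots,i_M$, $\boldsymbol{A}$ and, for $f\in L^\infty(\Omega)$, $\boldsymbol{b}$, $\boldsymbol{c}$, $\tilde f$ be generated by Method 1 as described in the context. Suppose that $\gamma,\delta \in (0,1)$ and $$M \geq N \log(4N/\gamma) \left( (1+\delta)\log(1+\delta) - \delta \right)^{-1},$$ $$K \geq (\mathcal{N}(P,\rho))^2 \log(2N/\gamma) \left( (1-\delta)\log(1-\delta)+\delta \right)^{-1},$$ where $\mathcal{N}(P,\rho)$ is the smallest constant such that $\|p\|_{L^\infty(\Omega)} \le \mathcal{N}(P,\rho) \|p\|_{L^2(\Omega,\rho)}$ for all $p \in P$. Then the following holds with probability at least $1-\gamma$: (i) the matrix $\boldsymbol{B}$ has full rank, $\mathrm{rank}(\boldsymbol{B}) = N$; (ii) the condition number of $\boldsymbol{A}$ satisfies $\kappa(\boldsymbol{A}) \le \sqrt{\frac{1+\delta}{1-\delta}}$; (iii) for any $f \in L^\infty(\Omega)$ the approximation $\tilde f$ is unique and satisfies $$\|f-\tilde f\|_{L^2(\Omega,\rho)} \le \inf_{p \in P} \left\{ \|f-p\|_{L^2(\Omega,\rho)}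 + \frac{1}{1-\delta} \max_{i=1,\ldots,K} \frac{|(f-p)(\boldsymbol{z}_i)|}{\sqrt{K\pi_i}} \right\}.$$
   Context: Functions are complex-valued. Functions in $P$ and in $L^\infty(\Omega)$ are regarded as measurable functions defined at every point of $\Omega$, so that point values make sense, and $\|\cdot\|_{L^\infty(\Omega)}$ is the sup norm over $\Omega$. $\kappa$ denotes the condition number with respect to the matrix $2$-norm (ratio of largest to smallest singular value). Method 1 (one pass): Step 1: draw $\boldsymbol{z}_1,\ldots,\boldsymbol{z}_K$ independently from $\rho$. Step 2: form $\boldsymbol{B} = \{\psi_j(\boldsymbol{z}_i)/\sqrt{K}\}_{i,j=1}^{K,N} \in \mathbb{C}^{K\times N}$ and check whether $\mathrm{rank}(\boldsymbol{B})=N$. (If not, the method returns to Step 1; statement (i) concerns the matrix from a single draw, and the subsequent quantities are defined when $\boldsymbol{B}$ has full rank.) Step 3: compute the reduced QR decomposition $\boldsymbol{B}=\boldsymbol{Q}\boldsymbol{R}$, where $\boldsymbol{Q}=\{q_{ij}\}\in\mathbb{C}^{K\times N}$ satisfies $\boldsymbol{Q}^*\boldsymbol{Q}=\boldsymbol{I}$ and $\boldsymbol{R}\in\mathbb{C}^{N\times N}$ is upper triangular. Define the probability distribution $\pi=\{\pi_i\}_{i=1}^K$ on $\{1,\ldots,K\}$ by $\pi_i = \frac1N\sum_{j=1}^N |q_{ij}|^2$. Step 4: conditionally on the grid points $\boldsymbol{z}_1,\ldots,\boldsymbol{z}_K$ (and hence on $\boldsymbol{B}$, $\boldsymbol{Q}$,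 $\boldsymbol{R}$ and $\pi$), draw $M$ integers $i_1,\ldots,i_M$ independently from $\pi$, define $$\boldsymbol{A} = \left\{ \frac{q_{i_j,k}}{\sqrt{M\pi_{i_j}}} \right\}_{j,k=1}^{M,N}\in\mathbb{C}^{M\times N},\qquad \boldsymbol{b} = \left\{ \frac{f(\boldsymbol{z}_{i_j})}{\sqrt{MK\pi_{i_j}}} \right\}_{j=1}^M\in\mathbb{C}^M,$$ and let $\boldsymbol{c}\in\operatorname{argmin}_{\boldsymbol{x}\in\mathbb{C}^N}\|\boldsymbol{A}\boldsymbol{x}-\boldsymbol{b}\|_2$. Output: $\tilde f = \sum_{i=1}^N c_i\phi_i$, where $\phi_i = \sum_{j=1}^i (R^{-\top})_{ij}\psi_j$ (so that $\phi_i(\boldsymbol{z}_k)=\sqrt{K}\,q_{ki}$). Standing assumption: with probability one, for every grid point $\boldsymbol{z}_i$ there exists $p\in P$ with $p(\boldsymbol{z}_i)\neq 0$ (so that every $\pi_i>0$). The probability in the theorem is with respect to the joint draw of $\boldsymbol{z}_1,\ldots,\boldsymbol{z}_K$ and $i_1,\ldots,i_M$. *)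

theory Defs
  imports "HOL-Probability.Probability" "Jordan_Normal_Form.Schur_Decomposition"
    "Jordan_Normal_Form.Gauss_Jordan_Elimination" "Jordan_Normal_Form.DL_Rank"
begin

text \<open>Indices run from \<open>0\<close>: \<open>\<psi>\<^sub>1, \<dots>, \<psi>\<^sub>N\<close> are \<open>\<psi> 0, \<dots>, \<psi> (N - 1)\<close>, and likewise for grid points,
  draws and matrix entries. Matrices and vectors are those of Jordan_Normal_Form.\<close>

subsection \<open>Function spaces\<close>

definition square_integrable :: "'a measure \<Rightarrow> ('a \<Rightarrow> complex) \<Rightarrow> bool" where
  "square_integrable \<rho> g \<longleftrightarrow>
     g \<in> borel_measurable \<rho> \<and> integrable \<rho> (\<lambda>x. (cmod (g x))\<^sup>2)"

definition L2_norm :: "'a measure \<Rightarrow> ('a \<Rightarrow> complex) \<Rightarrow> real" where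
  "L2_norm \<rho> g = sqrt (\<integral>x. (cmod (g x))\<^sup>2 \<partial>\<rho>)"

definition sup_norm :: "'a set \<Rightarrow> ('a \<Rightarrow> complex) \<Rightarrow> ennreal" where
  "sup_norm \<Omega> g = (SUP x\<in>\<Omega>. ennreal (cmod (g x)))"

definition bounded_measurable :: "'a measure \<Rightarrow> ('a \<Rightarrow> complex) \<Rightarrow> bool" where
  "bounded_measurable \<rho> f \<longleftrightarrow> f \<in> borel_measurable \<rho> \<and> bounded (f ` space \<rho>)"

text \<open>Linear independence is that of \<open>L\<^sup>2\<close>, where functions equal almost everywhere are identified,
  so that the image of \<open>P\<close> in \<open>L\<^sup>2\<close> has dimension \<open>N\<close>.\<close>

definition L2_basis :: "'a measure \<Rightarrow> ('a \<Rightarrow> complex) set \<Rightarrow> nat \<Rightarrow> (nat \<Rightarrow> 'a \<Rightarrow> complex) \<Rightarrow> bool" where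
  "L2_basis \<rho> P N \<psi> \<longleftrightarrow>
     (\<forall>j<N. square_integrable \<rho> (\<psi> j)) \<and>
     P = {p. \<exists>c. p = (\<lambda>x. \<Sum>j<N. c j * \<psi> j x)} \<and>
     (\<forall>c. (AE x in \<rho>. (\<Sum>j<N. c j * \<psi> j x) = 0) \<longrightarrow> (\<forall>j<N. c j = 0))"

text \<open>The smallest \<open>C\<close> with \<open>\<parallel>p\<parallel>\<^sub>\<infinity> \<le> C \<parallel>p\<parallel>\<^sub>2\<close> on \<open>P\<close>; it is \<open>\<infinity>\<close> if no finite \<open>C\<close> works.
  The infimum is attained, see \<open>nikolskii_const_bound\<close> below.\<close>

definition nikolskii_const :: "'a measure \<Rightarrow> ('a \<Rightarrow> complex) set \<Rightarrow> ennreal" where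
  "nikolskii_const \<rho> P =
     Inf {C. \<forall>p\<in>P. sup_norm (space \<rho>) p \<le> C * ennreal (L2_norm \<rho> p)}"

lemma nikolskii_const_bound:
  assumes "p \<in> P" "nikolskii_const \<rho> P \<noteq> \<infinity>"
  shows "sup_norm (space \<rho>) p \<le> nikolskii_const \<rho> P * ennreal (L2_norm \<rho> p)"
proof -
  define S where "S = {C. \<forall>p\<in>P. sup_norm (space \<rho>) p \<le> C * ennreal (L2_norm \<rho> p)}"
  define a where "a = sup_norm (space \<rho>) p"
  define c where "c = ennreal (L2_norm \<rho> p)"
  have le: "a \<le> C * c" if "C \<in> S" for C
    using that assms(1) by (auto simp: S_def a_def c_def)
  have "S \<noteq> {}"
    using assms(2) by (auto simp: nikolskii_const_def S_def)
  show ?thesis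
  proof (cases "c = 0")
    case True
    obtain C where "C \<in> S" using \<open>S \<noteq> {}\<close> by blast
    from le[OF this] True have "a \<le> 0" by simp
    then show ?thesis by (simp add: a_def)
  next
    case False
    have fin: "c \<noteq> \<infinity>" by (simp add: c_def)
    have "a / c \<le> Inf S"
    proof (rule Inf_greatest)
      fix C assume "C \<in> S"
      then show "a / c \<le> C"
        using False le by (intro divide_le_posI_ennreal) (auto simp: mult.commute zero_less_iff_neq_zero)
    qed
    then have "a / c * c \<le> Inf S * c" by (rule mult_right_mono) simp
    also have "a / c * c = a"
      using False fin by (simp add: ennreal_divide_times ennreal_divide_self top.not_eq_extremum)
    finally show ?thesis
      by (simp add: nikolskii_const_def S_def a_def c_def)
  qed
qed

subsection \<open>Matrices\<close>

definition vec_norm2 :: "complex vec \<Rightarrow> real" where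
  "vec_norm2 v = L2_set (\<lambda>i. cmod (vec_index v i)) {..<dim_vec v}"

text \<open>Only used for matrices with at least as many rows as columns.\<close>

definition singular_values :: "complex mat \<Rightarrow> real set" where
  "singular_values A = {s. 0 \<le> s \<and> eigenvalue (mat_adjoint A * A) (complex_of_real (s\<^sup>2))}"

definition condition_number :: "complex mat \<Rightarrow> ereal" where
  "condition_number A =
     (if Min (singular_values A) = 0 then \<infinity>
      else ereal (Max (singular_values A) / Min (singular_values A)))"

definition reduced_qr :: "complex mat \<Rightarrow> complex mat \<Rightarrow> complex mat \<Rightarrow> bool" where
  "reduced_qr B Q R \<longleftrightarrow>
     Q \<in> carrier_mat (dim_row B) (dim_col B) \<and> R \<in> carrier_mat (dim_col B) (dim_col B) \<and>
     mat_adjoint Q * Q = 1\<^sub>m (dim_col B) \<and> upper_triangular R \<and> B = Q * R"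

definition full_col_rank :: "complex mat \<Rightarrow> bool" where
  "full_col_rank B \<longleftrightarrow> vec_space.rank (dim_row B) B = dim_col B"

subsection \<open>The method\<close>

definition grid_mat :: "nat \<Rightarrow> nat \<Rightarrow> (nat \<Rightarrow> 'a \<Rightarrow> complex) \<Rightarrow> (nat \<Rightarrow> 'a) \<Rightarrow> complex mat" where
  "grid_mat K N \<psi> z = mat K N (\<lambda>(i, j). \<psi> j (z i) / complex_of_real (sqrt (real K)))"

definition sampling_prob :: "complex mat \<Rightarrow> nat \<Rightarrow> real" where
  "sampling_prob Q i = 1 / real (dim_col Q) * (\<Sum>j<dim_col Q. (cmod (Q $$ (i, j)))\<^sup>2)"

text \<open>If the grid matrix is rank deficient then no \<open>\<pi>\<close> is prescribed; the uniform distribution is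
  a placeholder that makes the joint law total.\<close>

definition sampling_pmf :: "(complex mat \<Rightarrow> complex mat \<times> complex mat) \<Rightarrow> complex mat \<Rightarrow> nat pmf" where
  "sampling_pmf qr B =
     (if full_col_rank B
      then embed_pmf (\<lambda>i. if i < dim_row B then sampling_prob (fst (qr B)) i else 0)
      else pmf_of_set {..<dim_row B})"

text \<open>The joint law of the grid \<open>z\<close> and of the indices \<open>\<iota>\<close>, which are drawn independently from
  \<open>\<pi>\<close> given \<open>z\<close>. The functions \<open>\<iota>\<close> are \<open>0\<close> outside \<open>{..<M}\<close>.\<close>

definition method_law ::
  "'a measure \<Rightarrow> (nat \<Rightarrow> 'a \<Rightarrow> complex) \<Rightarrow> nat \<Rightarrow> nat \<Rightarrow> nat \<Rightarrow>
   (complex mat \<Rightarrow> complex mat \<times> complex mat) \<Rightarrow> ((nat \<Rightarrow> 'a) \<times> (nat \<Rightarrow> nat)) measure" where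
  "method_law \<rho> \<psi> N K M qr =
     PiM {..<K} (\<lambda>_. \<rho>) \<bind> (\<lambda>z.
       measure_pmf (Pi_pmf {..<M} 0 (\<lambda>_. sampling_pmf qr (grid_mat K N \<psi> z))) \<bind> (\<lambda>\<iota>.
         return (PiM {..<K} (\<lambda>_. \<rho>) \<Otimes>\<^sub>M count_space UNIV) (z, \<iota>)))"

definition sampled_mat :: "complex mat \<Rightarrow> nat \<Rightarrow> (nat \<Rightarrow> nat) \<Rightarrow> complex mat" where
  "sampled_mat Q M \<iota> =
     mat M (dim_col Q)
       (\<lambda>(j, k). Q $$ (\<iota> j, k) / complex_of_real (sqrt (real M * sampling_prob Q (\<iota> j))))"

definition sampled_rhs ::
  "complex mat \<Rightarrow> nat \<Rightarrow> (nat \<Rightarrow> 'a) \<Rightarrow> (nat \<Rightarrow> nat) \<Rightarrow> ('a \<Rightarrow> complex) \<Rightarrow> complex vec" where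
  "sampled_rhs Q M z \<iota> f =
     vec M (\<lambda>j. f (z (\<iota> j)) /
       complex_of_real (sqrt (real M * real (dim_row Q) * sampling_prob Q (\<iota> j))))"

definition least_squares_sols :: "complex mat \<Rightarrow> complex vec \<Rightarrow> complex vec set" where
  "least_squares_sols A b =
     {c. is_arg_min (\<lambda>x. vec_norm2 (A *\<^sub>v x - b)) (\<lambda>x. x \<in> carrier_vec (dim_col A)) c}"

definition orth_fun :: "(nat \<Rightarrow> 'a \<Rightarrow> complex) \<Rightarrow> complex mat \<Rightarrow> nat \<Rightarrow> 'a \<Rightarrow> complex" where
  "orth_fun \<psi> R i x = (\<Sum>j\<le>i. transpose_mat (the (mat_inverse R)) $$ (i, j) * \<psi> j x)"

text \<open>All approximations the method may return, one for every least-squares solution.\<close>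

definition method_outputs ::
  "(nat \<Rightarrow> 'a \<Rightarrow> complex) \<Rightarrow> complex mat \<Rightarrow> complex mat \<Rightarrow> nat \<Rightarrow> (nat \<Rightarrow> 'a) \<Rightarrow> (nat \<Rightarrow> nat) \<Rightarrow>
   ('a \<Rightarrow> complex) \<Rightarrow> ('a \<Rightarrow> complex) set" where
  "method_outputs \<psi> Q R M z \<iota> f =
     {g. \<exists>c \<in> least_squares_sols (sampled_mat Q M \<iota>) (sampled_rhs Q M z \<iota> f).
           g = (\<lambda>x. \<Sum>i<dim_col Q. vec_index c i * orth_fun \<psi> R i x)}"

end

theory Submission
  imports Defs "Jordan_Normal_Form.Spectral_Radius"
begin

text \<open>
  Both stages ask that a sum \<open>S\<close> of independent rank-one matrices \<open>a a\<^sup>*\<close> with \<open>\<bar>a\<bar>\<^sup>2 \<le> R\<close> and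
  \<open>E a a\<^sup>* = \<kappa> I\<close> be close to its mean: for the grid, \<open>a\<close> lists the values of an \<open>L\<^sup>2\<close>-orthonormal basis of
  \<open>P\<close> at a random point, and for the sampling step it is a row of \<open>Q\<close> drawn with its leverage score. As the
  mean is a multiple of the identity, the matrix Chernoff bound needs no operator concavity. If
  \<open>A = B + a a\<^sup>*\<close> with \<open>B\<close> positive definite, then \<open>tr A\<^sup>p - tr B\<^sup>p\<close> is the sum of
  \<open>G i j = a\<^sup>* A\<^sup>i B\<^sup>j a\<close> over \<open>i + j = p - 1\<close>, and log-convexity of the moments \<open>a\<^sup>* B\<^sup>j a\<close> yields
  \<open>G (i + 1) j \<le> (1 + R / e) G i (j + 1)\<close> if \<open>B \<ge> e\<close>. Applied to \<open>p I + S\<close> and \<open>p I - S\<close> this bounds the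
  expected trace of the \<open>p\<close>-th power one summand at a time, and \<open>p \<longlongrightarrow> \<infinity>\<close> gives the exponential rates.

  On the resulting event the normal equations determine the coefficients, the residual bounds the
  distance of the approximation to any \<open>p \<in> P\<close> in the discrete norm, and the grid transfers it to \<open>L\<^sup>2\<close>.
\<close>

section \<open>Moments of Hermitian matrices\<close>

text \<open>Because the mean is \<open>\<kappa> I\<close>, the expectation of
  \<open>moment N X (a s) p\<close> is \<open>\<kappa> * pow_trace N X p\<close>. The random vector
  disappears, and a single scalar, the trace, carries the recursion from one summand to the next; a
  general mean would leave the trace of a product of two matrices that do not commute. The shift by
  \<open>p\<close> serves twice. It supplies the lower bound \<open>e\<close>, and as
  \<open>e\<close> is close to \<open>p\<close>, exchanging \<open>p\<close> factors costs about
  \<open>(1 + R / p) ^ p\<close>, which tends to \<open>exp R\<close>. Its own power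
  \<open>p ^ p\<close> cancels against the threshold \<open>(p + t) ^ p\<close> and leaves
  \<open>exp t\<close>. The failure budget is \<open>\<gamma> / 2\<close> for the grid and
  \<open>\<gamma> / 4\<close> for each of the two tails of the sample, whence \<open>2\<close> and
  \<open>4\<close> under the logarithms; the factor \<open>N\<close> beside them is the trace of the
  identity. A second obstacle is measurability: \<open>qr\<close> is an arbitrary choice of factors,
  so no event may be phrased through it. Events use an explicit Gram--Schmidt factor instead, and a
  unitary matrix translates them to \<open>Q\<close> once grid and indices are fixed.\<close>

definition cip :: "nat \<Rightarrow> (nat \<Rightarrow> complex) \<Rightarrow> (nat \<Rightarrow> complex) \<Rightarrow> complex" where
  "cip N x y = (\<Sum>i<N. cnj (x i) * y i)"

definition sqn :: "nat \<Rightarrow> (nat \<Rightarrow> complex) \<Rightarrow> real" where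
  "sqn N x = (\<Sum>i<N. (cmod (x i))\<^sup>2)"

text \<open>Vectors and matrices are total functions with the dimension as a parameter. Iterating
  \<open>mapply\<close> with \<open>^^\<close> then gives the action of matrix powers without a
  matrix product.\<close>

definition mapply :: "nat \<Rightarrow> (nat \<Rightarrow> nat \<Rightarrow> complex) \<Rightarrow> (nat \<Rightarrow> complex) \<Rightarrow> nat \<Rightarrow> complex" where
  "mapply N X x = (\<lambda>i. \<Sum>k<N. X i k * x k)"

definition hermitian_on :: "nat \<Rightarrow> (nat \<Rightarrow> nat \<Rightarrow> complex) \<Rightarrow> bool" where
  "hermitian_on N X \<longleftrightarrow> (\<forall>i<N. \<forall>j<N. X i j = cnj (X j i))"

definition psd_on :: "nat \<Rightarrow> (nat \<Rightarrow> nat \<Rightarrow> complex) \<Rightarrow> bool" where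
  "psd_on N X \<longleftrightarrow> hermitian_on N X \<and> (\<forall>x. 0 \<le> Re (cip N x (mapply N X x)))"

text \<open>For Hermitian \<open>X\<close> this is the \<open>p\<close>-th moment of the spectral
  measure of \<open>X\<close> at \<open>x\<close>. The trace estimates extract all spectral
  information from these numbers, without diagonalisation.\<close>

definition moment :: "nat \<Rightarrow> (nat \<Rightarrow> nat \<Rightarrow> complex) \<Rightarrow> (nat \<Rightarrow> complex) \<Rightarrow> nat \<Rightarrow> real" where
  "moment N X x p = Re (cip N x ((mapply N X ^^ p) x))"

definition unit_fun :: "nat \<Rightarrow> nat \<Rightarrow> complex" where
  "unit_fun k = (\<lambda>i. if i = k then 1 else 0)"

definition pow_trace :: "nat \<Rightarrow> (nat \<Rightarrow> nat \<Rightarrow> complex) \<Rightarrow> nat \<Rightarrow> real" where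
  "pow_trace N X p = (\<Sum>k<N. moment N X (unit_fun k) p)"

lemma sum_mult_assoc:
  fixes a :: "'i \<Rightarrow> 'a::semiring_0"
  shows "(\<Sum>i\<in>I. a i * (\<Sum>k\<in>J. b i k * c k)) = (\<Sum>k\<in>J. (\<Sum>i\<in>I. a i * b i k) * c k)"
  by (simp add: sum_distrib_left sum_distrib_right mult.assoc) (rule sum.swap)

lemma sum_mult_delta:
  fixes x :: "nat \<Rightarrow> complex"
  assumes "\<And>m. m < n \<Longrightarrow> d m = (if k = m then 1 else 0)" "k < n"
  shows "(\<Sum>m<n. d m * x m) = x k"
proof -
  have "(\<Sum>m<n. d m * x m) = (\<Sum>m<n. if m = k then x m else 0)"
    using assms(1) by (intro sum.cong refl) auto
  with assms(2) show ?thesis by simp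
qed

lemma cip_commute: "cip N y x = cnj (cip N x y)"
  by (simp add: cip_def mult.commute)

lemma cip_self: "cip N x x = of_real (sqn N x)"
  by (simp add: cip_def sqn_def complex_norm_square mult.commute del: of_real_power)

lemma sqn_nonneg: "0 \<le> sqn N x"
  by (simp add: sqn_def sum_nonneg)

lemma sqn_eq_0_iff: "sqn N x = 0 \<longleftrightarrow> (\<forall>i<N. x i = 0)"
  by (auto simp: sqn_def sum_nonneg_eq_0_iff)

lemma cip_add_left: "cip N (\<lambda>i. x i + y i) z = cip N x z + cip N y z"
  and cip_add_right: "cip N z (\<lambda>i. x i + y i) = cip N z x + cip N z y"
  and cip_scale_left: "cip N (\<lambda>i. x i * c) z = cnj c * cip N x z"
  and cip_scale_right: "cip N z (\<lambda>i. x i * c) = c * cip N z x"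
  by (simp_all add: cip_def algebra_simps sum.distrib sum_distrib_left)

lemma cip_sum_right: "cip N z (\<lambda>i. \<Sum>m\<in>I. f m i) = (\<Sum>m\<in>I. cip N z (f m))"
  unfolding cip_def by (simp add: sum_distrib_left) (rule sum.swap)

lemma cip_cong: "(\<And>i. i < N \<Longrightarrow> x i = x' i) \<Longrightarrow> (\<And>i. i < N \<Longrightarrow> y i = y' i) \<Longrightarrow> cip N x y = cip N x' y'"
  by (auto simp: cip_def intro!: sum.cong)

lemma sqn_scale: "sqn N (\<lambda>i. x i * c) = (cmod c)\<^sup>2 * sqn N x"
  by (simp add: sqn_def norm_mult power_mult_distrib sum_distrib_left mult.commute)

lemma cip_unit_left: "k < N \<Longrightarrow> cip N (unit_fun k) x = x k"
  by (simp add: cip_def unit_fun_def if_distrib[of cnj] if_distrib[of "\<lambda>c. c * _"] sum.delta cong: if_cong)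

lemma mapply_add: "mapply N X (\<lambda>i. x i + y i) = (\<lambda>i. mapply N X x i + mapply N X y i)"
  and mapply_scale: "mapply N X (\<lambda>i. x i * c) = (\<lambda>i. mapply N X x i * c)"
  by (simp_all add: mapply_def algebra_simps sum.distrib sum_distrib_left)

lemma cip_mapply:
  assumes "hermitian_on N X"
  shows "cip N (mapply N X x) y = cip N x (mapply N X y)"
proof -
  have "cip N (mapply N X x) y = (\<Sum>i<N. \<Sum>k<N. cnj (X i k) * cnj (x k) * y i)"
    by (simp add: cip_def mapply_def sum_distrib_right)
  also have "\<dots> = (\<Sum>k<N. \<Sum>i<N. cnj (X i k) * cnj (x k) * y i)"
    by (rule sum.swap)
  also have "\<dots> = (\<Sum>k<N. \<Sum>i<N. cnj (x k) * (X k i * y i))"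
  proof (intro sum.cong refl)
    fix k i assume "k \<in> {..<N}" "i \<in> {..<N}"
    then have "X k i = cnj (X i k)" using assms unfolding hermitian_on_def by blast
    then show "cnj (X i k) * cnj (x k) * y i = cnj (x k) * (X k i * y i)" by simp
  qed
  finally show ?thesis by (simp add: cip_def mapply_def sum_distrib_left)
qed

lemma cip_mapply_pow:
  assumes "hermitian_on N X"
  shows "cip N ((mapply N X ^^ p) x) y = cip N x ((mapply N X ^^ p) y)"
  by (induction p arbitrary: y) (simp_all add: cip_mapply[OF assms] flip: funpow_swap1)

text \<open>Symmetry moves all powers to one side, and the resulting number equals its own
  conjugate. So the inner products of the iterates of \<open>x\<close> depend on
  \<open>i + j\<close> only.\<close>

lemma cip_mapply_pow_split:
  assumes "hermitian_on N X"
  shows "cip N ((mapply N X ^^ i) x) ((mapply N X ^^ j) x) = of_real (moment N X x (i + j))"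
proof -
  have "cip N ((mapply N X ^^ i) x) ((mapply N X ^^ j) x) = cip N x ((mapply N X ^^ (i + j)) x)"
    by (simp add: cip_mapply_pow[OF assms] funpow_add)
  moreover have "Im (cip N x ((mapply N X ^^ p) x)) = 0" for p
    using cip_commute[of N x "(mapply N X ^^ p) x"] cip_mapply_pow[OF assms, of p x x]
    by (metis cnj.sel(2) neg_equal_zero)
  ultimately show ?thesis by (simp add: moment_def complex_eq_iff)
qed

lemma moment_0: "moment N X x 0 = sqn N x"
  by (simp add: moment_def cip_self)

lemma moment_even:
  assumes "hermitian_on N X"
  shows "moment N X x (2 * k) = sqn N ((mapply N X ^^ k) x)"
  using cip_mapply_pow_split[OF assms, of k x k] cip_self[of N "(mapply N X ^^ k) x"]
  by (simp only: mult_2 of_real_eq_iff)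

lemma moment_odd:
  assumes "hermitian_on N X"
  shows "moment N X x (Suc (2 * k)) = moment N X ((mapply N X ^^ k) x) 1"
  using cip_mapply_pow_split[OF assms, of k x "Suc k"]
  by (simp add: moment_def[of N X "(mapply N X ^^ k) x"] mult_2)

lemma moment_shift_even:
  assumes "hermitian_on N X"
  shows "moment N X ((mapply N X ^^ k) x) j = moment N X x (2 * k + j)"
proof -
  have "cip N ((mapply N X ^^ k) x) ((mapply N X ^^ j) ((mapply N X ^^ k) x))
      = of_real (moment N X x (k + (j + k)))"
    using cip_mapply_pow_split[OF assms, of k x "j + k"] by (simp add: funpow_add)
  then show ?thesis by (simp add: moment_def[of N X "(mapply N X ^^ k) x"] mult_2 add_ac)
qed

text \<open>The common source of the three Cauchy--Schwarz arguments: for a positive semidefinite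
  form, for \<open>cip\<close>, and for square-integrable functions.\<close>

lemma discriminant_le:
  fixes a b c :: real
  assumes c: "0 \<le> c" and quad: "\<And>t. 0 \<le> a + 2 * t * b + t\<^sup>2 * c"
  shows "b\<^sup>2 \<le> a * c"
proof (cases "c = 0")
  case True
  have "b = 0"
  proof (rule ccontr)
    assume "b \<noteq> 0"
    \<comment> \<open>At this \<open>t\<close> the affine function takes the value
      \<open>- 1\<close>.\<close>
    then show False using quad[of "- (a + 1) / (2 * b)"] True by (simp add: field_simps)
  qed
  then show ?thesis using True by simp
next
  case False
  then have "0 < c" using c by simp
  have "0 \<le> a + 2 * (- b / c) * b + (- b / c)\<^sup>2 * c" by (rule quad)
  also have "\<dots> = a - b\<^sup>2 / c" using False by (simp add: field_simps power2_eq_square)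
  finally show ?thesis using \<open>0 < c\<close> by (simp add: field_simps)
qed

lemma psd_on_cauchy_schwarz:
  assumes "psd_on N X"
  shows "(Re (cip N x (mapply N X y)))\<^sup>2 \<le> moment N X x 1 * moment N X y 1"
proof (rule discriminant_le)
  show "0 \<le> moment N X y 1" using assms by (simp add: psd_on_def moment_def)
  fix t :: real
  have herm: "hermitian_on N X" using assms by (simp add: psd_on_def)
  have sym: "Re (cip N y (mapply N X x)) = Re (cip N x (mapply N X y))"
    using cip_mapply[OF herm, of y x] cip_commute[of N "mapply N X y" x] by (metis cnj.sel(1))
  define z where "z = (\<lambda>i. x i + y i * of_real t)"
  have "Re (cip N z (mapply N X z)) = moment N X x 1 + 2 * t * Re (cip N x (mapply N X y)) + t\<^sup>2 * moment N X y 1"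
    unfolding z_def mapply_add mapply_scale cip_add_left cip_add_right cip_scale_left cip_scale_right moment_def
    using sym by (simp add: power2_eq_square ring_distribs)
  moreover have "0 \<le> Re (cip N z (mapply N X z))"
    using assms by (simp add: psd_on_def)
  ultimately show "0 \<le> moment N X x 1 + 2 * t * Re (cip N x (mapply N X y)) + t\<^sup>2 * moment N X y 1"
    by simp
qed

lemma cip_cauchy_schwarz: "(Re (cip N x y))\<^sup>2 \<le> sqn N x * sqn N y"
proof (rule discriminant_le)
  show "0 \<le> sqn N y" by (rule sqn_nonneg)
  fix t :: real
  define z where "z = (\<lambda>i. x i + y i * of_real t)"
  have sym: "Re (cip N y x) = Re (cip N x y)"
    using cip_commute[of N y x] by simp
  have "Re (cip N z z) = sqn N x + 2 * t * Re (cip N x y) + t\<^sup>2 * sqn N y"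
    unfolding z_def cip_add_left cip_add_right cip_scale_left cip_scale_right
    by (simp add: sym cip_self power2_eq_square algebra_simps)
  moreover have "0 \<le> Re (cip N z z)"
    by (simp add: cip_self sqn_nonneg)
  ultimately show "0 \<le> sqn N x + 2 * t * Re (cip N x y) + t\<^sup>2 * sqn N y"
    by simp
qed

lemma moment_nonneg:
  assumes "psd_on N X"
  shows "0 \<le> moment N X x p"
proof -
  have herm: "hermitian_on N X" using assms by (simp add: psd_on_def)
  show ?thesis
  proof (cases "even p")
    case True
    then obtain k where "p = 2 * k" by blast
    then show ?thesis by (simp add: moment_even[OF herm] sqn_nonneg)
  next
    case False
    then obtain k where "p = Suc (2 * k)" by (metis oddE Suc_eq_plus1)
    then have "moment N X x p = Re (cip N ((mapply N X ^^ k) x) (mapply N X ((mapply N X ^^ k) x)))"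
      using moment_odd[OF herm, of x k] by (simp add: moment_def[of N X "(mapply N X ^^ k) x"])
    then show ?thesis using assms by (simp only: psd_on_def)
  qed
qed

text \<open>Cauchy--Schwarz for two consecutive iterates of \<open>x\<close>, in the standard inner
  product if \<open>p\<close> is even and in the semi-inner product defined by \<open>X\<close> if
  \<open>p\<close> is odd. The parity split avoids a square root of \<open>X\<close>.\<close>

lemma moment_log_convex:
  assumes "psd_on N X"
  shows "(moment N X x (Suc p))\<^sup>2 \<le> moment N X x p * moment N X x (Suc (Suc p))"
proof -
  have herm: "hermitian_on N X" using assms by (simp add: psd_on_def)
  have split: "Re (cip N ((mapply N X ^^ i) x) ((mapply N X ^^ j) x)) = moment N X x (i + j)" for i j
    by (simp only: cip_mapply_pow_split[OF herm] Re_complex_of_real)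
  obtain k where "p = k + k \<or> p = Suc (k + k)"
    by (metis oddE evenE mult_2 Suc_eq_plus1)
  then show ?thesis
  proof
    assume p: "p = k + k"
    show ?thesis
      using cip_cauchy_schwarz[of N "(mapply N X ^^ k) x" "(mapply N X ^^ Suc k) x"]
        moment_even[OF herm, of x k] moment_even[OF herm, of x "Suc k"]
      unfolding split p mult_2 add_Suc add_Suc_right by (simp only:)
  next
    assume p: "p = Suc (k + k)"
    have "moment N X ((mapply N X ^^ i) x) 1 = moment N X x (Suc (i + i))" for i
      using moment_odd[OF herm, of x i] by (simp only: mult_2)
    moreover have "mapply N X ((mapply N X ^^ Suc k) x) = (mapply N X ^^ Suc (Suc k)) x"
      by simp
    ultimately show ?thesis
      using psd_on_cauchy_schwarz[OF assms, of "(mapply N X ^^ k) x" "(mapply N X ^^ Suc k) x"]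
      by (simp only: split p add_Suc add_Suc_right)
  qed
qed

section \<open>Log-convex sequences of nonnegative reals\<close>

lemma log_convex_shift:
  fixes b :: "nat \<Rightarrow> real"
  assumes nn: "\<And>j. 0 \<le> b j" and lc: "\<And>j. (b (Suc j))\<^sup>2 \<le> b j * b (Suc (Suc j))"
  shows "b (Suc l) * b (l + m) \<le> b l * b (Suc (l + m))"
proof (induction m)
  case (Suc m)
  show ?case
  proof (cases "b (l + m) = 0")
    case True
    \<comment> \<open>Division by \<open>b (l + m)\<close> is impossible here, but log-convexity
      makes the next term vanish as well.\<close>
    then have "b (Suc (l + m)) = 0" using lc[of "l + m"] by simp
    then show ?thesis using nn by simp
  next
    case False
    then have pos: "0 < b (l + m)" using nn[of "l + m"] by simp
    have "b (Suc l) * b (Suc (l + m)) * b (l + m) \<le> b l * (b (Suc (l + m)))\<^sup>2"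
      using mult_right_mono[OF Suc nn[of "Suc (l + m)"]] by (simp add: power2_eq_square mult_ac)
    also have "\<dots> \<le> b l * (b (l + m) * b (Suc (Suc (l + m))))"
      using lc nn by (intro mult_left_mono)
    finally show ?thesis using pos by (simp add: mult_ac)
  qed
qed simp

text \<open>In logarithms this is the superadditivity of a convex sequence normalised at
  \<open>0\<close>. The induction pushes two indices with fixed sum apart until one of them is
  \<open>0\<close>.\<close>

lemma log_convex_mult_le:
  fixes b :: "nat \<Rightarrow> real"
  assumes nn: "\<And>j. 0 \<le> b j" and lc: "\<And>j. (b (Suc j))\<^sup>2 \<le> b j * b (Suc (Suc j))"
  shows "b j * b l \<le> b 0 * b (j + l)"
proof -
  have *: "b l * b (l + m) \<le> b 0 * b (l + (l + m))" for l m
  proof (induction l arbitrary: m)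
    case (Suc l)
    have "b (Suc l) * b (Suc l + m) \<le> b l * b (l + (m + 2))"
      using log_convex_shift[of b l "Suc m", OF nn lc] by simp
    also have "\<dots> \<le> b 0 * b (l + (l + (m + 2)))" by (rule Suc)
    finally show ?case by simp
  qed simp
  show ?thesis
  proof (cases "l \<le> j")
    case True
    then have "l + (j - l) = j" by simp
    then show ?thesis using *[of l "j - l"] by (simp only: mult.commute[of "b j"] add.commute[of j])
  next
    case False
    then have "j + (l - j) = l" by simp
    then show ?thesis using *[of j "l - j"] by (simp only:)
  qed
qed

text \<open>Ratios of consecutive terms increase, so a lower bound on the first ratio holds for all
  of them. For moments this carries a lower bound on the quadratic form of \<open>X\<close> to all
  powers.\<close>

lemma log_convex_lower:
  fixes b :: "nat \<Rightarrow> real"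
  assumes nn: "\<And>j. 0 \<le> b j" and lc: "\<And>j. (b (Suc j))\<^sup>2 \<le> b j * b (Suc (Suc j))"
    and eps: "e * b 0 \<le> b 1"
  shows "e * b j \<le> b (Suc j)"
proof (cases "b 0 = 0")
  case True
  have "b j = 0" for j
  proof (cases j)
    case (Suc i)
    have "(b j)\<^sup>2 \<le> b 0 * b (2 * j)"
      using log_convex_mult_le[of b j j, OF nn lc] by (simp add: power2_eq_square mult_2)
    then show ?thesis using True by simp
  qed (use True in simp)
  then show ?thesis by simp
next
  case False
  then have "0 < b 0" using nn[of 0] by simp
  have "e * b j * b 0 \<le> b 1 * b j"
    using mult_right_mono[OF eps nn[of j]] by (simp add: mult_ac)
  also have "\<dots> \<le> b 0 * b (Suc j)"
    using log_convex_mult_le[of b 1 j, OF nn lc] by simp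
  finally show ?thesis using \<open>0 < b 0\<close> by (simp add: mult.commute)
qed

section \<open>Rank-one updates\<close>

locale rank_one_update =
  fixes N :: nat and A B :: "nat \<Rightarrow> nat \<Rightarrow> complex" and a :: "nat \<Rightarrow> complex"
  assumes psd_B: "psd_on N B"
    and update: "A i j = B i j + a i * cnj (a j)"
begin

text \<open>The \<open>G i j\<close> of the overview.\<close>

definition mixed :: "nat \<Rightarrow> nat \<Rightarrow> real" where
  "mixed i j = Re (cip N a ((mapply N A ^^ i) ((mapply N B ^^ j) a)))"

text \<open>The real part of the trace of \<open>A ^ i B ^ j\<close>, with the powers of
  \<open>B\<close> moved to the left argument. For fixed \<open>i + j = p\<close> it passes from the
  trace of \<open>B ^ p\<close> to that of \<open>A ^ p\<close> as \<open>i\<close> grows.\<close>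

definition mixed_trace :: "nat \<Rightarrow> nat \<Rightarrow> real" where
  "mixed_trace i j =
     (\<Sum>k<N. Re (cip N ((mapply N B ^^ j) (unit_fun k)) ((mapply N A ^^ i) (unit_fun k))))"

lemma herm_B: "hermitian_on N B"
  using psd_B by (simp add: psd_on_def)

lemma herm_A: "hermitian_on N A"
  unfolding hermitian_on_def
proof (intro allI impI)
  fix i j assume "i < N" "j < N"
  then have "B i j = cnj (B j i)" using herm_B unfolding hermitian_on_def by blast
  then show "A i j = cnj (A j i)" by (simp add: update)
qed

lemma mapply_A: "mapply N A y = (\<lambda>i. mapply N B y i + a i * cip N a y)"
  by (simp add: mapply_def cip_def update algebra_simps sum.distrib sum_distrib_left)

lemma mapply_pow_add:
  "(mapply N X ^^ p) (\<lambda>i. x i + y i) = (\<lambda>i. (mapply N X ^^ p) x i + (mapply N X ^^ p) y i)"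
  by (induction p) (simp_all add: mapply_add)

lemma mapply_pow_scale: "(mapply N X ^^ p) (\<lambda>i. x i * c) = (\<lambda>i. (mapply N X ^^ p) x i * c)"
  by (induction p) (simp_all add: mapply_scale)

lemma mixed_0: "mixed 0 j = moment N B a j"
  by (simp add: mixed_def moment_def)

lemma moment_A: "moment N A a i = mixed i 0"
  by (simp add: mixed_def moment_def)

text \<open>Only the innermost factor \<open>A\<close>, the one next to \<open>B ^ j a\<close>, is
  expanded: it yields \<open>B ^ (j + 1) a\<close> plus a multiple of \<open>a\<close>.\<close>

lemma mixed_Suc: "mixed (Suc i) j = mixed i (Suc j) + mixed i 0 * moment N B a j"
proof -
  have b: "cip N a ((mapply N B ^^ j) a) = of_real (moment N B a j)"
    using cip_mapply_pow_split[OF herm_B, of 0 a j] by simp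
  have "(mapply N A ^^ Suc i) ((mapply N B ^^ j) a)
      = (mapply N A ^^ i) (\<lambda>k. (mapply N B ^^ Suc j) a k + a k * of_real (moment N B a j))"
    by (simp add: funpow_swap1 mapply_A b)
  then show ?thesis
    by (simp only: mixed_def mapply_pow_add mapply_pow_scale cip_add_right cip_scale_right) simp
qed

text \<open>The matrix \<open>A ^ i B ^ j\<close> is not Hermitian in general, so positivity is not
  automatic. The recursion expresses \<open>mixed\<close> as a polynomial in moments of
  \<open>B\<close> with nonnegative coefficients.\<close>

lemma mixed_nonneg: "0 \<le> mixed i j"
  by (induction i arbitrary: j) (simp_all add: mixed_0 mixed_Suc moment_nonneg[OF psd_B])

text \<open>Log-convexity of the moments is all that is needed of the spectral calculus. This inequality, with
  its consequence \<open>mixed (i + 1) j \<le> (1 + R / e) * mixed i (j + 1)\<close> below, plays the role of the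
  Golden--Thompson inequality.\<close>

lemma moment_mult_mixed_le: "moment N B a j * mixed i l \<le> sqn N a * mixed i (j + l)"
proof (induction i arbitrary: l j)
  case 0
  show ?case
    using log_convex_mult_le[of "moment N B a" j l] moment_nonneg[OF psd_B] moment_log_convex[OF psd_B]
    by (simp add: mixed_0 moment_0)
next
  case (Suc i)
  have "moment N B a j * moment N B a l \<le> sqn N a * moment N B a (j + l)"
    using log_convex_mult_le[of "moment N B a" j l] moment_nonneg[OF psd_B] moment_log_convex[OF psd_B]
    by (simp add: moment_0)
  then have "mixed i 0 * (moment N B a j * moment N B a l) \<le> mixed i 0 * (sqn N a * moment N B a (j + l))"
    by (rule mult_left_mono) (rule mixed_nonneg)
  with Suc[of j "Suc l"] show ?case by (simp add: mixed_Suc algebra_simps)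
qed

context
  fixes e R :: real
  assumes e: "0 < e" "\<And>x. e * sqn N x \<le> moment N B x 1" and R: "sqn N a \<le> R"
begin

lemma moment_ge: "e * moment N B x j \<le> moment N B x (Suc j)"
  using log_convex_lower[of "moment N B x" e j] moment_nonneg[OF psd_B] moment_log_convex[OF psd_B] e(2)[of x]
  by (simp add: moment_0)

lemma mixed_ge: "e * mixed i j \<le> mixed i (Suc j)"
proof (induction i arbitrary: j)
  case 0
  show ?case by (simp add: mixed_0 moment_ge)
next
  case (Suc i)
  have "mixed i 0 * (e * moment N B a j) \<le> mixed i 0 * moment N B a (Suc j)"
    by (intro mult_left_mono moment_ge mixed_nonneg)
  with Suc[of "Suc j"] show ?case by (simp add: mixed_Suc algebra_simps)
qed

text \<open>The correction term of \<open>mixed_Suc\<close> is at most \<open>R * mixed i j\<close>,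
  and the lower bound on \<open>B\<close> supplies the missing power of \<open>B\<close> at the
  price of \<open>1 / e\<close>.\<close>

lemma mixed_step: "mixed (Suc i) j \<le> (1 + R / e) * mixed i (Suc j)"
proof -
  have "mixed i 0 * moment N B a j \<le> sqn N a * mixed i j"
    using moment_mult_mixed_le[of j i 0] by (simp add: mult.commute)
  also have "\<dots> \<le> R * mixed i j"
    using R by (intro mult_right_mono mixed_nonneg)
  also have "\<dots> \<le> R * (mixed i (Suc j) / e)"
  proof (intro mult_left_mono)
    show "mixed i j \<le> mixed i (Suc j) / e"
      using mixed_ge[of i j] e by (simp add: field_simps)
    show "0 \<le> R" using R sqn_nonneg[of N a] by simp
  qed
  finally show ?thesis by (simp add: mixed_Suc algebra_simps)
qed

lemma rho_ge_1: "1 \<le> 1 + R / e"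
  using R sqn_nonneg[of N a] e by simp

lemma mixed_le: "mixed i j \<le> (1 + R / e) ^ i * moment N B a (i + j)"
proof (induction i arbitrary: j)
  case (Suc i)
  have "mixed (Suc i) j \<le> (1 + R / e) * mixed i (Suc j)" by (rule mixed_step)
  also have "\<dots> \<le> (1 + R / e) * ((1 + R / e) ^ i * moment N B a (i + Suc j))"
    using rho_ge_1 by (intro mult_left_mono Suc) simp
  finally show ?case by simp
qed (simp add: mixed_0)

text \<open>The exchange in the opposite direction. It bounds \<open>mixed\<close> from below in
  terms of \<open>A\<close>, which for \<open>c I - S\<close> is the matrix before the new vector is
  subtracted.\<close>

lemma moment_le_mixed: "moment N A a (i + j) \<le> (1 + R / e) ^ j * mixed i j"
proof (induction j arbitrary: i)
  case (Suc j)
  have "moment N A a (Suc i + j) \<le> (1 + R / e) ^ j * mixed (Suc i) j" by (rule Suc)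
  also have "\<dots> \<le> (1 + R / e) ^ j * ((1 + R / e) * mixed i (Suc j))"
    using rho_ge_1 by (intro mult_left_mono mixed_step) simp
  finally show ?case by (simp add: mult_ac)
qed (simp add: moment_A)

end

text \<open>The outermost factor of \<open>A ^ (i + 1)\<close> is expanded. Its rank-one part
  contributes \<open>B ^ j a\<close> times the adjoint of \<open>A ^ i a\<close>, a matrix with
  trace \<open>mixed i j\<close> up to the imaginary part.\<close>

lemma mixed_trace_Suc: "mixed_trace (Suc i) j = mixed_trace i (Suc j) + mixed i j"
proof -
  have 1: "cip N ((mapply N B ^^ j) (unit_fun k)) ((mapply N A ^^ Suc i) (unit_fun k))
     = cip N ((mapply N B ^^ Suc j) (unit_fun k)) ((mapply N A ^^ i) (unit_fun k))
       + cnj ((mapply N A ^^ i) a k) * (mapply N B ^^ j) a k" if "k < N" for k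
  proof -
    have "cip N a ((mapply N A ^^ i) (unit_fun k)) = cip N ((mapply N A ^^ i) a) (unit_fun k)"
      by (simp add: cip_mapply_pow[OF herm_A])
    also have "\<dots> = cnj (cip N (unit_fun k) ((mapply N A ^^ i) a))" by (rule cip_commute)
    finally have *: "cip N a ((mapply N A ^^ i) (unit_fun k)) = cnj ((mapply N A ^^ i) a k)"
      using that by (simp add: cip_unit_left)
    have "cip N ((mapply N B ^^ j) (unit_fun k)) a = (mapply N B ^^ j) a k"
      using that by (simp add: cip_mapply_pow[OF herm_B] cip_unit_left)
    moreover have "(mapply N A ^^ Suc i) (unit_fun k) = (\<lambda>l. mapply N B ((mapply N A ^^ i) (unit_fun k)) l
        + a l * cnj ((mapply N A ^^ i) a k))"
      by (simp add: mapply_A *)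
    ultimately show ?thesis
      by (simp only: cip_add_right cip_scale_right) (simp add: cip_mapply[OF herm_B])
  qed
  have "mixed i j = Re (cip N ((mapply N A ^^ i) a) ((mapply N B ^^ j) a))"
    by (simp add: mixed_def cip_mapply_pow[OF herm_A])
  also have "\<dots> = (\<Sum>k<N. Re (cnj ((mapply N A ^^ i) a k) * (mapply N B ^^ j) a k))"
    by (simp add: cip_def)
  finally show ?thesis
    by (simp only: mixed_trace_def sum.distrib[symmetric]) (intro sum.cong refl, simp add: 1 del: funpow.simps)
qed

lemma mixed_trace_eq: "mixed_trace n j = mixed_trace 0 (n + j) + (\<Sum>i<n. mixed i (n + j - 1 - i))"
proof (induction n arbitrary: j)
  case (Suc n)
  have "n + Suc j - 1 = Suc n + j - 1" by simp
  then show ?case by (simp add: mixed_trace_Suc Suc)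
qed simp

lemma pow_trace_update: "pow_trace N A p = pow_trace N B p + (\<Sum>i<p. mixed i (p - 1 - i))"
proof -
  have "mixed_trace p 0 = pow_trace N A p"
    by (simp add: mixed_trace_def pow_trace_def moment_def)
  moreover have "mixed_trace 0 p = pow_trace N B p"
    by (simp add: mixed_trace_def pow_trace_def moment_def cip_mapply_pow[OF herm_B])
  ultimately show ?thesis using mixed_trace_eq[of p 0] by simp
qed

lemma pow_trace_update_le:
  assumes e: "0 < e" "\<And>x. e * sqn N x \<le> moment N B x 1" and R: "sqn N a \<le> R"
  shows "pow_trace N A p \<le> pow_trace N B p + (\<Sum>i<p. (1 + R / e) ^ i) * moment N B a (p - 1)"
proof -
  have "mixed i (p - 1 - i) \<le> (1 + R / e) ^ i * moment N B a (p - 1)" if "i < p" for i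
    using mixed_le[OF e R, of i "p - 1 - i"] that by simp
  then show ?thesis
    unfolding pow_trace_update sum_distrib_right by (intro add_left_mono sum_mono) simp
qed

text \<open>The update is read backwards here: the trace of the smaller matrix \<open>B\<close> is
  bounded by quantities of the larger matrix \<open>A\<close>, as is needed when vectors are
  subtracted.\<close>

lemma pow_trace_update_ge:
  assumes e: "0 < e" "\<And>x. e * sqn N x \<le> moment N B x 1" and R: "sqn N a \<le> R"
  shows "pow_trace N B p + (\<Sum>i<p. inverse (1 + R / e) ^ i) * moment N A a (p - 1) \<le> pow_trace N A p"
proof -
  have "inverse (1 + R / e) ^ (p - Suc i) * moment N A a (p - 1) \<le> mixed i (p - 1 - i)" if "i < p" for i
  proof -
    have "0 < (1 + R / e) ^ (p - Suc i)" using rho_ge_1[OF e R] by (intro zero_less_power) linarith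
    then show ?thesis
      using moment_le_mixed[OF e R, of i "p - 1 - i"] that
      by (simp add: power_inverse field_simps)
  qed
  then have "(\<Sum>i<p. inverse (1 + R / e) ^ (p - Suc i) * moment N A a (p - 1)) \<le> (\<Sum>i<p. mixed i (p - 1 - i))"
    by (intro sum_mono) simp
  then show ?thesis
    unfolding pow_trace_update sum_distrib_right
    \<comment> \<open>\<open>moment_le_mixed\<close> yields the power \<open>p - 1 - i\<close> in
      the \<open>i\<close>-th term, so the sum is reversed.\<close>
    by (subst (asm) sum.nat_diff_reindex[of "\<lambda>i. inverse (1 + R / e) ^ i * moment N A a (p - 1)" p]) simp
qed

end

section \<open>Gram sums shifted by a multiple of the identity\<close>

lemma cip_cauchy_schwarz_cmod: "(cmod (cip N x y))\<^sup>2 \<le> sqn N x * sqn N y"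
proof (cases "cip N x y = 0")
  case False
  \<comment> \<open>Scaling \<open>y\<close> by the conjugate of \<open>w\<close> turns the inner
    product into the real number \<open>(cmod w)\<^sup>2\<close>, to which the bound for real parts
    applies.\<close>
  define w where "w = cip N x y"
  have "cip N x (\<lambda>i. y i * cnj w) = of_real ((cmod w)\<^sup>2)"
    by (simp only: cip_scale_right w_def[symmetric] complex_norm_square) (rule mult.commute)
  then have "((cmod w)\<^sup>2)\<^sup>2 \<le> sqn N x * ((cmod w)\<^sup>2 * sqn N y)"
    using cip_cauchy_schwarz[of N x "\<lambda>i. y i * cnj w"] by (simp add: sqn_scale del: of_real_power)
  then show ?thesis using False by (simp add: w_def power2_eq_square mult_ac)
qed (simp add: sqn_nonneg)

definition shifted_gram :: "real \<Rightarrow> real \<Rightarrow> nat \<Rightarrow> (nat \<Rightarrow> nat \<Rightarrow> complex) \<Rightarrow> nat \<Rightarrow> nat \<Rightarrow> complex" where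
  "shifted_gram c s n v = (\<lambda>i j. (if i = j then of_real c else 0) + of_real s * (\<Sum>m<n. v m i * cnj (v m j)))"

text \<open>The quadratic form, at \<open>x\<close>, of the sum of the \<open>v m\<close> times
  their adjoints. Frame bounds are eigenvalue bounds for this sum.\<close>

definition frame_sum :: "nat \<Rightarrow> nat \<Rightarrow> (nat \<Rightarrow> nat \<Rightarrow> complex) \<Rightarrow> (nat \<Rightarrow> complex) \<Rightarrow> real" where
  "frame_sum N n v x = (\<Sum>m<n. (cmod (cip N (v m) x))\<^sup>2)"

lemma frame_sum_nonneg: "0 \<le> frame_sum N n v x"
  by (simp add: frame_sum_def sum_nonneg)

lemma frame_sum_le:
  assumes "\<And>m. m < n \<Longrightarrow> sqn N (v m) \<le> R"
  shows "frame_sum N n v x \<le> real n * R * sqn N x"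
proof -
  have "frame_sum N n v x \<le> (\<Sum>m<n. R * sqn N x)"
    unfolding frame_sum_def
    by (intro sum_mono order_trans[OF cip_cauchy_schwarz_cmod] mult_right_mono sqn_nonneg assms) simp
  then show ?thesis by simp
qed

lemma hermitian_shifted_gram: "hermitian_on N (shifted_gram c s n v)"
  by (auto simp: hermitian_on_def shifted_gram_def mult.commute)

lemma mapply_shifted_gram:
  assumes "i < N"
  shows "mapply N (shifted_gram c s n v) x i = x i * of_real c + of_real s * (\<Sum>m<n. v m i * cip N (v m) x)"
proof -
  have "mapply N (shifted_gram c s n v) x i
     = (\<Sum>k<N. if i = k then x k * of_real c else 0) + (\<Sum>k<N. of_real s * (\<Sum>m<n. v m i * cnj (v m k)) * x k)"
    unfolding mapply_def shifted_gram_def sum.distrib[symmetric]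
    by (intro sum.cong refl) (auto simp: algebra_simps)
  also have "(\<Sum>k<N. of_real s * (\<Sum>m<n. v m i * cnj (v m k)) * x k)
     = of_real s * (\<Sum>k<N. \<Sum>m<n. v m i * (cnj (v m k) * x k))"
    by (simp add: sum_distrib_left sum_distrib_right mult_ac)
  also have "(\<Sum>k<N. \<Sum>m<n. v m i * (cnj (v m k) * x k)) = (\<Sum>m<n. v m i * cip N (v m) x)"
    by (subst sum.swap) (simp add: cip_def sum_distrib_left)
  finally show ?thesis using assms by simp
qed

lemma moment_shifted_gram: "moment N (shifted_gram c s n v) x 1 = c * sqn N x + s * frame_sum N n v x"
proof -
  have "cip N x (mapply N (shifted_gram c s n v) x)
      = cip N x (\<lambda>i. x i * of_real c + (\<Sum>m<n. v m i * cip N (v m) x) * of_real s)"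
    by (rule cip_cong) (simp_all add: mapply_shifted_gram mult.commute)
  also have "\<dots> = of_real c * cip N x x + of_real s * (\<Sum>m<n. cip N (v m) x * cip N x (v m))"
    by (simp only: cip_add_right cip_scale_right cip_sum_right)
  also have "(\<Sum>m<n. cip N (v m) x * cip N x (v m)) = of_real (frame_sum N n v x)"
    unfolding frame_sum_def of_real_sum
    by (intro sum.cong refl) (simp only: complex_norm_square cip_commute[of N x])
  finally show ?thesis by (simp add: moment_def cip_self)
qed

lemma psd_shifted_gram_plus:
  assumes "0 \<le> c"
  shows "psd_on N (shifted_gram c 1 n v)"
  using moment_shifted_gram[of N c 1 n v] assms sqn_nonneg[of N] frame_sum_nonneg[of N n v]
  by (simp add: psd_on_def hermitian_shifted_gram moment_def)

text \<open>The worst case \<open>real n * R\<close> is crude, but it only restricts the shift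
  \<open>c\<close> from below, and the shift tends to infinity in the end.\<close>

lemma psd_shifted_gram_minus:
  assumes "\<And>m. m < n \<Longrightarrow> sqn N (v m) \<le> R" "real n * R \<le> c"
  shows "psd_on N (shifted_gram c (-1) n v)"
proof -
  have "frame_sum N n v x \<le> c * sqn N x" for x
    using frame_sum_le[of n N v R, OF assms(1)] mult_right_mono[OF assms(2) sqn_nonneg[of N x]]
    by (meson order_trans)
  then show ?thesis using moment_shifted_gram[of N c "-1" n v]
    by (simp add: psd_on_def hermitian_shifted_gram moment_def)
qed

text \<open>Log-convexity bounds ratios of moments from below only, so the upper bound needs its own
  argument. For even \<open>j\<close> the hypothesis is applied to an iterate of \<open>x\<close>.
  For odd \<open>j\<close> the square of \<open>X\<close> is compared with \<open>c\<close> times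
  \<open>X\<close>, by Cauchy--Schwarz in the form of \<open>X\<close> and cancellation.\<close>

lemma moment_le:
  assumes psd: "psd_on N X" and le: "\<And>x. moment N X x 1 \<le> c * sqn N x"
  shows "moment N X x (Suc j) \<le> c * moment N X x j"
proof -
  have herm: "hermitian_on N X" using psd by (simp add: psd_on_def)
  have two: "moment N X y 2 \<le> c * moment N X y 1" for y
  proof (cases "moment N X y 2 = 0")
    case False
    have eq: "moment N X y 2 = sqn N (mapply N X y)"
      using moment_even[OF herm, of y 1] by simp
    have nn: "0 \<le> moment N X y 2" "0 \<le> moment N X y 1"
      using moment_nonneg[OF psd] by blast+
    have "(moment N X y 2)\<^sup>2 \<le> moment N X (mapply N X y) 1 * moment N X y 1"
      using psd_on_cauchy_schwarz[OF psd, of "mapply N X y" y] by (simp add: eq cip_self)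
    also have "\<dots> \<le> c * moment N X y 2 * moment N X y 1"
      using le[of "mapply N X y"] nn by (intro mult_right_mono) (simp_all add: eq)
    finally show ?thesis using False nn by (simp add: power2_eq_square mult_ac)
  next
    case True
    have "(moment N X y 1)\<^sup>2 \<le> moment N X y 0 * moment N X y 2"
      using moment_log_convex[OF psd, of y 0] by (simp add: numeral_2_eq_2)
    with True have "moment N X y 1 = 0" by simp
    with True show ?thesis by simp
  qed
  show ?thesis
  proof (cases "even j")
    case True
    then obtain k where "j = 2 * k" by blast
    then show ?thesis
      using le[of "(mapply N X ^^ k) x"] moment_shift_even[OF herm, of k x 1] moment_even[OF herm, of x k] by simp
  next
    case False
    then obtain k where "j = 2 * k + 1" by (rule oddE)
    then show ?thesis
      using two[of "(mapply N X ^^ k) x"] moment_shift_even[OF herm, of k x 1] moment_shift_even[OF herm, of k x 2]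
      by simp
  qed
qed

text \<open>Log-convexity gives Jensen's inequality for the unit vector \<open>x\<close>. The even
  moment is then the squared norm of the \<open>r\<close>-th iterate, which the Hilbert--Schmidt
  norm of \<open>X ^ r\<close> dominates. So the trace controls the largest eigenvalue without
  naming it.\<close>

lemma moment_power_le_trace:
  assumes psd: "psd_on N X" and x: "sqn N x = 1"
  shows "(moment N X x 1) ^ (2 * r) \<le> pow_trace N X (2 * r)"
proof -
  have herm: "hermitian_on N X" using psd by (simp add: psd_on_def)
  have nn: "0 \<le> moment N X x j" for j by (rule moment_nonneg[OF psd])
  have "(moment N X x 1) ^ j \<le> moment N X x j" for j
  proof (induction j)
    case (Suc j)
    have "(moment N X x 1) ^ Suc j \<le> moment N X x 1 * moment N X x j"
      using Suc nn[of 1] by (simp add: mult_left_mono)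
    also have "\<dots> \<le> moment N X x (Suc j)"
      using log_convex_mult_le[of "moment N X x" 1 j] nn moment_log_convex[OF psd] by (simp add: moment_0 x)
    finally show ?case .
  qed (simp add: moment_0 x)
  then have "(moment N X x 1) ^ (2 * r) \<le> moment N X x (2 * r)" .
  also have "\<dots> = (\<Sum>i<N. (cmod ((mapply N X ^^ r) x i))\<^sup>2)"
    by (simp add: moment_even[OF herm] sqn_def)
  also have "\<dots> \<le> (\<Sum>i<N. moment N X (unit_fun i) (2 * r))"
  proof (rule sum_mono)
    fix i assume "i \<in> {..<N}"
    then have "(mapply N X ^^ r) x i = cip N ((mapply N X ^^ r) (unit_fun i)) x"
      by (simp add: cip_mapply_pow[OF herm] cip_unit_left)
    then show "(cmod ((mapply N X ^^ r) x i))\<^sup>2 \<le> moment N X (unit_fun i) (2 * r)"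
      using cip_cauchy_schwarz_cmod[of N "(mapply N X ^^ r) (unit_fun i)" x]
      by (simp add: moment_even[OF herm] x)
  qed
  finally show ?thesis by (simp add: pow_trace_def)
qed

text \<open>The moment becomes linear in the products \<open>cnj (x i) * x k\<close>, whose
  expectations are prescribed for an isotropic vector.\<close>

lemma moment_expand:
  "moment N X x p = Re (\<Sum>i<N. \<Sum>k<N. (mapply N X ^^ p) (unit_fun k) i * (cnj (x i) * x k))"
proof -
  have "(mapply N X ^^ p) x i = (\<Sum>k<N. x k * (mapply N X ^^ p) (unit_fun k) i)" if "i < N" for i
    using that
  proof (induction p arbitrary: i)
    case 0
    then show ?case by (simp add: unit_fun_def if_distrib[of "\<lambda>c. _ * c"] cong: if_cong)
  next
    case (Suc p)
    have "(mapply N X ^^ Suc p) x i = (\<Sum>l<N. X i l * (mapply N X ^^ p) x l)"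
      by (simp add: mapply_def)
    also have "\<dots> = (\<Sum>l<N. \<Sum>k<N. X i l * (x k * (mapply N X ^^ p) (unit_fun k) l))"
      by (intro sum.cong refl) (simp add: Suc.IH sum_distrib_left)
    also have "\<dots> = (\<Sum>k<N. \<Sum>l<N. X i l * (x k * (mapply N X ^^ p) (unit_fun k) l))"
      by (rule sum.swap)
    also have "\<dots> = (\<Sum>k<N. x k * (mapply N X ^^ Suc p) (unit_fun k) i)"
      by (simp add: mapply_def sum_distrib_left mult_ac)
    finally show ?case .
  qed
  then show ?thesis
    unfolding moment_def cip_def
    by (intro arg_cong[where f = Re] sum.cong refl) (simp add: sum_distrib_left mult_ac)
qed

section \<open>Expected traces of random Gram matrices\<close>

lemma borel_measurable_cnj [measurable]: "cnj \<in> borel_measurable borel"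
  by (intro borel_measurable_continuous_onI continuous_intros)

lemma shifted_gram_Suc:
  "shifted_gram c s (Suc n) v i j = shifted_gram c s n v i j + of_real s * (v n i * cnj (v n j))"
  by (simp add: shifted_gram_def algebra_simps)

lemma shifted_gram_cong: "(\<And>m. m < n \<Longrightarrow> v m = v' m) \<Longrightarrow> shifted_gram c s n v = shifted_gram c s n v'"
  by (simp add: shifted_gram_def)

lemma pow_trace_nonneg: "psd_on N X \<Longrightarrow> 0 \<le> pow_trace N X p"
  by (simp add: pow_trace_def sum_nonneg moment_nonneg)

text \<open>The bound \<open>R\<close> holds at every point rather than almost everywhere, so that
  positive semidefiniteness of \<open>c I - S\<close> is a pointwise statement.\<close>

locale isotropic_vector = prob_space \<mu> for \<mu> :: "'s measure" +
  fixes N :: nat and a :: "'s \<Rightarrow> nat \<Rightarrow> complex" and R \<kappa> :: real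
  assumes R: "\<And>s. s \<in> space \<mu> \<Longrightarrow> sqn N (a s) \<le> R"
    and meas: "\<And>i. i < N \<Longrightarrow> (\<lambda>s. a s i) \<in> borel_measurable \<mu>"
    and second_moment: "\<And>i k. i < N \<Longrightarrow> k < N \<Longrightarrow>
      (\<integral>s. cnj (a s i) * a s k \<partial>\<mu>) = (if i = k then of_real \<kappa> else 0)"
begin

lemma R_nonneg: "0 \<le> R"
proof -
  obtain s where "s \<in> space \<mu>" using not_empty by blast
  then show ?thesis using R[of s] sqn_nonneg[of N "a s"] by simp
qed

lemma cmod_le: "s \<in> space \<mu> \<Longrightarrow> i < N \<Longrightarrow> cmod (a s i) \<le> sqrt R"
proof (rule real_le_rsqrt)
  assume s: "s \<in> space \<mu>" and i: "i < N"
  have "(cmod (a s i))\<^sup>2 \<le> sqn N (a s)"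
    unfolding sqn_def using i by (intro member_le_sum) auto
  with R[OF s] show "(cmod (a s i))\<^sup>2 \<le> R" by simp
qed

lemma integrable_product: "i < N \<Longrightarrow> k < N \<Longrightarrow> integrable \<mu> (\<lambda>s. cnj (a s i) * a s k)"
proof (rule integrable_const_bound[where B = R])
  assume i: "i < N" and k: "k < N"
  show "AE s in \<mu>. cmod (cnj (a s i) * a s k) \<le> R"
  proof (rule AE_I2)
    fix s assume "s \<in> space \<mu>"
    then have "cmod (cnj (a s i) * a s k) \<le> sqrt R * sqrt R"
      unfolding norm_mult complex_mod_cnj using i k R_nonneg by (intro mult_mono cmod_le) auto
    then show "cmod (cnj (a s i) * a s k) \<le> R" using R_nonneg by simp
  qed
  have [measurable]: "(\<lambda>s. a s i) \<in> borel_measurable \<mu>" "(\<lambda>s. a s k) \<in> borel_measurable \<mu>"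
    using meas i k by auto
  show "(\<lambda>s. cnj (a s i) * a s k) \<in> borel_measurable \<mu>"
    by (intro borel_measurable_times measurable_compose[OF _ borel_measurable_cnj]) simp_all
qed

lemma integrable_moment: "integrable \<mu> (\<lambda>s. moment N X (a s) p)"
  unfolding moment_expand
  by (intro integrable_Re Bochner_Integration.integrable_sum integrable_mult_right integrable_product) auto

lemma integral_moment: "(\<integral>s. moment N X (a s) p \<partial>\<mu>) = \<kappa> * pow_trace N X p"
proof -
  have "(\<integral>s. moment N X (a s) p \<partial>\<mu>)
      = Re (\<integral>s. (\<Sum>i<N. \<Sum>k<N. (mapply N X ^^ p) (unit_fun k) i * (cnj (a s i) * a s k)) \<partial>\<mu>)"
    unfolding moment_expand
    by (intro integral_Re Bochner_Integration.integrable_sum integrable_mult_right integrable_product) auto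
  also have "(\<integral>s. (\<Sum>i<N. \<Sum>k<N. (mapply N X ^^ p) (unit_fun k) i * (cnj (a s i) * a s k)) \<partial>\<mu>)
      = (\<Sum>i<N. \<Sum>k<N. (mapply N X ^^ p) (unit_fun k) i * (if i = k then of_real \<kappa> else 0))"
  proof -
    have "(\<integral>s. (\<Sum>i<N. \<Sum>k<N. (mapply N X ^^ p) (unit_fun k) i * (cnj (a s i) * a s k)) \<partial>\<mu>)
        = (\<Sum>i<N. \<integral>s. (\<Sum>k<N. (mapply N X ^^ p) (unit_fun k) i * (cnj (a s i) * a s k)) \<partial>\<mu>)"
      by (intro Bochner_Integration.integral_sum Bochner_Integration.integrable_sum
          integrable_mult_right integrable_product) auto
    also have "\<dots> = (\<Sum>i<N. \<Sum>k<N. \<integral>s. (mapply N X ^^ p) (unit_fun k) i * (cnj (a s i) * a s k) \<partial>\<mu>)"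
      by (intro sum.cong refl Bochner_Integration.integral_sum integrable_mult_right integrable_product) auto
    finally show ?thesis by (simp add: second_moment)
  qed
  also have "\<dots> = (\<Sum>i<N. of_real \<kappa> * (mapply N X ^^ p) (unit_fun i) i)"
    by (intro sum.cong refl) (simp add: if_distrib[of "\<lambda>c. _ * c"] cong: if_cong)
  also have "Re \<dots> = \<kappa> * pow_trace N X p"
    by (simp add: pow_trace_def moment_def cip_unit_left sum_distrib_left)
  finally show ?thesis .
qed

lemma kappa_nonneg: 
  assumes "0 < N"
  shows "0 \<le> \<kappa>"
proof -
  have "0 \<le> (\<integral>s. (cmod (a s 0))\<^sup>2 \<partial>\<mu>)" by simp
  also have "\<dots> = Re (\<integral>s. cnj (a s 0) * a s 0 \<partial>\<mu>)"
    using integrable_product[of 0 0] assms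
    by (subst integral_Re[symmetric]) (auto intro!: Bochner_Integration.integral_cong simp: cmod_power2, simp add: power2_eq_square)
  also have "\<dots> = \<kappa>" using assms by (simp add: second_moment)
  finally show ?thesis .
qed

text \<open>With the earlier vectors fixed, the new term costs at most \<open>C\<close> times a
  moment of order \<open>p - 1\<close>. Its average is a multiple of
  \<open>pow_trace N B (p - 1)\<close>, and \<open>B \<ge> c\<close> raises the order by one at the
  price of \<open>1 / c\<close>. The bound is again a multiple of the trace of order
  \<open>p\<close>, so it can be iterated.\<close>

lemma nn_integral_pow_trace_plus:
  assumes N: "0 < N" and c: "0 < c" and p: "0 < p"
  shows "(\<integral>\<^sup>+s. ennreal (pow_trace N (shifted_gram c 1 (Suc n) (\<lambda>m. a ((w(n := s)) m))) p) \<partial>\<mu>)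
    \<le> ennreal (1 + \<kappa> / c * (\<Sum>i<p. (1 + R / c) ^ i))
       * ennreal (pow_trace N (shifted_gram c 1 n (\<lambda>m. a (w m))) p)"
proof -
  define B where "B = shifted_gram c 1 n (\<lambda>m. a (w m))"
  define C where "C = (\<Sum>i<p. (1 + R / c) ^ i)"
  have psd: "psd_on N B" using c by (simp add: B_def psd_shifted_gram_plus)
  have ge: "c * sqn N x \<le> moment N B x 1" for x
    unfolding B_def moment_shifted_gram using frame_sum_nonneg by simp
  have C: "0 \<le> C" using c R_nonneg by (auto simp: C_def intro!: sum_nonneg)
  have step: "pow_trace N (shifted_gram c 1 (Suc n) (\<lambda>m. a ((w(n := s)) m))) p
      \<le> pow_trace N B p + C * moment N B (a s) (p - 1)" if "s \<in> space \<mu>" for s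
  proof -
    define A where "A = shifted_gram c 1 (Suc n) (\<lambda>m. a ((w(n := s)) m))"
    have "rank_one_update N A B (a s)"
    proof
      fix i j
      have "shifted_gram c 1 n (\<lambda>m. a ((w(n := s)) m)) = B"
        unfolding B_def by (rule shifted_gram_cong) simp
      then show "A i j = B i j + a s i * cnj (a s j)"
        unfolding A_def shifted_gram_Suc by simp
    qed (rule psd)
    then interpret rank_one_update N A B "a s" .
    show ?thesis
      using pow_trace_update_le[OF c ge R[OF that]] by (simp add: A_def C_def)
  qed
  have int: "integrable \<mu> (\<lambda>s. pow_trace N B p + C * moment N B (a s) (p - 1))"
    by (intro Bochner_Integration.integrable_add integrable_mult_right integrable_moment) simp
  have tr0: "0 \<le> pow_trace N B p" by (rule pow_trace_nonneg[OF psd])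
  have "c * pow_trace N B (p - 1) \<le> pow_trace N B p"
  proof -
    \<comment> \<open>The zero vector is a legitimate update; it makes \<open>moment_ge\<close>, a
      statement on \<open>B\<close> alone, available.\<close>
    interpret rank_one_update N "\<lambda>i j. B i j + 0 * cnj 0" B "\<lambda>_. 0"
      by standard (simp_all add: psd)
    show ?thesis
      unfolding pow_trace_def sum_distrib_left
      using moment_ge[OF c ge, of "0" "unit_fun _" "p - 1"] p by (intro sum_mono) (simp add: sqn_def)
  qed
  then have tr1: "pow_trace N B (p - 1) \<le> pow_trace N B p / c"
    using c by (simp add: field_simps)
  have "(\<integral>\<^sup>+s. ennreal (pow_trace N (shifted_gram c 1 (Suc n) (\<lambda>m. a ((w(n := s)) m))) p) \<partial>\<mu>)
      \<le> (\<integral>\<^sup>+s. ennreal (pow_trace N B p + C * moment N B (a s) (p - 1)) \<partial>\<mu>)"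
    by (intro nn_integral_mono ennreal_leI step)
  also have "\<dots> = ennreal (\<integral>s. pow_trace N B p + C * moment N B (a s) (p - 1) \<partial>\<mu>)"
    using tr0 C moment_nonneg[OF psd] by (intro nn_integral_eq_integral int) auto
  also have "(\<integral>s. pow_trace N B p + C * moment N B (a s) (p - 1) \<partial>\<mu>)
      = pow_trace N B p + C * (\<kappa> * pow_trace N B (p - 1))"
    by (simp add: integrable_moment integral_moment prob_space)
  also have "\<dots> \<le> pow_trace N B p + C * (\<kappa> * (pow_trace N B p / c))"
    using C kappa_nonneg[OF N] tr1 by (intro add_left_mono mult_left_mono)
  also have "\<dots> = (1 + \<kappa> / c * C) * pow_trace N B p"
    by (simp add: algebra_simps)
  finally show ?thesis
    using tr0 by (simp add: B_def C_def ennreal_mult'' ennreal_leI)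
qed

text \<open>\<open>A\<close> is the matrix before the new vector is subtracted and \<open>B\<close>
  the one after, so that \<open>A\<close> is the rank-one update of \<open>B\<close>. The bound
  \<open>B \<ge> e\<close> has to survive \<open>Suc n\<close> subtractions, which the hypothesis on
  \<open>c\<close> ensures.\<close>

lemma nn_integral_pow_trace_minus:
  assumes N: "0 < N" and e: "0 < e" "e + real (Suc n) * R \<le> c" and p: "0 < p"
    and w: "\<And>m. m < n \<Longrightarrow> w m \<in> space \<mu>"
  shows "(\<integral>\<^sup>+s. ennreal (pow_trace N (shifted_gram c (-1) (Suc n) (\<lambda>m. a ((w(n := s)) m))) p) \<partial>\<mu>)
    \<le> ennreal (1 - \<kappa> / c * (\<Sum>i<p. inverse (1 + R / e) ^ i))
       * ennreal (pow_trace N (shifted_gram c (-1) n (\<lambda>m. a (w m))) p)"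
proof -
  define A where "A = shifted_gram c (-1) n (\<lambda>m. a (w m))"
  define C where "C = (\<Sum>i<p. inverse (1 + R / e) ^ i)"
  have nR: "real n * R \<le> real (Suc n) * R" using R_nonneg by (intro mult_right_mono) auto
  have c: "0 < c" using e R_nonneg by (smt (verit) of_nat_0_le_iff mult_nonneg_nonneg)
  have psd_A: "psd_on N A"
    unfolding A_def using w R e nR by (intro psd_shifted_gram_minus[where R = R]) auto
  have le: "moment N A x 1 \<le> c * sqn N x" for x
    unfolding A_def moment_shifted_gram using frame_sum_nonneg by simp
  have C: "0 \<le> C" using e R_nonneg by (auto simp: C_def intro!: sum_nonneg)
  have step: "pow_trace N (shifted_gram c (-1) (Suc n) (\<lambda>m. a ((w(n := s)) m))) p
      \<le> pow_trace N A p - C * moment N A (a s) (p - 1)"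
    and nn: "0 \<le> pow_trace N (shifted_gram c (-1) (Suc n) (\<lambda>m. a ((w(n := s)) m))) p"
    if "s \<in> space \<mu>" for s
  proof -
    define v where "v = (\<lambda>m. a ((w(n := s)) m))"
    define B where "B = shifted_gram c (-1) (Suc n) v"
    have v: "sqn N (v m) \<le> R" if "m < Suc n" for m
      using that w R \<open>s \<in> space \<mu>\<close> by (auto simp: v_def less_Suc_eq)
    have psd_B: "psd_on N B"
      unfolding B_def using v e by (intro psd_shifted_gram_minus[where R = R]) auto
    have ge: "e * sqn N x \<le> moment N B x 1" for x
    proof -
      have "frame_sum N (Suc n) v x \<le> (c - e) * sqn N x"
        using frame_sum_le[of "Suc n" N v R x, OF v] e
        by (smt (verit) mult_right_mono sqn_nonneg)
      then show ?thesis unfolding B_def moment_shifted_gram by (simp add: algebra_simps)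
    qed
    have "rank_one_update N A B (a s)"
    proof
      fix i j
      have "shifted_gram c (-1) n v = A"
        unfolding A_def v_def by (rule shifted_gram_cong) simp
      then show "A i j = B i j + a s i * cnj (a s j)"
        unfolding B_def shifted_gram_Suc by (simp add: v_def)
    qed (rule psd_B)
    then interpret rank_one_update N A B "a s" .
    show "pow_trace N (shifted_gram c (-1) (Suc n) (\<lambda>m. a ((w(n := s)) m))) p
      \<le> pow_trace N A p - C * moment N A (a s) (p - 1)"
      using pow_trace_update_ge[OF e(1) ge R[OF that], of p] by (simp add: B_def C_def v_def)
    show "0 \<le> pow_trace N (shifted_gram c (-1) (Suc n) (\<lambda>m. a ((w(n := s)) m))) p"
      using pow_trace_nonneg[OF psd_B] by (simp add: B_def v_def)
  qed
  have int: "integrable \<mu> (\<lambda>s. pow_trace N A p - C * moment N A (a s) (p - 1))"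
    by (intro Bochner_Integration.integrable_diff integrable_mult_right integrable_moment) simp
  have "pow_trace N A p \<le> c * pow_trace N A (p - 1)"
    unfolding pow_trace_def sum_distrib_left
    using moment_le[OF psd_A le, of "unit_fun _" "p - 1"] p by (intro sum_mono) simp
  then have tr1: "pow_trace N A p / c \<le> pow_trace N A (p - 1)"
    using c by (simp add: field_simps)
  have "(\<integral>\<^sup>+s. ennreal (pow_trace N (shifted_gram c (-1) (Suc n) (\<lambda>m. a ((w(n := s)) m))) p) \<partial>\<mu>)
      \<le> (\<integral>\<^sup>+s. ennreal (pow_trace N A p - C * moment N A (a s) (p - 1)) \<partial>\<mu>)"
    by (intro nn_integral_mono ennreal_leI step)
  \<comment> \<open>The integrand dominates the trace of a power of a positive semidefinite matrix,
    so it is nonnegative.\<close>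
  also have "\<dots> = ennreal (\<integral>s. pow_trace N A p - C * moment N A (a s) (p - 1) \<partial>\<mu>)"
    using step nn by (intro nn_integral_eq_integral int AE_I2) (meson order_trans)
  also have "(\<integral>s. pow_trace N A p - C * moment N A (a s) (p - 1) \<partial>\<mu>)
      = pow_trace N A p - C * (\<kappa> * pow_trace N A (p - 1))"
    by (simp add: integrable_moment integral_moment prob_space)
  also have "\<dots> \<le> pow_trace N A p - C * (\<kappa> * (pow_trace N A p / c))"
    using C kappa_nonneg[OF N] tr1 by (intro diff_left_mono mult_left_mono)
  also have "\<dots> = (1 - \<kappa> / c * C) * pow_trace N A p"
    by (simp add: algebra_simps)
  finally show ?thesis
    using pow_trace_nonneg[OF psd_A] by (simp add: A_def C_def ennreal_mult'' ennreal_leI)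
qed

end

lemma measurable_pow_trace:
  assumes "\<And>m i. m < n \<Longrightarrow> i < N \<Longrightarrow> (\<lambda>x. v x m i) \<in> borel_measurable M"
  shows "(\<lambda>x. pow_trace N (shifted_gram c s n (v x)) p) \<in> borel_measurable M"
proof -
  have entry: "(\<lambda>x. shifted_gram c s n (v x) i j) \<in> borel_measurable M" if "i < N" "j < N" for i j
  proof -
    have [measurable]: "(\<lambda>x. v x m i) \<in> borel_measurable M" "(\<lambda>x. v x m j) \<in> borel_measurable M"
      if "m < n" for m
      using assms that \<open>i < N\<close> \<open>j < N\<close> by auto
    have "(\<lambda>x. \<Sum>m<n. v x m i * cnj (v x m j)) \<in> borel_measurable M"
      by (intro borel_measurable_sum borel_measurable_times measurable_compose[OF _ borel_measurable_cnj]) simp_all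
    then show ?thesis unfolding shifted_gram_def by simp
  qed
  have pow: "(\<lambda>x. (mapply N (shifted_gram c s n (v x)) ^^ q) (unit_fun k) i) \<in> borel_measurable M"
    if "i < N" for i k q
    using that
  proof (induction q arbitrary: i)
    case (Suc q)
    then show ?case
      by (simp add: mapply_def) (intro borel_measurable_sum borel_measurable_times entry; simp)
  qed simp
  show ?thesis
    unfolding pow_trace_def moment_def cip_def
    by (intro borel_measurable_sum measurable_compose[OF _ borel_measurable_Re] borel_measurable_times pow) auto
qed

section \<open>Chernoff bounds\<close>

text \<open>The last coordinate is integrated out first. Since \<open>r\<close> does not depend on
  the earlier coordinates, each integration contributes one factor \<open>r\<close>.\<close>

lemma nn_integral_PiM_chain:
  fixes F :: "nat \<Rightarrow> (nat \<Rightarrow> 's) \<Rightarrow> ennreal"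
  assumes "prob_space \<mu>"
    and meas: "\<And>n. n \<le> M \<Longrightarrow> F n \<in> borel_measurable (PiM {..<n} (\<lambda>_. \<mu>))"
    and step: "\<And>n w. n < M \<Longrightarrow> w \<in> space (PiM {..<n} (\<lambda>_. \<mu>)) \<Longrightarrow>
      (\<integral>\<^sup>+s. F (Suc n) (w(n := s)) \<partial>\<mu>) \<le> r * F n w"
    and base: "\<And>w. F 0 w \<le> C"
  shows "(\<integral>\<^sup>+w. F M w \<partial>PiM {..<M} (\<lambda>_. \<mu>)) \<le> r ^ M * C"
proof -
  interpret prob_space \<mu> by fact
  interpret P: product_prob_space "\<lambda>_. \<mu>" UNIV by standard
  have "n \<le> M \<Longrightarrow> (\<integral>\<^sup>+w. F n w \<partial>PiM {..<n} (\<lambda>_. \<mu>)) \<le> r ^ n * C" for n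
  proof (induction n)
    case 0
    show ?case using base by (simp add: P.nn_integral_empty)
  next
    case (Suc n)
    have "(\<integral>\<^sup>+w. F (Suc n) w \<partial>PiM {..<Suc n} (\<lambda>_. \<mu>))
        = (\<integral>\<^sup>+w. (\<integral>\<^sup>+s. F (Suc n) (w(n := s)) \<partial>\<mu>) \<partial>PiM {..<n} (\<lambda>_. \<mu>))"
      using meas[OF Suc.prems] unfolding lessThan_Suc
      by (intro P.product_nn_integral_insert) auto
    also have "\<dots> \<le> (\<integral>\<^sup>+w. r * F n w \<partial>PiM {..<n} (\<lambda>_. \<mu>))"
      using Suc.prems by (intro nn_integral_mono step) auto
    also have "\<dots> = r * (\<integral>\<^sup>+w. F n w \<partial>PiM {..<n} (\<lambda>_. \<mu>))"
      using Suc.prems by (intro nn_integral_cmult meas) simp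
    also have "\<dots> \<le> r * (r ^ n * C)"
      using Suc by (intro mult_left_mono) auto
    finally show ?case by (simp add: mult.assoc)
  qed
  then show ?thesis by simp
qed

text \<open>The discrete analogue, for index functions that take the value \<open>d\<close> outside
  the range and for which every function is measurable.\<close>

lemma nn_integral_Pi_pmf_chain:
  fixes F :: "nat \<Rightarrow> (nat \<Rightarrow> 's) \<Rightarrow> ennreal"
  assumes step: "\<And>n w. n < M \<Longrightarrow> (\<integral>\<^sup>+s. F (Suc n) (w(n := s)) \<partial>measure_pmf \<mu>) \<le> r * F n w"
    and base: "\<And>w. F 0 w \<le> C"
  shows "(\<integral>\<^sup>+w. F M w \<partial>measure_pmf (Pi_pmf {..<M} d (\<lambda>_. \<mu>))) \<le> r ^ M * C"
proof -
  have "n \<le> M \<Longrightarrow> (\<integral>\<^sup>+w. F n w \<partial>measure_pmf (Pi_pmf {..<n} d (\<lambda>_. \<mu>))) \<le> r ^ n * C" for n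
  proof (induction n)
    case 0
    show ?case using base by simp
  next
    case (Suc n)
    \<comment> \<open>Insertion draws the new coordinate first; the draws are exchanged so that it
      becomes the inner integral.\<close>
    have "Pi_pmf {..<Suc n} d (\<lambda>_. \<mu>)
        = bind_pmf (Pi_pmf {..<n} d (\<lambda>_. \<mu>)) (\<lambda>w. map_pmf (\<lambda>s. w(n := s)) \<mu>)"
      unfolding lessThan_Suc
      by (subst Pi_pmf_insert', simp, simp, subst bind_commute_pmf) (simp add: map_pmf_def)
    then have "(\<integral>\<^sup>+w. F (Suc n) w \<partial>measure_pmf (Pi_pmf {..<Suc n} d (\<lambda>_. \<mu>)))
        = (\<integral>\<^sup>+w. (\<integral>\<^sup>+s. F (Suc n) (w(n := s)) \<partial>measure_pmf \<mu>) \<partial>measure_pmf (Pi_pmf {..<n} d (\<lambda>_. \<mu>)))"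
      by simp
    also have "\<dots> \<le> (\<integral>\<^sup>+w. r * F n w \<partial>measure_pmf (Pi_pmf {..<n} d (\<lambda>_. \<mu>)))"
      using Suc.prems by (intro nn_integral_mono step) auto
    also have "\<dots> = r * (\<integral>\<^sup>+w. F n w \<partial>measure_pmf (Pi_pmf {..<n} d (\<lambda>_. \<mu>)))"
      by (intro nn_integral_cmult) simp
    also have "\<dots> \<le> r * (r ^ n * C)"
      using Suc by (intro mult_left_mono) auto
    finally show ?case by (simp add: mult.assoc)
  qed
  then show ?thesis by simp
qed

text \<open>The starting value of the recursion. The trace of the identity is the origin of the
  factor \<open>real N\<close> in front of the tail bounds.\<close>

lemma pow_trace_scalar: "pow_trace N (shifted_gram c s 0 v) p = real N * c ^ p"
proof -
  have "(mapply N (shifted_gram c s 0 v) ^^ p) x i = x i * of_real (c ^ p)" if "i < N" for x i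
    using that by (induction p arbitrary: i) (simp_all add: mapply_shifted_gram)
  then have "moment N (shifted_gram c s 0 v) x p = c ^ p * sqn N x" for x
    unfolding moment_def
    by (subst cip_cong[OF refl, of N _ "\<lambda>i. x i * of_real (c ^ p)"])
       (simp_all add: cip_scale_right cip_self del: of_real_power)
  moreover have "sqn N (unit_fun k) = 1" if "k < N" for k
    using that by (simp add: sqn_def unit_fun_def if_distrib[of cmod] if_distrib[of "\<lambda>c. c\<^sup>2"] cong: if_cong)
  ultimately show ?thesis by (simp add: pow_trace_def)
qed

text \<open>A trace below the \<open>2 r\<close>-th power of the threshold forces the frame bound. Markov's inequality for
  this trace gives Chernoff's bound only in the limit \<open>r \<longlongrightarrow> \<infinity>\<close>, where \<open>(1 + x / (2 r))\<close> to the power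
  \<open>2 r\<close> becomes \<open>exp x\<close>; a countable union over \<open>r\<close> loses nothing and stays measurable. The power is even
  because \<open>pow_trace\<close> is then a sum of squared norms.\<close>

definition upper_certificate :: "nat \<Rightarrow> nat \<Rightarrow> real \<Rightarrow> (nat \<Rightarrow> nat \<Rightarrow> complex) \<Rightarrow> bool" where
  "upper_certificate N M t v \<longleftrightarrow>
     (\<exists>r. 1 \<le> r \<and> pow_trace N (shifted_gram (real (2 * r)) 1 M v) (2 * r) < (real (2 * r) + t) ^ (2 * r))"

text \<open>\<open>real M * R < real (2 * r)\<close> keeps the shifted matrix positive semidefinite
  for vectors bounded by \<open>R\<close>, and \<open>t < real (2 * r)\<close> keeps the base of the
  threshold positive, so that equal powers may be compared.\<close>

definition lower_certificate :: "nat \<Rightarrow> nat \<Rightarrow> real \<Rightarrow> real \<Rightarrow> (nat \<Rightarrow> nat \<Rightarrow> complex) \<Rightarrow> bool" where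
  "lower_certificate N M R t v \<longleftrightarrow>
     (\<exists>r. real M * R < real (2 * r) \<and> t < real (2 * r) \<and>
       pow_trace N (shifted_gram (real (2 * r)) (-1) M v) (2 * r) < (real (2 * r) - t) ^ (2 * r))"

lemma frame_sum_scale: "frame_sum N n v (\<lambda>i. x i * c) = (cmod c)\<^sup>2 * frame_sum N n v x"
  by (simp add: frame_sum_def cip_scale_right norm_mult power_mult_distrib sum_distrib_left)

lemma frame_sum_unit_extend:
  assumes unit: "\<And>y. sqn N y = 1 \<Longrightarrow> Q (frame_sum N n v y)" and "sqn N x \<noteq> 0"
  obtains l where "Q l" "frame_sum N n v x = sqn N x * l"
proof
  define s where "s = sqrt (sqn N x)"
  have s: "0 < s" "s\<^sup>2 = sqn N x" using assms(2) sqn_nonneg[of N x] by (simp_all add: s_def)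
  define y where "y = (\<lambda>i. x i * of_real (1 / s))"
  have "sqn N y = 1" unfolding y_def sqn_scale using s assms(2) by (simp add: norm_divide power_divide)
  then show "Q (frame_sum N n v y)" by (rule unit)
  show "frame_sum N n v x = sqn N x * frame_sum N n v y"
    unfolding y_def frame_sum_scale s(2)[symmetric] using s(1) by (simp add: norm_divide power_divide)
qed

lemma frame_sum_null: "sqn N x = 0 \<Longrightarrow> frame_sum N n v x = 0"
  by (simp add: frame_sum_def cip_def sqn_eq_0_iff)

text \<open>For a unit vector the \<open>2 r\<close>-th power of the shifted quadratic form is at
  most the trace, hence below the threshold, and bases of equal powers compare. Homogeneity covers
  the other vectors.\<close>

lemma upper_certificate_bound:
  assumes "upper_certificate N M t v" "0 \<le> t"
  shows "frame_sum N M v x \<le> t * sqn N x"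
proof (cases "sqn N x = 0")
  case False
  obtain r where r: "1 \<le> r"
    "pow_trace N (shifted_gram (real (2 * r)) 1 M v) (2 * r) < (real (2 * r) + t) ^ (2 * r)"
    using assms by (auto simp: upper_certificate_def)
  have "frame_sum N M v y < t" if "sqn N y = 1" for y
  proof -
    have "(real (2 * r) + frame_sum N M v y) ^ (2 * r) < (real (2 * r) + t) ^ (2 * r)"
      using moment_power_le_trace[OF psd_shifted_gram_plus that, of "real (2 * r)" M v r] r(2)
      by (simp add: moment_shifted_gram[unfolded One_nat_def] that)
    then show ?thesis using assms(2) by (auto dest: power_less_imp_less_base)
  qed
  then obtain l where "l < t" "frame_sum N M v x = sqn N x * l"
    using False frame_sum_unit_extend[of N "\<lambda>l. l < t" M v x] by blast
  then show ?thesis using sqn_nonneg[of N x] by (simp add: mult.commute mult_right_mono)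
qed (simp add: frame_sum_null)

lemma lower_certificate_bound:
  assumes "lower_certificate N M R t v" "\<And>m. m < M \<Longrightarrow> sqn N (v m) \<le> R"
  shows "t * sqn N x \<le> frame_sum N M v x"
proof (cases "sqn N x = 0")
  case False
  obtain r where r: "real M * R < real (2 * r)" "t < real (2 * r)"
    "pow_trace N (shifted_gram (real (2 * r)) (-1) M v) (2 * r) < (real (2 * r) - t) ^ (2 * r)"
    using assms(1) by (auto simp: lower_certificate_def)
  have psd: "psd_on N (shifted_gram (real (2 * r)) (-1) M v)"
    using r(1) assms(2) by (intro psd_shifted_gram_minus[where R = R]) auto
  have "t < frame_sum N M v y" if "sqn N y = 1" for y
  proof -
    have "(real (2 * r) - frame_sum N M v y) ^ (2 * r) < (real (2 * r) - t) ^ (2 * r)"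
      using moment_power_le_trace[OF psd that, of r] r(3)
      by (simp add: moment_shifted_gram[unfolded One_nat_def] that)
    then have "real (2 * r) - frame_sum N M v y < real (2 * r) - t"
      by (rule power_less_imp_less_base) (use r(2) in simp)
    then show ?thesis by simp
  qed
  then obtain l where "t < l" "frame_sum N M v x = sqn N x * l"
    using False frame_sum_unit_extend[of N "\<lambda>l. t < l" M v x] by blast
  then show ?thesis using sqn_nonneg[of N x] by (simp add: mult.commute mult_right_mono)
qed (simp add: frame_sum_null)

lemma measurable_upper_certificate [measurable (raw)]:
  assumes "\<And>m i. m < M \<Longrightarrow> i < N \<Longrightarrow> (\<lambda>x. v x m i) \<in> borel_measurable L"
  shows "Measurable.pred L (\<lambda>x. upper_certificate N M t (v x))"
  unfolding upper_certificate_def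
  by (intro pred_intros_countable pred_intros_logic borel_measurable_pred_less
      measurable_pow_trace assms borel_measurable_const) measurable

lemma measurable_lower_certificate [measurable (raw)]:
  assumes "\<And>m i. m < M \<Longrightarrow> i < N \<Longrightarrow> (\<lambda>x. v x m i) \<in> borel_measurable L"
  shows "Measurable.pred L (\<lambda>x. lower_certificate N M R t (v x))"
  unfolding lower_certificate_def
  by (intro pred_intros_countable pred_intros_logic borel_measurable_pred_less
      measurable_pow_trace assms borel_measurable_const)

section \<open>Markov's inequality for the trace and its limit for large powers\<close>

lemma emeasure_le_of_markov:
  fixes g :: "'w \<Rightarrow> real"
  assumes g: "g \<in> borel_measurable \<nu>" and le: "(\<integral>\<^sup>+w. ennreal (g w) \<partial>\<nu>) \<le> ennreal b"
    and T: "0 < T" and b: "0 \<le> b" and sub: "\<And>w. w \<in> A \<Longrightarrow> T \<le> g w" and A: "A \<in> sets \<nu>"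
  shows "emeasure \<nu> A \<le> ennreal (b / T)"
proof -
  have "ennreal T * emeasure \<nu> A = (\<integral>\<^sup>+w. ennreal T * indicator A w \<partial>\<nu>)"
    using A by (simp add: nn_integral_cmult_indicator)
  also have "\<dots> \<le> (\<integral>\<^sup>+w. ennreal (g w) \<partial>\<nu>)"
    using sub by (intro nn_integral_mono) (auto split: split_indicator intro: ennreal_leI)
  also note le
  finally have *: "ennreal T * emeasure \<nu> A \<le> ennreal b" .
  have "emeasure \<nu> A = ennreal (1 / T) * (ennreal T * emeasure \<nu> A)"
    using T by (simp add: mult.assoc[symmetric] ennreal_mult[symmetric])
  also have "\<dots> \<le> ennreal (1 / T) * ennreal b"
    using * by (intro mult_left_mono) auto
  also have "\<dots> = ennreal (b / T)"
    using T b by (simp add: ennreal_mult[symmetric])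
  finally show ?thesis .
qed

lemma exp_limit_even: "(\<lambda>r. (1 + x / real (2 * r)) ^ (2 * r)) \<longlonglongrightarrow> exp x"
proof -
  have "strict_mono ((*) (2::nat))" by (simp add: strict_mono_def)
  then show ?thesis
    using LIMSEQ_subseq_LIMSEQ[OF tendsto_exp_limit_sequentially[of x]] by (simp only: o_def)
qed

lemma sum_geometric_shift:
  fixes c R \<kappa> :: real
  assumes "0 < c" "0 < R"
  shows "\<kappa> / c * (\<Sum>i<p. (1 + R / c) ^ i) = \<kappa> / R * ((1 + R / c) ^ p - 1)"
  using assms geometric_sum[of "1 + R / c" p] by simp

lemma emeasure_not_upper_certificate:
  fixes v :: "'w \<Rightarrow> nat \<Rightarrow> nat \<Rightarrow> complex"
  assumes N: "0 < N" and R: "0 < R" and \<kappa>: "0 \<le> \<kappa>" and t: "0 \<le> t"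
    and meas: "\<And>m i. m < M \<Longrightarrow> i < N \<Longrightarrow> (\<lambda>w. v w m i) \<in> borel_measurable \<nu>"
    and bound: "\<And>r. 1 \<le> r \<Longrightarrow>
      (\<integral>\<^sup>+w. ennreal (pow_trace N (shifted_gram (real (2 * r)) 1 M (v w)) (2 * r)) \<partial>\<nu>)
      \<le> ennreal (1 + \<kappa> / real (2 * r) * (\<Sum>i<2 * r. (1 + R / real (2 * r)) ^ i)) ^ M
         * ennreal (real N * real (2 * r) ^ (2 * r))"
  shows "emeasure \<nu> {w \<in> space \<nu>. \<not> upper_certificate N M t (v w)}
    \<le> ennreal (real N * exp (real M * \<kappa> / R * (exp R - 1) - t))"
proof -
  define A where "A = {w \<in> space \<nu>. \<not> upper_certificate N M t (v w)}"
  \<comment> \<open>The exponent per vector: \<open>1 + x \<le> exp x\<close> turns each factor of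
    the trace bound into at most \<open>exp (h r)\<close>.\<close>
  define h where "h r = \<kappa> / R * ((1 + R / real (2 * r)) ^ (2 * r) - 1)" for r
  define b where "b r = real N * exp (real M * h r) / (1 + t / real (2 * r)) ^ (2 * r)" for r
  have A: "A \<in> sets \<nu>"
    unfolding A_def using measurable_upper_certificate[OF meas] by measurable
  have le: "emeasure \<nu> A \<le> ennreal (b r)" if r: "1 \<le> r" for r
  proof -
    define p where "p = real (2 * r)"
    have p: "0 < p" using r by (simp add: p_def)
    have "1 + \<kappa> / p * (\<Sum>i<2 * r. (1 + R / p) ^ i) \<le> exp (h r)"
      unfolding sum_geometric_shift[OF p R] h_def p_def[symmetric] by (rule exp_ge_add_one_self)
    then have "ennreal (1 + \<kappa> / p * (\<Sum>i<2 * r. (1 + R / p) ^ i)) ^ M \<le> ennreal (exp (h r)) ^ M"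
      by (intro power_mono ennreal_leI) auto
    also have "\<dots> = ennreal (exp (real M * h r))"
      by (simp add: ennreal_power exp_of_nat_mult)
    finally have "(\<integral>\<^sup>+w. ennreal (pow_trace N (shifted_gram p 1 M (v w)) (2 * r)) \<partial>\<nu>)
        \<le> ennreal (exp (real M * h r)) * ennreal (real N * p ^ (2 * r))"
      using bound[OF r] unfolding p_def[symmetric] by (meson mult_right_mono order_trans zero_le)
    also have "\<dots> = ennreal (exp (real M * h r) * (real N * p ^ (2 * r)))"
      using p by (simp add: ennreal_mult)
    finally have int: "(\<integral>\<^sup>+w. ennreal (pow_trace N (shifted_gram p 1 M (v w)) (2 * r)) \<partial>\<nu>)
        \<le> ennreal (exp (real M * h r) * (real N * p ^ (2 * r)))" .
    have "emeasure \<nu> A \<le> ennreal (exp (real M * h r) * (real N * p ^ (2 * r)) / (p + t) ^ (2 * r))"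
    proof (rule emeasure_le_of_markov[OF _ int _ _ _ A])
      show "(\<lambda>w. pow_trace N (shifted_gram p 1 M (v w)) (2 * r)) \<in> borel_measurable \<nu>"
        by (intro measurable_pow_trace meas)
      show "(p + t) ^ (2 * r) \<le> pow_trace N (shifted_gram p 1 M (v w)) (2 * r)" if "w \<in> A" for w
        using that r unfolding A_def upper_certificate_def p_def by (auto simp: not_less)
    qed (use p t in auto)
    also have "exp (real M * h r) * (real N * p ^ (2 * r)) / (p + t) ^ (2 * r) = b r"
    proof -
      have "p + t = p * (1 + t / p)" using p by (simp add: field_simps)
      then have "(p + t) ^ (2 * r) = p ^ (2 * r) * (1 + t / p) ^ (2 * r)"
        by (simp only: power_mult_distrib)
      then show ?thesis using p unfolding b_def p_def[symmetric] by simp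
    qed
    finally show ?thesis .
  qed
  \<comment> \<open>The event \<open>A\<close> does not depend on \<open>r\<close>, so the bounds
    \<open>b r\<close> may be replaced by their limit.\<close>
  have "b \<longlonglongrightarrow> real N * exp (real M * (\<kappa> / R * (exp R - 1))) / exp t"
    unfolding b_def h_def by (intro tendsto_intros exp_limit_even) simp
  also have "real N * exp (real M * (\<kappa> / R * (exp R - 1))) / exp t
      = real N * exp (real M * \<kappa> / R * (exp R - 1) - t)"
    by (simp add: exp_diff)
  finally have "(\<lambda>r. ennreal (b r)) \<longlonglongrightarrow> ennreal (real N * exp (real M * \<kappa> / R * (exp R - 1) - t))"
    by (rule tendsto_ennrealI)
  then show ?thesis
    unfolding A_def[symmetric] using le by (intro LIMSEQ_le_const) auto
qed

lemma emeasure_not_lower_certificate: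
  fixes v :: "'w \<Rightarrow> nat \<Rightarrow> nat \<Rightarrow> complex"
  assumes N: "0 < N" and R: "0 < R" and \<kappa>: "0 \<le> \<kappa>"
    and meas: "\<And>m i. m < M \<Longrightarrow> i < N \<Longrightarrow> (\<lambda>w. v w m i) \<in> borel_measurable \<nu>"
    and bound: "\<And>r. real M * R < real (2 * r) \<Longrightarrow>
      (\<integral>\<^sup>+w. ennreal (pow_trace N (shifted_gram (real (2 * r)) (-1) M (v w)) (2 * r)) \<partial>\<nu>)
      \<le> ennreal (1 - \<kappa> / real (2 * r) * (\<Sum>i<2 * r. inverse (1 + R / (real (2 * r) - real M * R)) ^ i)) ^ M
         * ennreal (real N * real (2 * r) ^ (2 * r))"
  shows "emeasure \<nu> {w \<in> space \<nu>. \<not> lower_certificate N M R t (v w)}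
    \<le> ennreal (real N * exp (t - real M * \<kappa> / R * (1 - exp (- R))))"
proof -
  define A where "A = {w \<in> space \<nu>. \<not> lower_certificate N M R t (v w)}"
  \<comment> \<open>A minorant of the exact exponent. The lower bound \<open>e\<close> below falls
    short of \<open>p\<close> by \<open>real M * R\<close>; the factor
    \<open>1 - real M * R / real (2 * r)\<close> absorbs this and tends to \<open>1\<close>.\<close>
  define h where "h r = \<kappa> / R * (1 - real M * R / real (2 * r)) * (1 - inverse ((1 + R / real (2 * r)) ^ (2 * r)))" for r
  define b where "b r = real N * exp (- (real M * h r)) / (1 + (- t) / real (2 * r)) ^ (2 * r)" for r
  have A: "A \<in> sets \<nu>"
    unfolding A_def using measurable_lower_certificate[OF meas] by measurable
  have le: "emeasure \<nu> A \<le> ennreal (b r)" if r: "real M * R < real (2 * r)" "t < real (2 * r)" for r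
  proof -
    define p where "p = real (2 * r)"
    define e where "e = p - real M * R"
    define q where "q = inverse (1 + R / e)"
    have p: "0 < p" using r R by (smt (verit) mult_nonneg_nonneg of_nat_0_le_iff p_def)
    have e: "0 < e" "e \<le> p" using r R by (simp_all add: e_def p_def)
    have q: "0 < q" "q < 1" using R e by (simp_all add: q_def inverse_less_1_iff add_pos_pos)
    \<comment> \<open>Replacing \<open>e\<close> by the larger \<open>p\<close> in the base leads to
      a power with known limit.\<close>
    have "(1 + R / p) ^ (2 * r) \<le> (1 + R / e) ^ (2 * r)"
      using R p e by (intro power_mono add_left_mono divide_left_mono) auto
    then have qp: "q ^ (2 * r) \<le> inverse ((1 + R / p) ^ (2 * r))"
      unfolding q_def power_inverse using R p by (intro le_imp_inverse_le zero_less_power) (auto simp: add_pos_pos)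
    have "inverse ((1 + R / p) ^ (2 * r)) \<le> 1"
      using R p by (intro inverse_le_1_iff[THEN iffD2] disjI2 one_le_power) simp
    then have inv1: "0 \<le> 1 - inverse ((1 + R / p) ^ (2 * r))" by simp
    have "1 - q = R / (R + e)" using R e by (simp add: q_def field_simps)
    moreover have "(\<Sum>i<2 * r. q ^ i) = (1 - q ^ (2 * r)) / (1 - q)"
      using q geometric_sum[of q "2 * r"] by (metis less_irrefl minus_diff_eq minus_divide_divide)
    ultimately have "(\<Sum>i<2 * r. q ^ i) = (1 - q ^ (2 * r)) * (R + e) / R"
      by simp
    then have "\<kappa> / p * (\<Sum>i<2 * r. q ^ i) = \<kappa> / R * ((R + e) / p) * (1 - q ^ (2 * r))"
      by (simp add: mult_ac)
    moreover have "h r \<le> \<kappa> / R * ((R + e) / p) * (1 - q ^ (2 * r))"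
      unfolding h_def p_def[symmetric]
    proof (intro mult_mono mult_left_mono)
      show "1 - real M * R / p \<le> (R + e) / p" using R p by (simp add: e_def field_simps)
      show "1 - inverse ((1 + R / p) ^ (2 * r)) \<le> 1 - q ^ (2 * r)" using qp by simp
      show "0 \<le> 1 - real M * R / p" using e p by (simp add: e_def)
    qed (use \<kappa> R p e inv1 in auto)
    ultimately have "1 - \<kappa> / p * (\<Sum>i<2 * r. q ^ i) \<le> 1 + (- h r)" by simp
    also have "\<dots> \<le> exp (- h r)" by (rule exp_ge_add_one_self)
    finally have "ennreal (1 - \<kappa> / p * (\<Sum>i<2 * r. q ^ i)) ^ M \<le> ennreal (exp (- h r)) ^ M"
      by (intro power_mono ennreal_leI) auto
    also have "\<dots> = ennreal (exp (- (real M * h r)))"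
      by (simp add: ennreal_power flip: exp_of_nat_mult)
    finally have "(\<integral>\<^sup>+w. ennreal (pow_trace N (shifted_gram p (-1) M (v w)) (2 * r)) \<partial>\<nu>)
        \<le> ennreal (exp (- (real M * h r))) * ennreal (real N * p ^ (2 * r))"
      using bound[OF r(1)] unfolding p_def[symmetric] e_def[symmetric] q_def[symmetric]
      by (meson mult_right_mono order_trans zero_le)
    also have "\<dots> = ennreal (exp (- (real M * h r)) * (real N * p ^ (2 * r)))"
      using p by (simp add: ennreal_mult)
    finally have int: "(\<integral>\<^sup>+w. ennreal (pow_trace N (shifted_gram p (-1) M (v w)) (2 * r)) \<partial>\<nu>)
        \<le> ennreal (exp (- (real M * h r)) * (real N * p ^ (2 * r)))" .
    have "emeasure \<nu> A \<le> ennreal (exp (- (real M * h r)) * (real N * p ^ (2 * r)) / (p - t) ^ (2 * r))"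
    proof (rule emeasure_le_of_markov[OF _ int _ _ _ A])
      show "(\<lambda>w. pow_trace N (shifted_gram p (-1) M (v w)) (2 * r)) \<in> borel_measurable \<nu>"
        by (intro measurable_pow_trace meas)
      show "(p - t) ^ (2 * r) \<le> pow_trace N (shifted_gram p (-1) M (v w)) (2 * r)" if "w \<in> A" for w
      proof -
        have "\<not> pow_trace N (shifted_gram p (-1) M (v w)) (2 * r) < (p - t) ^ (2 * r)"
          using that r unfolding A_def lower_certificate_def p_def by blast
        then show ?thesis by simp
      qed
    qed (use p r in \<open>auto simp: p_def\<close>)
    also have "exp (- (real M * h r)) * (real N * p ^ (2 * r)) / (p - t) ^ (2 * r) = b r"
    proof -
      have "p - t = p * (1 + (- t) / p)" using p by (simp add: field_simps)
      then have "(p - t) ^ (2 * r) = p ^ (2 * r) * (1 + (- t) / p) ^ (2 * r)"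
        by (simp only: power_mult_distrib)
      then show ?thesis using p unfolding b_def p_def[symmetric] by simp
    qed
    finally show ?thesis .
  qed
  have "(\<lambda>r. real M * R / real (2 * r)) \<longlonglongrightarrow> 0"
    using tendsto_mult_right_zero[OF lim_inverse_n', of "real M * R / 2"] by (simp add: field_simps)
  then have "h \<longlonglongrightarrow> \<kappa> / R * (1 - 0) * (1 - inverse (exp R))"
    unfolding h_def by (intro tendsto_intros exp_limit_even) simp_all
  then have "b \<longlonglongrightarrow> real N * exp (- (real M * (\<kappa> / R * (1 - 0) * (1 - inverse (exp R))))) / exp (- t)"
    unfolding b_def by (intro tendsto_intros exp_limit_even) simp_all
  also have "real N * exp (- (real M * (\<kappa> / R * (1 - 0) * (1 - inverse (exp R))))) / exp (- t)
      = real N * exp (t - real M * \<kappa> / R * (1 - exp (- R)))"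
    by (simp add: exp_diff exp_minus field_simps)
  finally have "(\<lambda>r. ennreal (b r)) \<longlonglongrightarrow> ennreal (real N * exp (t - real M * \<kappa> / R * (1 - exp (- R))))"
    by (rule tendsto_ennrealI)
  \<comment> \<open>The bounds are available only once \<open>2 * r\<close> exceeds both
    \<open>real M * R\<close> and \<open>t\<close>, which does not affect the limit.\<close>
  moreover have "\<exists>n. \<forall>r\<ge>n. emeasure \<nu> A \<le> ennreal (b r)"
  proof -
    obtain n where "max (real M * R) t < real n" using reals_Archimedean2 by blast
    then show ?thesis by (intro exI[of _ n]) (auto intro!: le)
  qed
  ultimately show ?thesis
    unfolding A_def[symmetric] by (intro LIMSEQ_le_const) auto
qed

context isotropic_vector
begin

text \<open>This is the tail for the grid, where a lower frame bound carries the error from the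
  discrete norm to \<open>L2_norm\<close>.\<close>

lemma PiM_not_lower_certificate:
  assumes N: "0 < N" and R: "0 < R"
  shows "emeasure (PiM {..<M} (\<lambda>_. \<mu>)) {w \<in> space (PiM {..<M} (\<lambda>_. \<mu>)). \<not> lower_certificate N M R t (\<lambda>m. a (w m))}
    \<le> ennreal (real N * exp (t - real M * \<kappa> / R * (1 - exp (- R))))"
proof (rule emeasure_not_lower_certificate[OF N R kappa_nonneg[OF N]])
  have meas': "(\<lambda>w. a (w m) i) \<in> borel_measurable (PiM {..<n} (\<lambda>_. \<mu>))" if "m < n" "i < N" for m i n
    using that by (intro measurable_compose[OF _ meas] measurable_component_singleton) auto
  show "(\<lambda>w. a (w m) i) \<in> borel_measurable (PiM {..<M} (\<lambda>_. \<mu>))" if "m < M" "i < N" for m i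
    using that by (rule meas')
  fix r assume r: "real M * R < real (2 * r)"
  define F where "F n w = ennreal (pow_trace N (shifted_gram (real (2 * r)) (-1) n (\<lambda>m. a (w m))) (2 * r))" for n w
  define c where "c = ennreal (1 - \<kappa> / real (2 * r) * (\<Sum>i<2 * r. inverse (1 + R / (real (2 * r) - real M * R)) ^ i))"
  have "0 < real (2 * r)" using r R by (smt (verit) mult_nonneg_nonneg of_nat_0_le_iff)
  then have r0: "0 < 2 * r" by (simp only: of_nat_0_less_iff)
  have "(\<integral>\<^sup>+w. F M w \<partial>PiM {..<M} (\<lambda>_. \<mu>)) \<le> c ^ M * ennreal (real N * real (2 * r) ^ (2 * r))"
  proof (rule nn_integral_PiM_chain[OF prob_space_axioms])
    fix n w assume n: "n < M" and w: "w \<in> space (PiM {..<n} (\<lambda>_. \<mu>))"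
    \<comment> \<open>The single choice \<open>e = real (2 * r) - real M * R\<close> serves all
      steps, as at most \<open>M\<close> vectors are subtracted.\<close>
    have "real (Suc n) * R \<le> real M * R" using n R by (intro mult_right_mono) auto
    then show "(\<integral>\<^sup>+s. F (Suc n) (w(n := s)) \<partial>\<mu>) \<le> c * F n w"
      unfolding F_def c_def using r r0 R w
      by (intro nn_integral_pow_trace_minus N) (auto simp: space_PiM PiE_iff)
  qed (auto simp: F_def[abs_def] pow_trace_scalar
      intro!: measurable_compose[OF _ measurable_ennreal] measurable_pow_trace meas')
  then show "(\<integral>\<^sup>+w. ennreal (pow_trace N (shifted_gram (real (2 * r)) (-1) M (\<lambda>m. a (w m))) (2 * r)) \<partial>PiM {..<M} (\<lambda>_. \<mu>))
      \<le> ennreal (1 - \<kappa> / real (2 * r) * (\<Sum>i<2 * r. inverse (1 + R / (real (2 * r) - real M * R)) ^ i)) ^ M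
         * ennreal (real N * real (2 * r) ^ (2 * r))"
    by (simp only: F_def c_def)
qed

lemma Pi_pmf_not_certificate:
  assumes p: "\<mu> = measure_pmf p" and N: "0 < N" and R: "0 < R"
  shows "emeasure (measure_pmf (Pi_pmf {..<M} x0 (\<lambda>_. p))) {w. \<not> lower_certificate N M R t (\<lambda>m. a (w m))}
      \<le> ennreal (real N * exp (t - real M * \<kappa> / R * (1 - exp (- R))))" (is ?lower)
    and "0 \<le> t \<Longrightarrow> emeasure (measure_pmf (Pi_pmf {..<M} x0 (\<lambda>_. p))) {w. \<not> upper_certificate N M t (\<lambda>m. a (w m))}
      \<le> ennreal (real N * exp (real M * \<kappa> / R * (exp R - 1) - t))" (is "_ \<Longrightarrow> ?upper")
proof -
  have "(\<integral>\<^sup>+w. ennreal (pow_trace N (shifted_gram (real (2 * r)) (-1) M (\<lambda>m. a (w m))) (2 * r)) \<partial>measure_pmf (Pi_pmf {..<M} x0 (\<lambda>_. p)))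
      \<le> ennreal (1 - \<kappa> / real (2 * r) * (\<Sum>i<2 * r. inverse (1 + R / (real (2 * r) - real M * R)) ^ i)) ^ M
         * ennreal (real N * real (2 * r) ^ (2 * r))" if r: "real M * R < real (2 * r)" for r
  proof -
    define F where "F n w = ennreal (pow_trace N (shifted_gram (real (2 * r)) (-1) n (\<lambda>m. a (w m))) (2 * r))" for n w
    have "0 < real (2 * r)" using r R by (smt (verit) mult_nonneg_nonneg of_nat_0_le_iff)
    then have r0: "0 < 2 * r" by (simp only: of_nat_0_less_iff)
    show ?thesis
      unfolding F_def[symmetric]
    proof (rule nn_integral_Pi_pmf_chain[where F = F])
      fix n w assume n: "n < M"
      have "real (Suc n) * R \<le> real M * R" using n R by (intro mult_right_mono) auto
      then show "(\<integral>\<^sup>+s. F (Suc n) (w(n := s)) \<partial>measure_pmf p)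
          \<le> ennreal (1 - \<kappa> / real (2 * r) * (\<Sum>i<2 * r. inverse (1 + R / (real (2 * r) - real M * R)) ^ i)) * F n w"
        unfolding F_def p[symmetric] using r r0 R by (intro nn_integral_pow_trace_minus N) (auto simp: p)
    qed (simp add: F_def pow_trace_scalar)
  qed
  from emeasure_not_lower_certificate[OF N R kappa_nonneg[OF N] _ this, where t = t]
  show ?lower by simp
  assume t: "0 \<le> t"
  have "(\<integral>\<^sup>+w. ennreal (pow_trace N (shifted_gram (real (2 * r)) 1 M (\<lambda>m. a (w m))) (2 * r)) \<partial>measure_pmf (Pi_pmf {..<M} x0 (\<lambda>_. p)))
      \<le> ennreal (1 + \<kappa> / real (2 * r) * (\<Sum>i<2 * r. (1 + R / real (2 * r)) ^ i)) ^ M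
         * ennreal (real N * real (2 * r) ^ (2 * r))" if r: "1 \<le> r" for r
  proof -
    define F where "F n w = ennreal (pow_trace N (shifted_gram (real (2 * r)) 1 n (\<lambda>m. a (w m))) (2 * r))" for n w
    show ?thesis
      unfolding F_def[symmetric]
    proof (rule nn_integral_Pi_pmf_chain[where F = F])
      fix n w
      show "(\<integral>\<^sup>+s. F (Suc n) (w(n := s)) \<partial>measure_pmf p)
          \<le> ennreal (1 + \<kappa> / real (2 * r) * (\<Sum>i<2 * r. (1 + R / real (2 * r)) ^ i)) * F n w"
        unfolding F_def p[symmetric] using r by (intro nn_integral_pow_trace_plus N) auto
    qed (simp add: F_def pow_trace_scalar)
  qed
  from emeasure_not_upper_certificate[OF N R kappa_nonneg[OF N] t _ this]
  show ?upper by simp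
qed

end

section \<open>Orthonormal factors\<close>

text \<open>Gram--Schmidt on the unit vectors for the form given by \<open>G\<close>, with
  coefficient vectors as result. The explicit recursion in the entries of \<open>G\<close> makes the
  result measurable in \<open>G\<close>, which the mere existence of an orthonormal basis would not
  give.\<close>

primrec gram_orthonormal :: "nat \<Rightarrow> (nat \<Rightarrow> nat \<Rightarrow> complex) \<Rightarrow> nat \<Rightarrow> nat \<Rightarrow> nat \<Rightarrow> complex" where
  "gram_orthonormal N G 0 = (\<lambda>_ _. 0)"
| "gram_orthonormal N G (Suc j) =
     (let t = gram_orthonormal N G j;
          v = (\<lambda>i. unit_fun j i - (\<Sum>l<j. t l i * cip N (t l) (mapply N G (unit_fun j))))
      in t(j := (\<lambda>i. v i * of_real (1 / sqrt (moment N G v 1)))))"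

lemma cip_diff_right: "cip N z (\<lambda>i. x i - y i) = cip N z x - cip N z y"
  by (simp add: cip_def algebra_simps sum_subtractf)

lemma mapply_diff: "mapply N X (\<lambda>i. x i - y i) = (\<lambda>i. mapply N X x i - mapply N X y i)"
  by (simp add: mapply_def algebra_simps sum_subtractf)

lemma mapply_sum: "mapply N X (\<lambda>i. \<Sum>l\<in>I. f l i) = (\<lambda>i. \<Sum>l\<in>I. mapply N X (f l) i)"
  unfolding mapply_def by (simp add: sum_distrib_left) (intro ext, rule sum.swap)

text \<open>Vector \<open>l\<close> vanishes beyond coordinate \<open>l\<close>, and this is carried
  along because it gives the new vector the coordinate \<open>1\<close> at \<open>j\<close>. The new
  vector is therefore nonzero and can be normalised.\<close>

lemma gram_orthonormal_aux:
  assumes herm: "hermitian_on N G" and pos: "\<And>x. sqn N x \<noteq> 0 \<Longrightarrow> 0 < moment N G x 1"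
  shows "j \<le> N \<Longrightarrow>
    (\<forall>k<j. \<forall>l<j. cip N (gram_orthonormal N G j k) (mapply N G (gram_orthonormal N G j l)) = (if k = l then 1 else 0))
    \<and> (\<forall>l<j. \<forall>i>l. gram_orthonormal N G j l i = 0)"
proof (induction j)
  case (Suc j)
  define t where "t = gram_orthonormal N G j"
  define v where "v = (\<lambda>i. unit_fun j i - (\<Sum>l<j. t l i * cip N (t l) (mapply N G (unit_fun j))))"
  define s where "s = moment N G v 1"
  define u where "u = (\<lambda>i. v i * of_real (1 / sqrt s))"
  have step: "gram_orthonormal N G (Suc j) = t(j := u)"
    by (simp add: t_def v_def u_def s_def Let_def)
  have orth: "cip N (t k) (mapply N G (t l)) = (if k = l then 1 else 0)" if "k < j" "l < j" for k l
    using Suc that by (simp add: t_def)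
  have supp: "t l i = 0" if "l < j" "l < i" for l i
    using Suc that by (simp add: t_def)
  have "v j = 1" using supp by (simp add: v_def unit_fun_def)
  then have "sqn N v \<noteq> 0" using Suc.prems by (auto simp: sqn_eq_0_iff intro!: exI[of _ j])
  then have s: "0 < s" unfolding s_def by (rule pos)
  have tv: "cip N (t k) (mapply N G v) = 0" if "k < j" for k
  proof -
    have "cip N (t k) (mapply N G v) = cip N (t k) (mapply N G (unit_fun j))
        - (\<Sum>l<j. cip N (t l) (mapply N G (unit_fun j)) * cip N (t k) (mapply N G (t l)))"
      unfolding v_def mapply_diff mapply_sum mapply_scale cip_diff_right cip_sum_right cip_scale_right ..
    also have "(\<Sum>l<j. cip N (t l) (mapply N G (unit_fun j)) * cip N (t k) (mapply N G (t l)))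
        = (\<Sum>l<j. if l = k then cip N (t l) (mapply N G (unit_fun j)) else 0)"
      using that by (intro sum.cong refl) (auto simp: orth)
    finally show ?thesis using that by simp
  qed
  have vt: "cip N v (mapply N G (t k)) = 0" if "k < j" for k
    using tv[OF that] cip_mapply[OF herm, of v "t k"] cip_commute[of N "mapply N G v" "t k"] by simp
  have vv: "cip N v (mapply N G v) = of_real s"
    using cip_mapply_pow_split[OF herm, of 0 v 1] by (simp add: s_def)
  have uu: "cip N u (mapply N G u) = 1"
    unfolding u_def mapply_scale cip_scale_left cip_scale_right vv using s
    by (simp flip: of_real_mult)
  have tu: "cip N (t k) (mapply N G u) = 0" "cip N u (mapply N G (t k)) = 0" if "k < j" for k
    unfolding u_def mapply_scale cip_scale_left cip_scale_right using tv[OF that] vt[OF that] by simp_all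
  have "u i = 0" if "j < i" for i
    using supp that by (simp add: u_def v_def unit_fun_def)
  then show ?case
    unfolding step using orth uu tu supp by (auto simp: less_Suc_eq)
qed simp

lemma gram_orthonormal:
  assumes "hermitian_on N G" "\<And>x. sqn N x \<noteq> 0 \<Longrightarrow> 0 < moment N G x 1" "k < N" "l < N"
  shows "cip N (gram_orthonormal N G N k) (mapply N G (gram_orthonormal N G N l)) = (if k = l then 1 else 0)"
  using gram_orthonormal_aux[OF assms(1,2), of N] assms(3,4) by simp

lemma borel_measurable_cip:
  assumes "\<And>i. i < N \<Longrightarrow> (\<lambda>x. u x i) \<in> borel_measurable L" "\<And>i. i < N \<Longrightarrow> (\<lambda>x. v x i) \<in> borel_measurable L"
  shows "(\<lambda>x. cip N (u x) (v x)) \<in> borel_measurable L"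
  unfolding cip_def
  by (intro borel_measurable_sum borel_measurable_times measurable_compose[OF _ borel_measurable_cnj] assms) auto

lemma borel_measurable_mapply:
  assumes "\<And>i k. i < N \<Longrightarrow> k < N \<Longrightarrow> (\<lambda>x. X x i k) \<in> borel_measurable L"
    "\<And>i. i < N \<Longrightarrow> (\<lambda>x. v x i) \<in> borel_measurable L" "i < N"
  shows "(\<lambda>x. mapply N (X x) (v x) i) \<in> borel_measurable L"
  unfolding mapply_def using assms(3) by (intro borel_measurable_sum borel_measurable_times assms(1,2)) auto

lemma borel_measurable_gram_orthonormal:
  assumes G: "\<And>i k. i < N \<Longrightarrow> k < N \<Longrightarrow> (\<lambda>x. G x i k) \<in> borel_measurable L"
  shows "(\<lambda>x. gram_orthonormal N (G x) j l i) \<in> borel_measurable L"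
proof (induction j arbitrary: l i)
  case (Suc j)
  define t where "t x = gram_orthonormal N (G x) j" for x
  define v where "v x = (\<lambda>i. unit_fun j i - (\<Sum>l<j. t x l i * cip N (t x l) (mapply N (G x) (unit_fun j))))" for x
  have t: "(\<lambda>x. t x l i) \<in> borel_measurable L" for l i
    unfolding t_def by (rule Suc)
  have v: "(\<lambda>x. v x i) \<in> borel_measurable L" for i
    unfolding v_def
    by (intro borel_measurable_diff borel_measurable_sum borel_measurable_times borel_measurable_cip
        borel_measurable_mapply t G borel_measurable_const)
  have s: "(\<lambda>x. moment N (G x) (v x) 1) \<in> borel_measurable L"
    unfolding moment_def
    by (simp, intro measurable_compose[OF _ borel_measurable_Re] borel_measurable_cip borel_measurable_mapply v G)
  have "(\<lambda>x. v x i * of_real (1 / sqrt (moment N (G x) (v x) 1))) \<in> borel_measurable L"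
    by (intro borel_measurable_times v measurable_compose[OF _ borel_measurable_of_real]
        borel_measurable_divide borel_measurable_const measurable_compose[OF s borel_measurable_sqrt])
  moreover have "gram_orthonormal N (G x) (Suc j) l i =
      (if l = j then v x i * of_real (1 / sqrt (moment N (G x) (v x) 1)) else t x l i)" for x
    by (simp add: v_def t_def Let_def)
  ultimately show ?case using t by (cases "l = j") (simp_all del: gram_orthonormal.simps)
qed simp

definition column_gram :: "nat \<Rightarrow> (nat \<Rightarrow> nat \<Rightarrow> complex) \<Rightarrow> nat \<Rightarrow> nat \<Rightarrow> complex" where
  "column_gram K b = (\<lambda>j k. \<Sum>i<K. cnj (b i j) * b i k)"

lemma cip_column_gram:
  "cip N x (mapply N (column_gram K b) y) = (\<Sum>i<K. cnj (\<Sum>j<N. b i j * x j) * (\<Sum>k<N. b i k * y k))"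
proof -
  have "cip N x (mapply N (column_gram K b) y)
      = (\<Sum>j<N. \<Sum>k<N. \<Sum>i<K. cnj (b i j * x j) * (b i k * y k))"
    by (simp add: cip_def mapply_def column_gram_def sum_distrib_left sum_distrib_right mult_ac)
  also have "\<dots> = (\<Sum>j<N. \<Sum>i<K. \<Sum>k<N. cnj (b i j * x j) * (b i k * y k))"
    by (intro sum.cong refl sum.swap)
  also have "\<dots> = (\<Sum>i<K. \<Sum>j<N. \<Sum>k<N. cnj (b i j * x j) * (b i k * y k))"
    by (rule sum.swap)
  finally show ?thesis by (simp add: sum_product)
qed

lemma hermitian_column_gram: "hermitian_on N (column_gram K b)"
  by (simp add: hermitian_on_def column_gram_def mult.commute)

lemma moment_column_gram: "moment N (column_gram K b) x 1 = (\<Sum>i<K. (cmod (\<Sum>j<N. b i j * x j))\<^sup>2)"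
proof -
  have "cnj z * z = of_real ((cmod z)\<^sup>2)" for z
    by (subst complex_norm_square) (rule mult.commute)
  then have "cip N x (mapply N (column_gram K b) x) = of_real (\<Sum>i<K. (cmod (\<Sum>j<N. b i j * x j))\<^sup>2)"
    unfolding cip_column_gram of_real_sum by (intro sum.cong refl)
  then show ?thesis by (simp add: moment_def del: of_real_power)
qed

text \<open>The function \<open>qr\<close> of the theorem need not be measurable. This factor is, and any other choice differs
  from it by a unitary matrix, so that sampling probabilities and singular values agree.\<close>

definition gs_factor :: "nat \<Rightarrow> nat \<Rightarrow> (nat \<Rightarrow> nat \<Rightarrow> complex) \<Rightarrow> nat \<Rightarrow> nat \<Rightarrow> complex" where
  "gs_factor K N b i k = (\<Sum>j<N. b i j * gram_orthonormal N (column_gram K b) N k j)"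

lemma borel_measurable_gs_factor:
  assumes b: "\<And>i j. i < K \<Longrightarrow> j < N \<Longrightarrow> (\<lambda>x. b x i j) \<in> borel_measurable L" and i: "i < K"
  shows "(\<lambda>x. gs_factor K N (b x) i k) \<in> borel_measurable L"
  unfolding gs_factor_def
  using i by (intro borel_measurable_sum borel_measurable_times borel_measurable_gram_orthonormal b)
    (auto simp: column_gram_def intro!: borel_measurable_sum borel_measurable_times
      measurable_compose[OF _ borel_measurable_cnj] b)

text \<open>Full column rank, in a form free of matrix types.\<close>

definition injective_on :: "nat \<Rightarrow> nat \<Rightarrow> (nat \<Rightarrow> nat \<Rightarrow> complex) \<Rightarrow> bool" where
  "injective_on K N b \<longleftrightarrow> (\<forall>x. (\<forall>i<K. (\<Sum>j<N. b i j * x j) = 0) \<longrightarrow> (\<forall>j<N. x j = 0))"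

lemma injective_onD:
  assumes "injective_on K N b" "\<forall>i<K. (\<Sum>j<N. b i j * x j) = 0"
  shows "\<forall>j<N. x j = 0"
  by (rule mp[OF spec[OF assms(1)[unfolded injective_on_def], of x] assms(2)])

lemma gs_factor_orthonormal:
  assumes "injective_on K N b" "k < N" "l < N"
  shows "(\<Sum>i<K. cnj (gs_factor K N b i k) * gs_factor K N b i l) = (if k = l then 1 else 0)"
proof -
  have "0 < moment N (column_gram K b) x 1" if "sqn N x \<noteq> 0" for x
  proof -
    have "\<not> (\<forall>i<K. (\<Sum>j<N. b i j * x j) = 0)"
    proof
      assume "\<forall>i<K. (\<Sum>j<N. b i j * x j) = 0"
      from injective_onD[OF assms(1) this] have "sqn N x = 0" unfolding sqn_eq_0_iff .
      with that show False by simp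
    qed
    then obtain i where "i < K" "(\<Sum>j<N. b i j * x j) \<noteq> 0" by blast
    then show ?thesis
      unfolding moment_column_gram by (intro sum_pos2[of "{..<K}" i]) simp_all
  qed
  from gram_orthonormal[OF hermitian_column_gram this assms(2,3)]
  show ?thesis unfolding cip_column_gram gs_factor_def .
qed

section \<open>Leverage scores and unitary changes of the orthonormal factor\<close>

definition leverage :: "nat \<Rightarrow> (nat \<Rightarrow> nat \<Rightarrow> complex) \<Rightarrow> nat \<Rightarrow> real" where
  "leverage N q i = (\<Sum>k<N. (cmod (q i k))\<^sup>2)"

text \<open>For square matrices a one-sided inverse is two-sided; the passage to the matrix type
  provides this fact for functions.\<close>

lemma left_inverse_imp_right_inverse:
  fixes u v :: "nat \<Rightarrow> nat \<Rightarrow> complex"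
  assumes inv: "\<And>l m. l < N \<Longrightarrow> m < N \<Longrightarrow> (\<Sum>k<N. v l k * u k m) = (if l = m then 1 else 0)"
    and "k < N" "m < N"
  shows "(\<Sum>l<N. u k l * v l m) = (if k = m then 1 else 0)"
proof -
  define U V where "U = mat N N (\<lambda>(k, l). u k l)" and "V = mat N N (\<lambda>(l, k). v l k)"
  have "V * U = 1\<^sub>m N"
    by (rule eq_matI) (simp_all add: U_def V_def scalar_prod_def inv atLeast0LessThan)
  then have "U * V = 1\<^sub>m N"
    by (intro mat_mult_left_right_inverse[of V N U]) (simp_all add: U_def V_def)
  then have "(U * V) $$ (k, m) = (1\<^sub>m N) $$ (k, m)" by simp
  then show ?thesis
    using assms(2,3) by (simp add: U_def V_def scalar_prod_def atLeast0LessThan)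
qed

text \<open>Orthonormality of both factors makes \<open>u\<close> an isometry, and squareness makes
  it unitary. The identity for the rows of \<open>u\<close> is the one used for leverages and
  coordinates.\<close>

lemma orthonormal_factor_unitary:
  fixes q q0 u :: "nat \<Rightarrow> nat \<Rightarrow> complex"
  assumes q: "\<And>k l. k < N \<Longrightarrow> l < N \<Longrightarrow> (\<Sum>i<K. cnj (q i k) * q i l) = (if k = l then 1 else 0)"
    and q0: "\<And>k l. k < N \<Longrightarrow> l < N \<Longrightarrow> (\<Sum>i<K. cnj (q0 i k) * q0 i l) = (if k = l then 1 else 0)"
    and factor: "\<And>i l. i < K \<Longrightarrow> l < N \<Longrightarrow> q0 i l = (\<Sum>k<N. q i k * u k l)"
    and "k < N" "m < N"
  shows "(\<Sum>l<N. u k l * cnj (u m l)) = (if k = m then 1 else 0)"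
proof -
  have uu: "(\<Sum>k<N. cnj (u k l) * u k m) = (if l = m then 1 else 0)" if lm: "l < N" "m < N" for l m
  proof -
    have "(if l = m then 1 else 0) = (\<Sum>i<K. cnj (\<Sum>k<N. q i k * u k l) * (\<Sum>k<N. q i k * u k m))"
      unfolding q0[OF lm, symmetric] using lm by (intro sum.cong refl) (simp add: factor)
    also have "\<dots> = cip N (\<lambda>k. u k l) (mapply N (column_gram K q) (\<lambda>k. u k m))"
      by (simp add: cip_column_gram)
    also have "\<dots> = cip N (\<lambda>k. u k l) (\<lambda>k. u k m)"
      by (rule cip_cong[OF refl]) (simp add: mapply_def column_gram_def, rule sum_mult_delta, rule q)
    finally show ?thesis by (simp add: cip_def)
  qed
  show ?thesis
    by (rule left_inverse_imp_right_inverse[of N "\<lambda>l k. cnj (u k l)" u, OF uu assms(4,5)])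
qed

lemma unitary_change:
  fixes q q0 u :: "nat \<Rightarrow> nat \<Rightarrow> complex"
  assumes u: "\<And>k m. k < N \<Longrightarrow> m < N \<Longrightarrow> (\<Sum>l<N. u k l * cnj (u m l)) = (if k = m then 1 else 0)"
  obtains y where "sqn N y = sqn N x" "\<And>k. k < N \<Longrightarrow> (\<Sum>l<N. u k l * y l) = x k"
proof
  define y where "y = (\<lambda>l. \<Sum>m<N. cnj (u m l) * x m)"
  show eq: "(\<Sum>l<N. u k l * y l) = x k" if "k < N" for k
    unfolding y_def sum_mult_assoc by (rule sum_mult_delta) (rule u[OF that], simp, rule that)
  have "cip N y y = (\<Sum>l<N. \<Sum>m<N. u m l * cnj (x m) * y l)"
    by (simp add: cip_def y_def sum_distrib_right)
  also have "\<dots> = (\<Sum>m<N. cnj (x m) * (\<Sum>l<N. u m l * y l))"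
    by (subst sum.swap) (simp add: sum_distrib_left mult_ac)
  also have "\<dots> = cip N x x"
    unfolding cip_def by (intro sum.cong refl) (simp add: eq)
  finally show "sqn N y = sqn N x" by (simp only: cip_self of_real_eq_iff)
qed

lemma leverage_unitary:
  fixes q q0 u :: "nat \<Rightarrow> nat \<Rightarrow> complex"
  assumes u: "\<And>k m. k < N \<Longrightarrow> m < N \<Longrightarrow> (\<Sum>l<N. u k l * cnj (u m l)) = (if k = m then 1 else 0)"
    and factor: "\<And>l. l < N \<Longrightarrow> q0 i l = (\<Sum>k<N. q i k * u k l)"
  shows "leverage N q0 i = leverage N q i"
proof -
  have "complex_of_real (leverage N q0 i) = (\<Sum>l<N. q0 i l * cnj (q0 i l))"
    unfolding leverage_def of_real_sum complex_norm_square ..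
  also have "\<dots> = (\<Sum>l<N. \<Sum>k<N. q i k * u k l * cnj (q0 i l))"
    by (intro sum.cong refl) (simp add: factor[of _] sum_distrib_right)
  also have "\<dots> = (\<Sum>k<N. q i k * (\<Sum>l<N. u k l * cnj (q0 i l)))"
    by (subst sum.swap) (simp add: sum_distrib_left mult_ac)
  also have "\<dots> = (\<Sum>k<N. q i k * cnj (q i k))"
  proof (intro sum.cong refl arg_cong2[where f = "(*)"])
    fix k assume "k \<in> {..<N}"
    then have k: "k < N" by simp
    have "(\<Sum>l<N. u k l * cnj (q0 i l)) = (\<Sum>l<N. u k l * (\<Sum>m<N. cnj (u m l) * cnj (q i m)))"
      by (intro sum.cong refl) (simp add: factor mult.commute)
    then show "(\<Sum>l<N. u k l * cnj (q0 i l)) = cnj (q i k)"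
      unfolding sum_mult_assoc using sum_mult_delta[OF u[OF k] k] by simp
  qed
  also have "\<dots> = of_real (leverage N q i)"
    unfolding leverage_def of_real_sum complex_norm_square ..
  finally show ?thesis by (simp only: of_real_eq_iff)
qed

text \<open>Both sides are the trace of the adjoint of \<open>q\<close> times \<open>q\<close>.
  Divided by \<open>N\<close>, the leverages are probabilities.\<close>

lemma sum_leverage:
  assumes "\<And>k l. k < N \<Longrightarrow> l < N \<Longrightarrow> (\<Sum>i<K. cnj (q i k) * q i l) = (if k = l then 1 else 0)"
  shows "(\<Sum>i<K. leverage N q i) = real N"
proof -
  have "complex_of_real (\<Sum>i<K. leverage N q i) = (\<Sum>i<K. \<Sum>k<N. cnj (q i k) * q i k)"
    unfolding leverage_def of_real_sum complex_norm_square by (simp add: mult.commute)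
  also have "\<dots> = (\<Sum>k<N. \<Sum>i<K. cnj (q i k) * q i k)" by (rule sum.swap)
  also have "\<dots> = of_real (real N)" using assms by simp
  finally show ?thesis by (simp only: of_real_eq_iff)
qed

text \<open>Let \<open>T\<close> have the columns \<open>t k\<close>. Orthonormality says that
  \<open>v\<close>, the adjoint of \<open>T\<close> times \<open>G\<close>, is a left inverse of
  \<open>T\<close>; the expansion says that it is also a right inverse.\<close>

lemma gram_basis_expand:
  fixes t :: "nat \<Rightarrow> nat \<Rightarrow> complex"
  assumes orth: "\<And>k l. k < N \<Longrightarrow> l < N \<Longrightarrow> cip N (t k) (mapply N G (t l)) = (if k = l then 1 else 0)"
    and j: "j < N"
  shows "x j = (\<Sum>k<N. t k j * cip N (t k) (mapply N G x))"
proof -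
  define v where "v l m = (\<Sum>j<N. cnj (t l j) * G j m)" for l m
  have v: "(\<Sum>m<N. v l m * y m) = cip N (t l) (mapply N G y)" for l y
    unfolding v_def cip_def mapply_def sum_mult_assoc ..
  have "(\<Sum>k<N. v l k * t m k) = (if l = m then 1 else 0)" if "l < N" "m < N" for l m
    unfolding v by (rule orth[OF that])
  from left_inverse_imp_right_inverse[of N v "\<lambda>k m. t m k", OF this]
  have inv: "(\<Sum>l<N. t l j * v l m) = (if j = m then 1 else 0)" if "m < N" for m
    using that j by simp
  show ?thesis
    unfolding v[symmetric] sum_mult_assoc by (rule sum_mult_delta[OF inv j, symmetric])
qed

lemma gram_basis_norm:
  fixes t :: "nat \<Rightarrow> nat \<Rightarrow> complex"
  assumes orth: "\<And>k l. k < N \<Longrightarrow> l < N \<Longrightarrow> cip N (t k) (mapply N G (t l)) = (if k = l then 1 else 0)"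
    and x: "\<And>j. j < N \<Longrightarrow> x j = (\<Sum>k<N. t k j * y k)"
  shows "cip N x (mapply N G x) = of_real (sqn N y)"
proof -
  have Gx: "mapply N G x = mapply N G (\<lambda>j. \<Sum>k<N. t k j * y k)"
    unfolding mapply_def by (intro ext sum.cong refl) (simp add: x)
  have tG: "cip N (t k) (mapply N G x) = y k" if "k < N" for k
  proof -
    have "cip N (t k) (mapply N G x) = (\<Sum>l<N. y l * cip N (t k) (mapply N G (t l)))"
      unfolding Gx mapply_sum mapply_scale cip_sum_right cip_scale_right ..
    also have "\<dots> = (\<Sum>l<N. if l = k then y l else 0)"
      using that by (intro sum.cong refl) (auto simp: orth)
    finally show ?thesis using that by simp
  qed
  have "cip N x (mapply N G x) = (\<Sum>j<N. \<Sum>k<N. cnj (y k) * (cnj (t k j) * mapply N G x j))"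
    unfolding cip_def by (intro sum.cong refl) (simp add: x sum_distrib_left sum_distrib_right mult_ac)
  also have "\<dots> = (\<Sum>k<N. cnj (y k) * cip N (t k) (mapply N G x))"
    by (subst sum.swap) (simp add: cip_def sum_distrib_left)
  also have "\<dots> = cip N y y"
    unfolding cip_def[of N y] by (intro sum.cong refl) (simp add: tG)
  finally show ?thesis by (simp only: cip_self)
qed

section \<open>Rank, condition number and least squares\<close>

text \<open>Equivalent to \<open>injective_on\<close>, but made of finitely many equations between
  measurable functions of the grid, whereas \<open>injective_on\<close> quantifies over all vectors.
  This is how the full-rank event is seen to be measurable.\<close>

definition gs_orthonormal :: "nat \<Rightarrow> nat \<Rightarrow> (nat \<Rightarrow> nat \<Rightarrow> complex) \<Rightarrow> bool" where
  "gs_orthonormal K N b \<longleftrightarrow>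
     (\<forall>k<N. \<forall>l<N. (\<Sum>i<K. cnj (gs_factor K N b i k) * gs_factor K N b i l) = (if k = l then 1 else 0))"

text \<open>\<open>y\<close> is the adjoint of the factor applied to \<open>b x\<close>; these are
  the coordinates of \<open>x\<close> in the Gram--Schmidt basis.\<close>

lemma gs_factor_recover:
  assumes "gs_orthonormal K N b"
  obtains y where "\<And>k. k < N \<Longrightarrow> y k = (\<Sum>i<K. cnj (gs_factor K N b i k) * (\<Sum>j<N. b i j * x j))"
    "\<And>j. j < N \<Longrightarrow> x j = (\<Sum>k<N. gram_orthonormal N (column_gram K b) N k j * y k)"
    "\<And>i. (\<Sum>j<N. b i j * x j) = (\<Sum>k<N. gs_factor K N b i k * y k)"
proof
  define t where "t = gram_orthonormal N (column_gram K b) N"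
  define y where "y k = cip N (t k) (mapply N (column_gram K b) x)" for k
  show "y k = (\<Sum>i<K. cnj (gs_factor K N b i k) * (\<Sum>j<N. b i j * x j))" for k
    unfolding y_def cip_column_gram gs_factor_def t_def ..
  have "cip N (t k) (mapply N (column_gram K b) (t l)) = (if k = l then 1 else 0)" if "k < N" "l < N" for k l
    using assms that unfolding cip_column_gram gs_orthonormal_def gs_factor_def t_def by simp
  from gram_basis_expand[of N t, OF this]
  show x: "x j = (\<Sum>k<N. gram_orthonormal N (column_gram K b) N k j * y k)" if "j < N" for j
    using that unfolding y_def t_def by blast
  show "(\<Sum>j<N. b i j * x j) = (\<Sum>k<N. gs_factor K N b i k * y k)" for i
  proof -
    have "(\<Sum>j<N. b i j * x j) = (\<Sum>j<N. b i j * (\<Sum>k<N. t k j * y k))"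
      by (intro sum.cong refl) (simp add: x t_def)
    then show ?thesis by (simp only: sum_mult_assoc gs_factor_def t_def)
  qed
qed

lemma injective_on_iff_gs_orthonormal: "injective_on K N b \<longleftrightarrow> gs_orthonormal K N b"
proof
  assume "injective_on K N b"
  then show "gs_orthonormal K N b"
    unfolding gs_orthonormal_def using gs_factor_orthonormal by blast
next
  assume gs: "gs_orthonormal K N b"
  show "injective_on K N b"
    unfolding injective_on_def
  proof (intro allI impI)
    fix x :: "nat \<Rightarrow> complex" and j
    assume zero: "\<forall>i<K. (\<Sum>j<N. b i j * x j) = 0" and j: "j < N"
    obtain y where y: "\<And>k. k < N \<Longrightarrow> y k = (\<Sum>i<K. cnj (gs_factor K N b i k) * (\<Sum>j<N. b i j * x j))"
      and x: "\<And>j. j < N \<Longrightarrow> x j = (\<Sum>k<N. gram_orthonormal N (column_gram K b) N k j * y k)"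
      by (rule gs_factor_recover[OF gs, of x]) (rule that)
    have "y k = 0" if "k < N" for k using y[OF that] zero by simp
    then show "x j = 0" using x[OF j] by simp
  qed
qed

text \<open>\<open>w\<close> holds the coordinates of the orthogonal projection of \<open>b\<close>
  onto the range of \<open>a\<close>, and \<open>c\<close> pulls them back through the Gram--Schmidt
  basis. The residual is tested against the whole range, as Pythagoras requires.\<close>

lemma exists_normal_equations:
  fixes b :: "nat \<Rightarrow> complex"
  assumes "injective_on K N a"
  obtains c where "\<And>x. (\<Sum>i<K. cnj (\<Sum>k<N. a i k * x k) * ((\<Sum>k<N. a i k * c k) - b i)) = 0"
proof -
  have gs: "gs_orthonormal K N a" using assms by (simp only: injective_on_iff_gs_orthonormal)
  define q where "q = gs_factor K N a"
  define w where "w l = (\<Sum>i<K. cnj (q i l) * b i)" for l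
  define c where "c j = (\<Sum>l<N. gram_orthonormal N (column_gram K a) N l j * w l)" for j
  have qq: "(\<Sum>i<K. cnj (q i k) * q i l) = (if k = l then 1 else 0)" if "k < N" "l < N" for k l
    using gs that by (simp add: gs_orthonormal_def q_def)
  have ac: "(\<Sum>j<N. a i j * c j) = (\<Sum>l<N. q i l * w l)" for i
    unfolding c_def sum_mult_assoc q_def gs_factor_def ..
  have orth: "(\<Sum>i<K. cnj (q i k) * ((\<Sum>l<N. q i l * w l) - b i)) = 0" if k: "k < N" for k
  proof -
    have "(\<Sum>i<K. cnj (q i k) * (\<Sum>l<N. q i l * w l)) = w k"
      unfolding sum_mult_assoc by (rule sum_mult_delta[OF qq[OF k] k])
    then show ?thesis by (simp add: w_def right_diff_distrib sum_subtractf)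
  qed
  show ?thesis
  proof
    fix x
    obtain y where y: "\<And>i. (\<Sum>j<N. a i j * x j) = (\<Sum>k<N. q i k * y k)"
      by (rule gs_factor_recover[OF gs, of x, folded q_def]) (rule that, assumption)
    have "(\<Sum>i<K. cnj (\<Sum>k<N. a i k * x k) * ((\<Sum>k<N. a i k * c k) - b i))
        = (\<Sum>i<K. \<Sum>k<N. cnj (y k) * (cnj (q i k) * ((\<Sum>l<N. q i l * w l) - b i)))"
      unfolding y ac by (simp add: sum_distrib_right mult_ac)
    also have "\<dots> = (\<Sum>k<N. cnj (y k) * (\<Sum>i<K. cnj (q i k) * ((\<Sum>l<N. q i l * w l) - b i)))"
      by (subst sum.swap) (simp add: sum_distrib_left)
    finally show "(\<Sum>i<K. cnj (\<Sum>k<N. a i k * x k) * ((\<Sum>k<N. a i k * c k) - b i)) = 0"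
      by (simp add: orth)
  qed
qed

section \<open>Rank as injectivity\<close>

lemma rank_eq_iff_injective_on:
  fixes B :: "complex mat"
  assumes B: "B \<in> carrier_mat K N"
  shows "vec_space.rank K B = N \<longleftrightarrow> injective_on K N (\<lambda>i j. B $$ (i, j))"
proof -
  interpret vec_space "TYPE(complex)" K .
  have dims: "dim_row B = K" "dim_col B = N" using B by auto
  have mult: "B *\<^sub>v vec N x = 0\<^sub>v K \<longleftrightarrow> (\<forall>i<K. (\<Sum>j<N. B $$ (i, j) * x j) = 0)" for x
    by (auto simp: vec_eq_iff scalar_prod_def dims atLeast0LessThan row_def)
  show ?thesis
  proof
    assume rank: "rank B = N"
    \<comment> \<open>Independence is a property of the set of columns, so repetitions are excluded
      by counting: rank \<open>N\<close> needs \<open>N\<close> different columns.\<close>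
    have dist: "distinct (cols B)"
    proof (rule card_distinct)
      obtain S where S: "maximal S (\<lambda>T. T \<subseteq> set (cols B) \<and> lin_indpt T)"
        using maximal_exists[of "\<lambda>T. T \<subseteq> set (cols B) \<and> lin_indpt T" "card (set (cols B))" "{}"]
        by (meson List.finite_set card_mono empty_iff empty_subsetI finite_lin_indpt2 rev_finite_subset)
      then have "card S \<le> card (set (cols B))" by (simp add: card_mono maximal_def)
      then have "length (cols B) \<le> card (set (cols B))"
        using rank_card_indpt[OF B S] rank by (simp add: dims)
      then show "card (set (cols B)) = length (cols B)"
        using card_length[of "cols B"] by simp
    qed
    have indep: "lin_indpt (set (cols B))"
      by (rule full_rank_lin_indpt[OF B rank dist])
    show "injective_on K N (\<lambda>i j. B $$ (i, j))"
      unfolding injective_on_def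
    proof (intro allI impI)
      fix x :: "nat \<Rightarrow> complex" and j
      assume "\<forall>i<K. (\<Sum>j<N. B $$ (i, j) * x j) = 0" and j: "j < N"
      then have "B *\<^sub>v vec N x = 0\<^sub>v K" by (simp only: mult)
      then have "vec N x = 0\<^sub>v N" using lin_depI[OF B, of "vec N x"] dist indep by auto
      then have "vec_index (vec N x) j = vec_index (0\<^sub>v N) j" by simp
      then show "x j = 0" using j by simp
    qed
  next
    assume inj: "injective_on K N (\<lambda>i j. B $$ (i, j))"
    have dist: "distinct (cols B)"
      unfolding distinct_conv_nth
    proof (intro allI impI)
      fix k l assume "k < length (cols B)" "l < length (cols B)" and kl: "k \<noteq> l"
      then have k: "k < N" and l: "l < N" by (simp_all add: dims)
      show "cols B ! k \<noteq> cols B ! l"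
      proof
        assume "cols B ! k = cols B ! l"
        then have "col B k = col B l" using k l by (simp add: dims)
        then have eq: "B $$ (i, k) = B $$ (i, l)" if "i < K" for i
          using k l that by (metis dims index_col)
        \<comment> \<open>Two equal columns would annihilate the difference of two unit
          vectors.\<close>
        have "\<forall>i<K. (\<Sum>j<N. B $$ (i, j) * (unit_fun k j - unit_fun l j)) = 0"
          using k l eq by (simp add: right_diff_distrib sum_subtractf unit_fun_def
              if_distrib[of "\<lambda>c. _ * c"] cong: if_cong)
        from injective_onD[OF inj this] k have "unit_fun k k = unit_fun l k" by simp
        then show False using kl by (simp add: unit_fun_def)
      qed
    qed
    have "lin_indpt (set (cols B))"
    proof
      assume "lin_dep (set (cols B))"
      then obtain v where v: "v \<in> carrier_vec N" "v \<noteq> 0\<^sub>v N" "B *\<^sub>v v = 0\<^sub>v K"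
        using lin_depE[OF B _ dist] by blast
      have veq: "v = vec N (\<lambda>j. vec_index v j)" using v(1) by auto
      then have "B *\<^sub>v vec N (\<lambda>j. vec_index v j) = 0\<^sub>v K" using v(3) by simp
      from injective_onD[OF inj this[unfolded mult]] have "v = 0\<^sub>v N"
        using v(1) by (intro eq_vecI) auto
      with v(2) show False ..
    qed
    then show "rank B = N" by (rule lin_indpt_full_rank[OF B dist])
  qed
qed

section \<open>Adjoints, QR entries and singular values\<close>

lemma mat_adjoint_carrier: "A \<in> carrier_mat m n \<Longrightarrow> mat_adjoint A \<in> carrier_mat n m"
  by (auto simp: mat_adjoint_def)

lemma index_mat_adjoint:
  fixes A :: "complex mat"
  shows "A \<in> carrier_mat m n \<Longrightarrow> k < n \<Longrightarrow> i < m \<Longrightarrow> mat_adjoint A $$ (k, i) = cnj (A $$ (i, k))"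
  by (auto simp: mat_adjoint_def mat_of_rows_index)

lemma index_adjoint_times:
  fixes A :: "complex mat"
  assumes A: "A \<in> carrier_mat m n" and k: "k < n" and l: "l < n"
  shows "(mat_adjoint A * A) $$ (k, l) = column_gram m (\<lambda>i j. A $$ (i, j)) k l"
proof -
  note Ad = mat_adjoint_carrier[OF A]
  have "(mat_adjoint A * A) $$ (k, l) = (\<Sum>i<m. mat_adjoint A $$ (k, i) * A $$ (i, l))"
    using A Ad k l by (auto simp: scalar_prod_def atLeast0LessThan intro!: sum.cong)
  also have "\<dots> = column_gram m (\<lambda>i j. A $$ (i, j)) k l"
    unfolding column_gram_def using k by (intro sum.cong refl) (simp add: index_mat_adjoint[OF A])
  finally show ?thesis .
qed

lemma reduced_qr_entries:
  assumes "reduced_qr B Q R" and B: "B \<in> carrier_mat K N"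
  shows "Q \<in> carrier_mat K N" "R \<in> carrier_mat N N"
    and "\<And>k l. k < N \<Longrightarrow> l < N \<Longrightarrow> (\<Sum>i<K. cnj (Q $$ (i, k)) * Q $$ (i, l)) = (if k = l then 1 else 0)"
    and "\<And>i j. i < K \<Longrightarrow> j < N \<Longrightarrow> B $$ (i, j) = (\<Sum>k<N. Q $$ (i, k) * R $$ (k, j))"
    and "\<And>k j. k < N \<Longrightarrow> j < k \<Longrightarrow> R $$ (k, j) = 0"
    and "\<And>i w. i < K \<Longrightarrow> (\<Sum>j<N. B $$ (i, j) * w j) = (\<Sum>k<N. Q $$ (i, k) * (\<Sum>j<N. R $$ (k, j) * w j))"
proof -
  have dims: "dim_row B = K" "dim_col B = N" using B by auto
  note qr = assms(1)[unfolded reduced_qr_def dims]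
  show Q: "Q \<in> carrier_mat K N" and R: "R \<in> carrier_mat N N" using qr by auto
  show "(\<Sum>i<K. cnj (Q $$ (i, k)) * Q $$ (i, l)) = (if k = l then 1 else 0)" if "k < N" "l < N" for k l
    using index_adjoint_times[OF Q that] qr that by (simp add: column_gram_def)
  show *: "B $$ (i, j) = (\<Sum>k<N. Q $$ (i, k) * R $$ (k, j))" if "i < K" "j < N" for i j
    using qr Q R that by (auto simp: scalar_prod_def atLeast0LessThan intro!: sum.cong)
  show "(\<Sum>j<N. B $$ (i, j) * w j) = (\<Sum>k<N. Q $$ (i, k) * (\<Sum>j<N. R $$ (k, j) * w j))" if "i < K" for i w
    unfolding sum_mult_assoc using that by (intro sum.cong refl) (simp add: *)
  show "R $$ (k, j) = 0" if "k < N" "j < k" for k j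
    using qr R that by (auto simp: upper_triangular_def)
qed

text \<open>Eigenvalues of \<open>C\<close> are Rayleigh quotients, hence real and between
  \<open>\<alpha>\<close> and \<open>\<beta>\<close>. \<open>Min\<close> and \<open>Max\<close> are
  meaningful because the spectrum is finite and, for \<open>0 < n\<close>, nonempty;
  \<open>0 < \<alpha>\<close> excludes the infinite branch.\<close>

lemma condition_number_le:
  assumes A: "A \<in> carrier_mat m n" and n: "0 < n" and \<alpha>: "0 < \<alpha>"
    and lower: "\<And>x. \<alpha> * sqn n x \<le> (\<Sum>i<m. (cmod (\<Sum>k<n. A $$ (i, k) * x k))\<^sup>2)"
    and upper: "\<And>x. (\<Sum>i<m. (cmod (\<Sum>k<n. A $$ (i, k) * x k))\<^sup>2) \<le> \<beta> * sqn n x"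
  shows "condition_number A \<le> ereal (sqrt (\<beta> / \<alpha>))"
proof -
  define C where "C = mat_adjoint A * A"
  have C: "C \<in> carrier_mat n n" using A mat_adjoint_carrier[OF A] by (simp add: C_def)
  have ev: "\<exists>r. w = of_real r \<and> \<alpha> \<le> r \<and> r \<le> \<beta>" if "eigenvalue C w" for w
  proof -
    obtain v where v: "v \<in> carrier_vec n" "v \<noteq> 0\<^sub>v n" "C *\<^sub>v v = w \<cdot>\<^sub>v v"
      using \<open>eigenvalue C w\<close> C by (auto simp: eigenvalue_def eigenvector_def)
    define x where "x = (\<lambda>k. vec_index v k)"
    have "sqn n x \<noteq> 0"
    proof
      assume "sqn n x = 0"
      then have "v = 0\<^sub>v n" using v(1) unfolding sqn_eq_0_iff x_def by (intro eq_vecI) auto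
      with v(2) show False ..
    qed
    then have pos: "0 < sqn n x" using sqn_nonneg[of n x] by linarith
    have "mapply n (column_gram m (\<lambda>i j. A $$ (i, j))) x k = x k * w" if k: "k < n" for k
    proof -
      have "mapply n (column_gram m (\<lambda>i j. A $$ (i, j))) x k = vec_index (C *\<^sub>v v) k"
      proof -
        have "vec_index (C *\<^sub>v v) k = (\<Sum>l<n. C $$ (k, l) * vec_index v l)"
          using C v(1) k by (simp add: scalar_prod_def atLeast0LessThan)
        also have "\<dots> = mapply n (column_gram m (\<lambda>i j. A $$ (i, j))) x k"
          unfolding mapply_def x_def C_def
          by (intro sum.cong refl) (simp add: index_adjoint_times[OF A k] del: index_mult_mat)
        finally show ?thesis by simp
      qed
      then show ?thesis using v k by (simp add: x_def mult.commute)
    qed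
    then have "cip n x (mapply n (column_gram m (\<lambda>i j. A $$ (i, j))) x) = cip n x (\<lambda>k. x k * w)"
      by (intro cip_cong) auto
    then have "w * of_real (sqn n x) = cip n x (mapply n (column_gram m (\<lambda>i j. A $$ (i, j))) x)"
      by (simp only: cip_scale_right cip_self)
    also have "\<dots> = of_real (\<Sum>i<m. (cmod (\<Sum>k<n. A $$ (i, k) * x k))\<^sup>2)"
      unfolding cip_column_gram of_real_sum complex_norm_square by (simp add: mult.commute)
    finally have eq: "w * of_real (sqn n x) = of_real (\<Sum>i<m. (cmod (\<Sum>k<n. A $$ (i, k) * x k))\<^sup>2)" .
    define r where "r = (\<Sum>i<m. (cmod (\<Sum>k<n. A $$ (i, k) * x k))\<^sup>2) / sqn n x"
    have "w = of_real r"
      using eq pos by (simp add: r_def field_simps del: of_real_sum of_real_power)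
    moreover have "\<alpha> \<le> r" "r \<le> \<beta>"
      using lower[of x] upper[of x] pos by (simp_all add: r_def field_simps)
    ultimately show ?thesis by blast
  qed
  have bounds: "sqrt \<alpha> \<le> s \<and> s \<le> sqrt \<beta>" if "s \<in> singular_values A" for s
  proof -
    from that have s: "0 \<le> s" and "eigenvalue C (of_real (s\<^sup>2))"
      by (simp_all add: singular_values_def C_def)
    then obtain r where "complex_of_real (s\<^sup>2) = of_real r" "\<alpha> \<le> r" "r \<le> \<beta>" using ev by blast
    then have "\<alpha> \<le> s\<^sup>2" "s\<^sup>2 \<le> \<beta>" by (simp_all only: of_real_eq_iff)
    with s show ?thesis by (simp add: real_le_rsqrt real_le_lsqrt)
  qed
  have "singular_values A \<subseteq> (\<lambda>w. sqrt (Re w)) ` spectrum C"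
  proof
    fix s assume "s \<in> singular_values A"
    then have "0 \<le> s" "complex_of_real (s\<^sup>2) \<in> spectrum C"
      by (simp_all add: singular_values_def C_def spectrum_def)
    then show "s \<in> (\<lambda>w. sqrt (Re w)) ` spectrum C"
      by (intro image_eqI[of _ _ "complex_of_real (s\<^sup>2)"]) simp_all
  qed
  then have fin: "finite (singular_values A)"
    using card_finite_spectrum(1)[OF C] by (meson finite_imageI finite_subset)
  obtain w where w: "eigenvalue C w"
    using spectrum_non_empty[OF C] n by (auto simp: spectrum_def)
  then obtain r where r: "w = of_real r" "\<alpha> \<le> r" using ev by blast
  have "sqrt r \<in> singular_values A"
    using w r \<alpha> by (simp add: singular_values_def C_def del: of_real_power)
  then have ne: "singular_values A \<noteq> {}" by blast
  have min: "sqrt \<alpha> \<le> Min (singular_values A)" and max: "Max (singular_values A) \<le> sqrt \<beta>"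
    using Min_in[OF fin ne] Max_in[OF fin ne] bounds by blast+
  have s\<alpha>: "0 < sqrt \<alpha>" using \<alpha> by simp
  have "0 \<le> sqrt \<beta>" using bounds[OF Max_in[OF fin ne]] s\<alpha> by linarith
  then have "Max (singular_values A) / Min (singular_values A) \<le> sqrt \<beta> / sqrt \<alpha>"
    using min max s\<alpha> by (intro frac_le) auto
  moreover have "Min (singular_values A) \<noteq> 0" using min s\<alpha> by linarith
  ultimately show ?thesis
    by (simp add: condition_number_def real_sqrt_divide)
qed

section \<open>Least squares and the triangular factor\<close>

lemma vec_norm2_residual:
  assumes A: "A \<in> carrier_mat m n" and b: "b \<in> carrier_vec m" and x: "x \<in> carrier_vec n"
  shows "vec_norm2 (A *\<^sub>v x - b)
    = sqrt (\<Sum>i<m. (cmod ((\<Sum>k<n. A $$ (i, k) * vec_index x k) - vec_index b i))\<^sup>2)"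
  unfolding vec_norm2_def L2_set_def using A b x
  by (auto simp: scalar_prod_def atLeast0LessThan intro!: sum.cong)

text \<open>By Pythagoras the squared residual at \<open>x\<close> is the one at \<open>c\<close>
  plus the squared norm of \<open>A\<close> applied to \<open>x - c\<close>. The second conclusion
  keeps the latter term; minimality of \<open>c\<close> with the triangle inequality would lose a
  factor \<open>2\<close> in the norm.\<close>

lemma least_squares_unique:
  assumes A: "A \<in> carrier_mat m n" and b: "b \<in> carrier_vec m"
    and inj: "injective_on m n (\<lambda>i j. A $$ (i, j))"
  obtains c where "least_squares_sols A b = {vec n c}"
    "\<And>x. (\<Sum>i<m. (cmod (\<Sum>k<n. A $$ (i, k) * (x k - c k)))\<^sup>2)
       \<le> (\<Sum>i<m. (cmod ((\<Sum>k<n. A $$ (i, k) * x k) - vec_index b i))\<^sup>2)"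
proof -
  obtain c where c: "\<And>x. (\<Sum>i<m. cnj (\<Sum>k<n. A $$ (i, k) * x k) * ((\<Sum>k<n. A $$ (i, k) * c k) - vec_index b i)) = 0"
    by (rule exists_normal_equations[OF inj, of "vec_index b"]) (rule that, assumption)
  define res where "res x = (\<Sum>i<m. (cmod ((\<Sum>k<n. A $$ (i, k) * x k) - vec_index b i))\<^sup>2)" for x
  have pyth: "res x = (\<Sum>i<m. (cmod (\<Sum>k<n. A $$ (i, k) * (x k - c k)))\<^sup>2) + res c" for x
  proof -
    define u where "u i = (\<Sum>k<n. A $$ (i, k) * (x k - c k))" for i
    define r where "r i = (\<Sum>k<n. A $$ (i, k) * c k) - vec_index b i" for i
    have "(\<Sum>k<n. A $$ (i, k) * x k) - vec_index b i = u i + r i" for i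
      by (simp add: u_def r_def algebra_simps sum_subtractf)
    then have "res x = (\<Sum>i<m. (cmod (u i + r i))\<^sup>2)" by (simp add: res_def)
    also have "\<dots> = (\<Sum>i<m. (cmod (u i))\<^sup>2 + (cmod (r i))\<^sup>2 + 2 * Re (cnj (u i) * r i))"
      by (intro sum.cong refl) (simp add: cmod_power2, simp add: power2_eq_square algebra_simps)
    also have "\<dots> = (\<Sum>i<m. (cmod (u i))\<^sup>2) + res c + 2 * Re (\<Sum>i<m. cnj (u i) * r i)"
      by (simp add: sum.distrib sum_distrib_left res_def r_def)
    also have "(\<Sum>i<m. cnj (u i) * r i) = 0"
      unfolding u_def r_def by (rule c)
    finally show ?thesis by (simp add: u_def)
  qed
  have le: "res c \<le> res x" for x
    unfolding pyth[of x] by (simp add: sum_nonneg)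
  have norm: "vec_norm2 (A *\<^sub>v x - b) = sqrt (res (vec_index x))" if "x \<in> carrier_vec n" for x
    unfolding vec_norm2_residual[OF A b that] res_def ..
  have res_c: "res (vec_index (vec n c)) = res c"
    unfolding res_def by (intro sum.cong refl) simp
  have dim: "dim_col A = n" using A by simp
  have "least_squares_sols A b = {vec n c}"
  proof (intro equalityI subsetI)
    fix x assume "x \<in> least_squares_sols A b"
    then have x: "x \<in> carrier_vec n"
      and min: "\<not> vec_norm2 (A *\<^sub>v vec n c - b) < vec_norm2 (A *\<^sub>v x - b)"
      by (auto simp: least_squares_sols_def is_arg_min_def dim)
    have "res (vec_index x) \<le> res c"
      using min by (simp add: norm x res_c)
    then have "(\<Sum>i<m. (cmod (\<Sum>k<n. A $$ (i, k) * (vec_index x k - c k)))\<^sup>2) = 0"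
      using pyth[of "vec_index x"] sum_nonneg[of "{..<m}" "\<lambda>i. (cmod (\<Sum>k<n. A $$ (i, k) * (vec_index x k - c k)))\<^sup>2"]
      by simp
    then have "\<forall>i<m. (\<Sum>k<n. A $$ (i, k) * (vec_index x k - c k)) = 0"
      by (simp add: sum_nonneg_eq_0_iff)
    from injective_onD[OF inj this] have "\<forall>k<n. vec_index x k = c k" by simp
    then show "x \<in> {vec n c}" using x by auto
  next
    fix x assume "x \<in> {vec n c}"
    then show "x \<in> least_squares_sols A b"
      by (auto simp: least_squares_sols_def is_arg_min_def dim norm res_c le not_less)
  qed
  moreover have "(\<Sum>i<m. (cmod (\<Sum>k<n. A $$ (i, k) * (x k - c k)))\<^sup>2) \<le> res x" for x
    unfolding pyth[of x] by (simp add: res_def sum_nonneg)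
  ultimately show ?thesis using that unfolding res_def by blast
qed

text \<open>Rows are treated from the bottom up: in entry \<open>(j, i)\<close> of
  \<open>R * S\<close> the terms with \<open>k < j\<close> vanish as \<open>R\<close> is triangular,
  those with \<open>k > j\<close> by induction. It reconciles \<open>orth_fun\<close>, which sums
  over \<open>j \<le> i\<close>, with the full inverse.\<close>

lemma inverse_upper_triangular:
  fixes R S :: "complex mat"
  assumes R: "R \<in> carrier_mat n n" and S: "S \<in> carrier_mat n n" and RS: "R * S = 1\<^sub>m n"
    and upper: "\<And>k j. k < n \<Longrightarrow> j < k \<Longrightarrow> R $$ (k, j) = 0"
  shows "i < j \<Longrightarrow> j < n \<Longrightarrow> S $$ (j, i) = 0"
proof (induction "n - j" arbitrary: j rule: less_induct)
  case less
  have "det R * det S = 1"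
    using RS det_mult[OF R S] by simp
  then have "det R \<noteq> 0" by auto
  moreover have "upper_triangular R" using upper R by (auto simp: upper_triangular_def)
  ultimately have diag: "R $$ (j, j) \<noteq> 0"
    using upper_triangular_imp_det_eq_0_iff[OF R] less.prems R by (auto simp: diag_mat_def)
  have "0 = (R * S) $$ (j, i)" using RS less.prems by simp
  also have "\<dots> = (\<Sum>k<n. R $$ (j, k) * S $$ (k, i))"
    using R S less.prems by (auto simp: scalar_prod_def atLeast0LessThan intro!: sum.cong)
  also have "\<dots> = (\<Sum>k<n. if k = j then R $$ (j, j) * S $$ (j, i) else 0)"
  proof (intro sum.cong refl)
    fix k assume k: "k \<in> {..<n}"
    consider "k < j" | "k = j" | "j < k" by linarith
    then show "R $$ (j, k) * S $$ (k, i) = (if k = j then R $$ (j, j) * S $$ (j, i) else 0)"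
    proof cases
      case 3
      then have "S $$ (k, i) = 0" using less k by auto
      with 3 show ?thesis by simp
    qed (use upper less.prems in auto)
  qed
  also have "\<dots> = R $$ (j, j) * S $$ (j, i)" using less.prems by simp
  finally show ?case using diag by simp
qed

text \<open>A kernel vector of \<open>R\<close> would be one of \<open>B\<close>, so
  \<open>R\<close> is invertible, and \<open>d\<close> is its inverse applied to
  \<open>c\<close>.\<close>

lemma method_output_expansion:
  assumes qr: "reduced_qr B Q R" and B: "B \<in> carrier_mat K N"
    and inj: "injective_on K N (\<lambda>i j. B $$ (i, j))"
  obtains d where "\<And>x. (\<Sum>i<N. c i * orth_fun \<psi> R i x) = (\<Sum>j<N. d j * \<psi> j x)"
    "\<And>k. k < N \<Longrightarrow> (\<Sum>j<N. R $$ (k, j) * d j) = c k"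
proof -
  note Q = reduced_qr_entries(1)[OF qr B] and R = reduced_qr_entries(2)[OF qr B]
    and BQR = reduced_qr_entries(6)[OF qr B] and upper = reduced_qr_entries(5)[OF qr B]
  have "det R \<noteq> 0"
  proof
    assume "det R = 0"
    then obtain v where v: "v \<in> carrier_vec N" "v \<noteq> 0\<^sub>v N" "R *\<^sub>v v = 0\<^sub>v N"
      using det_0_iff_vec_prod_zero[OF R] by blast
    have Rv: "(\<Sum>j<N. R $$ (k, j) * vec_index v j) = 0" if "k < N" for k
    proof -
      have "(\<Sum>j<N. R $$ (k, j) * vec_index v j) = vec_index (R *\<^sub>v v) k"
        using R v(1) that by (simp add: scalar_prod_def atLeast0LessThan)
      then show ?thesis using v(3) that by simp
    qed
    have "\<forall>i<K. (\<Sum>j<N. B $$ (i, j) * vec_index v j) = 0"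
      by (simp add: BQR Rv)
    from injective_onD[OF inj this] have "v = 0\<^sub>v N" using v(1) by (intro eq_vecI) auto
    with v(2) show False ..
  qed
  then have "mat_inverse R \<noteq> None"
    using det_non_zero_imp_unit[OF R, of "()"] mat_inverse(1)[OF R, of "()"] by blast
  then obtain S where S: "mat_inverse R = Some S" by blast
  from mat_inverse(2)[OF R S] have RS: "R * S = 1\<^sub>m N" and Sc: "S \<in> carrier_mat N N" by auto
  define d where "d j = (\<Sum>i<N. S $$ (j, i) * c i)" for j
  show ?thesis
  proof
    show "(\<Sum>i<N. c i * orth_fun \<psi> R i x) = (\<Sum>j<N. d j * \<psi> j x)" for x
    proof -
      have orth: "orth_fun \<psi> R i x = (\<Sum>j<N. S $$ (j, i) * \<psi> j x)" if i: "i < N" for i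
      proof -
        have "orth_fun \<psi> R i x = (\<Sum>j\<le>i. S $$ (j, i) * \<psi> j x)"
          unfolding orth_fun_def S option.sel using Sc i by (intro sum.cong refl) auto
        also have "\<dots> = (\<Sum>j<N. S $$ (j, i) * \<psi> j x)"
          using i inverse_upper_triangular[OF R Sc RS upper]
          by (intro sum.mono_neutral_left) auto
        finally show ?thesis .
      qed
      have "(\<Sum>i<N. c i * orth_fun \<psi> R i x) = (\<Sum>i<N. c i * (\<Sum>j<N. S $$ (j, i) * \<psi> j x))"
        by (intro sum.cong refl) (simp add: orth)
      then show ?thesis unfolding sum_mult_assoc d_def by (simp add: mult.commute)
    qed
    show "(\<Sum>j<N. R $$ (k, j) * d j) = c k" if k: "k < N" for k
    proof -
      have "(\<Sum>j<N. R $$ (k, j) * S $$ (j, i)) = (if k = i then 1 else 0)" if i: "i < N" for i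
      proof -
        have "(\<Sum>j<N. R $$ (k, j) * S $$ (j, i)) = (R * S) $$ (k, i)"
          using R Sc k i by (auto simp: scalar_prod_def atLeast0LessThan intro!: sum.cong)
        then show ?thesis using k i by (simp add: RS)
      qed
      then show ?thesis unfolding d_def sum_mult_assoc by (rule sum_mult_delta[OF _ k])
    qed
  qed
qed

section \<open>Error of the least-squares approximation\<close>

lemma square_integrable_cmod_mult:
  assumes "square_integrable \<rho> f" "square_integrable \<rho> g"
  shows "integrable \<rho> (\<lambda>x. cmod (f x) * cmod (g x))"
proof (rule Bochner_Integration.integrable_bound)
  have [measurable]: "f \<in> borel_measurable \<rho>" "g \<in> borel_measurable \<rho>"
    using assms by (simp_all add: square_integrable_def)
  show "integrable \<rho> (\<lambda>x. (cmod (f x))\<^sup>2 + (cmod (g x))\<^sup>2)"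
    using assms by (simp add: square_integrable_def)
  show "(\<lambda>x. cmod (f x) * cmod (g x)) \<in> borel_measurable \<rho>"
    by measurable
  have "cmod (f x) * cmod (g x) \<le> (cmod (f x))\<^sup>2 + (cmod (g x))\<^sup>2" for x
    using sum_squares_bound[of "cmod (f x)" "cmod (g x)"] mult_nonneg_nonneg[OF norm_ge_zero norm_ge_zero, of "f x" "g x"]
    by linarith
  then show "AE x in \<rho>. norm (cmod (f x) * cmod (g x)) \<le> norm ((cmod (f x))\<^sup>2 + (cmod (g x))\<^sup>2)"
    by (intro AE_I2) simp
qed

lemma square_integrable_add:
  assumes "square_integrable \<rho> f" "square_integrable \<rho> g"
  shows "square_integrable \<rho> (\<lambda>x. f x + g x)"
  unfolding square_integrable_def
proof
  have [measurable]: "f \<in> borel_measurable \<rho>" "g \<in> borel_measurable \<rho>"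
    using assms by (simp_all add: square_integrable_def)
  show meas: "(\<lambda>x. f x + g x) \<in> borel_measurable \<rho>"
    by measurable
  show "integrable \<rho> (\<lambda>x. (cmod (f x + g x))\<^sup>2)"
  proof (rule Bochner_Integration.integrable_bound)
    show "integrable \<rho> (\<lambda>x. (cmod (f x))\<^sup>2 + (cmod (g x))\<^sup>2 + 2 * (cmod (f x) * cmod (g x)))"
      using assms square_integrable_cmod_mult[OF assms] by (simp add: square_integrable_def)
    show "(\<lambda>x. (cmod (f x + g x))\<^sup>2) \<in> borel_measurable \<rho>" using meas by simp
    have "(cmod (f x + g x))\<^sup>2 \<le> (cmod (f x) + cmod (g x))\<^sup>2" for x
      by (intro power_mono norm_triangle_ineq) simp
    then show "AE x in \<rho>. norm ((cmod (f x + g x))\<^sup>2)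
        \<le> norm ((cmod (f x))\<^sup>2 + (cmod (g x))\<^sup>2 + 2 * (cmod (f x) * cmod (g x)))"
      by (intro AE_I2) (simp add: power2_sum mult.assoc)
  qed
qed

lemma square_integrable_scale:
  "square_integrable \<rho> f \<Longrightarrow> square_integrable \<rho> (\<lambda>x. c * f x)"
  by (auto simp: square_integrable_def norm_mult power_mult_distrib)

lemma square_integrable_sum:
  fixes n :: nat
  assumes "\<And>j. j < n \<Longrightarrow> square_integrable \<rho> (f j)"
  shows "square_integrable \<rho> (\<lambda>x. \<Sum>j<n. c j * f j x)"
  using assms
proof (induction n)
  case 0
  show ?case by (simp add: square_integrable_def)
next
  case (Suc n)
  then show ?case by (simp add: square_integrable_add square_integrable_scale)
qed

lemma L2_norm_triangle:
  assumes f: "square_integrable \<rho> f" and g: "square_integrable \<rho> g"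
  shows "L2_norm \<rho> (\<lambda>x. f x + g x) \<le> L2_norm \<rho> f + L2_norm \<rho> g"
proof -
  have f2: "integrable \<rho> (\<lambda>x. (cmod (f x))\<^sup>2)" and g2: "integrable \<rho> (\<lambda>x. (cmod (g x))\<^sup>2)"
    using f g by (simp_all add: square_integrable_def)
  note fg = square_integrable_cmod_mult[OF f g]
  define a b c where "a = (\<integral>x. (cmod (f x))\<^sup>2 \<partial>\<rho>)" and "b = (\<integral>x. cmod (f x) * cmod (g x) \<partial>\<rho>)"
    and "c = (\<integral>x. (cmod (g x))\<^sup>2 \<partial>\<rho>)"
  have nn: "0 \<le> a" "0 \<le> b" "0 \<le> c" by (simp_all add: a_def b_def c_def)
  have "b\<^sup>2 \<le> a * c"
  proof (rule discriminant_le[OF nn(3)])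
    fix t
    have "0 \<le> (\<integral>x. (cmod (f x) + t * cmod (g x))\<^sup>2 \<partial>\<rho>)" by simp
    also have "\<dots> = (\<integral>x. (cmod (f x))\<^sup>2 + 2 * t * (cmod (f x) * cmod (g x)) + t\<^sup>2 * (cmod (g x))\<^sup>2 \<partial>\<rho>)"
      by (intro Bochner_Integration.integral_cong refl) (simp add: power2_eq_square algebra_simps)
    also have "\<dots> = a + 2 * t * b + t\<^sup>2 * c"
      using f2 g2 fg by (simp add: a_def b_def c_def)
    finally show "0 \<le> a + 2 * t * b + t\<^sup>2 * c" .
  qed
  then have "b \<le> sqrt a * sqrt c"
    using nn by (metis real_le_rsqrt real_sqrt_mult)
  have "(\<integral>x. (cmod (f x + g x))\<^sup>2 \<partial>\<rho>)
      \<le> (\<integral>x. (cmod (f x))\<^sup>2 + 2 * (cmod (f x) * cmod (g x)) + (cmod (g x))\<^sup>2 \<partial>\<rho>)"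
  proof (rule integral_mono)
    show "integrable \<rho> (\<lambda>x. (cmod (f x + g x))\<^sup>2)"
      using square_integrable_add[OF f g] by (simp add: square_integrable_def)
    show "(cmod (f x + g x))\<^sup>2 \<le> (cmod (f x))\<^sup>2 + 2 * (cmod (f x) * cmod (g x)) + (cmod (g x))\<^sup>2" for x
    proof -
      have "(cmod (f x + g x))\<^sup>2 \<le> (cmod (f x) + cmod (g x))\<^sup>2"
        by (intro power_mono norm_triangle_ineq) simp
      then show ?thesis by (simp add: power2_sum mult.assoc)
    qed
  qed (use f2 g2 fg in simp)
  also have "\<dots> = a + 2 * b + c" using f2 g2 fg by (simp add: a_def b_def c_def)
  also have "\<dots> \<le> a + 2 * (sqrt a * sqrt c) + c" using \<open>b \<le> sqrt a * sqrt c\<close> by simp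
  also have "\<dots> = (sqrt a + sqrt c)\<^sup>2" using nn by (simp add: power2_sum)
  finally show ?thesis
    unfolding L2_norm_def a_def[symmetric] c_def[symmetric] using nn by (intro real_le_lsqrt) simp_all
qed

lemma square_integrable_bounded:
  assumes "prob_space \<rho>" "bounded_measurable \<rho> f"
  shows "square_integrable \<rho> f"
proof -
  interpret prob_space \<rho> by fact
  obtain C where C: "\<And>x. x \<in> space \<rho> \<Longrightarrow> cmod (f x) \<le> C"
    using assms(2) by (auto simp: bounded_measurable_def bounded_iff)
  have meas: "f \<in> borel_measurable \<rho>" using assms(2) by (simp add: bounded_measurable_def)
  moreover have "integrable \<rho> (\<lambda>x. (cmod (f x))\<^sup>2)"
  proof (rule integrable_const_bound[where B = "C\<^sup>2"])
    show "AE x in \<rho>. norm ((cmod (f x))\<^sup>2) \<le> C\<^sup>2"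
      using C by (intro AE_I2) (simp add: power_mono)
  qed (use meas in simp)
  ultimately show ?thesis by (simp add: square_integrable_def)
qed

lemma sampling_prob_eq_leverage:
  "Q \<in> carrier_mat K N \<Longrightarrow> sampling_prob Q i = leverage N (\<lambda>i k. Q $$ (i, k)) i / real N"
  by (simp add: sampling_prob_def leverage_def)

lemma L2_basisD:
  assumes "L2_basis \<rho> P N \<psi>"
  shows "P = {p. \<exists>c. p = (\<lambda>x. \<Sum>j<N. c j * \<psi> j x)}"
    and "\<And>j. j < N \<Longrightarrow> square_integrable \<rho> (\<psi> j)"
    and "AE x in \<rho>. (\<Sum>j<N. c j * \<psi> j x) = 0 \<Longrightarrow> \<forall>j<N. c j = 0"
proof -
  note b = assms[unfolded L2_basis_def]
  show "P = {p. \<exists>c. p = (\<lambda>x. \<Sum>j<N. c j * \<psi> j x)}"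
    by (rule b[THEN conjunct2, THEN conjunct1])
  show "square_integrable \<rho> (\<psi> j)" if "j < N" for j
    by (rule b[THEN conjunct1, rule_format, OF that])
  show "AE x in \<rho>. (\<Sum>j<N. c j * \<psi> j x) = 0 \<Longrightarrow> \<forall>j<N. c j = 0"
    by (rule mp[OF spec[OF b[THEN conjunct2, THEN conjunct2], of c]])
qed

text \<open>The deterministic core. One factor \<open>1 - \<delta>\<close> is lost between
  \<open>L2_norm\<close> and the grid norm, another between the grid norm and the sampled rows. Both
  act on squares, so together they give \<open>1 / (1 - \<delta>)\<close> for the norm.\<close>

lemma oversampled_least_squares_error:
  fixes \<psi> :: "nat \<Rightarrow> 'a \<Rightarrow> complex" and \<delta> :: real
  assumes rho: "prob_space \<rho>" and N: "0 < N" and M: "0 < M" and basis: "L2_basis \<rho> P N \<psi>"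
    and qr: "reduced_qr (grid_mat K N \<psi> z) Q R" and \<delta>: "\<delta> < 1"
    and inj: "injective_on K N (\<lambda>i j. grid_mat K N \<psi> z $$ (i, j))"
    and grid: "\<And>d. (1 - \<delta>) * (L2_norm \<rho> (\<lambda>x. \<Sum>j<N. d j * \<psi> j x))\<^sup>2
        \<le> (\<Sum>i<K. (cmod (\<Sum>j<N. grid_mat K N \<psi> z $$ (i, j) * d j))\<^sup>2)"
    and \<iota>: "\<And>j. j < M \<Longrightarrow> \<iota> j < K \<and> 0 < sampling_prob Q (\<iota> j)"
    and sampled: "\<And>x. (1 - \<delta>) * sqn N x
        \<le> (\<Sum>j<M. (cmod (\<Sum>k<N. sampled_mat Q M \<iota> $$ (j, k) * x k))\<^sup>2)"
    and f: "bounded_measurable \<rho> f"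
  obtains g where "method_outputs \<psi> Q R M z \<iota> f = {g}"
    "L2_norm \<rho> (\<lambda>x. f x - g x) \<le>
       (INF p\<in>P. L2_norm \<rho> (\<lambda>x. f x - p x) +
          1 / (1 - \<delta>) * (MAX i\<in>{..<K}. cmod (f (z i) - p (z i)) / sqrt (real K * sampling_prob Q i)))"
proof -
  define B where "B = grid_mat K N \<psi> z"
  define A where "A = sampled_mat Q M \<iota>"
  define b where "b = sampled_rhs Q M z \<iota> f"
  have B: "B \<in> carrier_mat K N" by (simp add: B_def grid_mat_def)
  note qr' = qr[folded B_def] and inj' = inj[folded B_def]
  note Q = reduced_qr_entries(1)[OF qr' B] and R = reduced_qr_entries(2)[OF qr' B]
    and QQ = reduced_qr_entries(3)[OF qr' B] and BQR = reduced_qr_entries(6)[OF qr' B]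
  have dimQ: "dim_col Q = N" "dim_row Q = K" using Q by auto
  have K: "0 < K" using \<iota>[OF M] by simp
  have A: "A \<in> carrier_mat M N" by (simp add: A_def sampled_mat_def dimQ)
  have b: "b \<in> carrier_vec M" by (simp add: b_def sampled_rhs_def)
  have injA: "injective_on M N (\<lambda>i j. A $$ (i, j))"
    unfolding injective_on_def
  proof (intro allI impI)
    fix x :: "nat \<Rightarrow> complex" and j
    assume "\<forall>i<M. (\<Sum>k<N. A $$ (i, k) * x k) = 0" and j: "j < N"
    then have "(1 - \<delta>) * sqn N x \<le> 0" using sampled[of x] by (simp add: A_def)
    then have "sqn N x = 0" using \<delta> sqn_nonneg[of N x] by (simp add: mult_le_0_iff)
    then show "x j = 0" using j unfolding sqn_eq_0_iff by blast
  qed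
  obtain c where sols: "least_squares_sols A b = {vec N c}"
    and ls: "\<And>x. (\<Sum>i<M. (cmod (\<Sum>k<N. A $$ (i, k) * (x k - c k)))\<^sup>2)
       \<le> (\<Sum>i<M. (cmod ((\<Sum>k<N. A $$ (i, k) * x k) - vec_index b i))\<^sup>2)"
    by (rule least_squares_unique[OF A b injA]) (rule that)
  obtain d where d: "\<And>x. (\<Sum>i<N. c i * orth_fun \<psi> R i x) = (\<Sum>j<N. d j * \<psi> j x)"
    and Rd: "\<And>k. k < N \<Longrightarrow> (\<Sum>j<N. R $$ (k, j) * d j) = c k"
    by (rule method_output_expansion[OF qr' B inj', of c \<psi>]) (rule that)
  define g where "g = (\<lambda>x. \<Sum>j<N. d j * \<psi> j x)"
  have "method_outputs \<psi> Q R M z \<iota> f = {g}"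
  proof -
    have "(\<lambda>x. \<Sum>i<N. vec_index (vec N c) i * orth_fun \<psi> R i x) = g"
      unfolding g_def d[symmetric] by (intro ext sum.cong refl) simp
    then show ?thesis
      unfolding method_outputs_def A_def[symmetric] b_def[symmetric] sols dimQ by blast
  qed
  moreover have "L2_norm \<rho> (\<lambda>x. f x - g x) \<le> L2_norm \<rho> (\<lambda>x. f x - p x) +
      1 / (1 - \<delta>) * (MAX i\<in>{..<K}. cmod (f (z i) - p (z i)) / sqrt (real K * sampling_prob Q i))"
    if pP: "p \<in> P" for p
  proof -
    obtain e where p: "p = (\<lambda>x. \<Sum>j<N. e j * \<psi> j x)"
      using pP unfolding L2_basisD(1)[OF basis] by blast
    define m where "m = (MAX i\<in>{..<K}. cmod (f (z i) - p (z i)) / sqrt (real K * sampling_prob Q i))"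
    have m: "cmod (f (z i) - p (z i)) / sqrt (real K * sampling_prob Q i) \<le> m" if "i < K" for i
      unfolding m_def using that by (intro Max_ge) auto
    have prob_nn: "0 \<le> sampling_prob Q i" for i
      by (simp add: sampling_prob_def sum_nonneg)
    have "0 \<le> cmod (f (z 0) - p (z 0)) / sqrt (real K * sampling_prob Q 0)"
      using prob_nn by simp
    then have m0: "0 \<le> m" using m[OF K] by linarith
    \<comment> \<open>The coordinates of \<open>p\<close> in the basis \<open>orth_fun\<close>: the
      grid values of \<open>p\<close>, divided by \<open>sqrt (real K)\<close>, are \<open>Q\<close>
      applied to \<open>x\<close>.\<close>
    define x where "x k = (\<Sum>j<N. R $$ (k, j) * e j)" for k
    have isometry: "(\<Sum>i<K. (cmod (\<Sum>k<N. Q $$ (i, k) * y k))\<^sup>2) = sqn N y" for y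
    proof -
      have "moment N (column_gram K (\<lambda>i k. Q $$ (i, k))) y 1 = Re (cip N y y)"
      proof -
        have "cip N y (mapply N (column_gram K (\<lambda>i k. Q $$ (i, k))) y) = cip N y y"
      proof (rule cip_cong[OF refl])
        fix k assume k: "k < N"
        show "mapply N (column_gram K (\<lambda>i k. Q $$ (i, k))) y k = y k"
          unfolding mapply_def column_gram_def by (rule sum_mult_delta[OF QQ[OF k] k])
      qed
      then show ?thesis by (simp add: moment_def)
      qed
      then show ?thesis unfolding moment_column_gram by (simp add: cip_self)
    qed
    have "(1 - \<delta>) * (L2_norm \<rho> (\<lambda>t. \<Sum>j<N. (e j - d j) * \<psi> j t))\<^sup>2
        \<le> (\<Sum>i<K. (cmod (\<Sum>j<N. B $$ (i, j) * (e j - d j)))\<^sup>2)"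
      unfolding B_def by (rule grid)
    also have "\<dots> = (\<Sum>i<K. (cmod (\<Sum>k<N. Q $$ (i, k) * (\<Sum>j<N. R $$ (k, j) * (e j - d j))))\<^sup>2)"
      by (intro sum.cong refl) (simp add: BQR)
    also have "\<dots> = sqn N (\<lambda>k. \<Sum>j<N. R $$ (k, j) * (e j - d j))" by (rule isometry)
    also have "\<dots> = sqn N (\<lambda>k. x k - c k)"
      unfolding sqn_def by (intro sum.cong refl) (simp add: x_def Rd[symmetric] right_diff_distrib sum_subtractf)
    finally have 1: "(1 - \<delta>) * (L2_norm \<rho> (\<lambda>t. \<Sum>j<N. (e j - d j) * \<psi> j t))\<^sup>2 \<le> sqn N (\<lambda>k. x k - c k)" .
    have "(1 - \<delta>) * sqn N (\<lambda>k. x k - c k) \<le> (\<Sum>j<M. (cmod (\<Sum>k<N. A $$ (j, k) * (x k - c k)))\<^sup>2)"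
      unfolding A_def by (rule sampled)
    also have "\<dots> \<le> (\<Sum>j<M. (cmod ((\<Sum>k<N. A $$ (j, k) * x k) - vec_index b j))\<^sup>2)" by (rule ls)
    \<comment> \<open>\<open>A\<close> and \<open>b\<close> carry matching weights, so each residual
      entry is a weighted grid error of modulus at most \<open>m / sqrt (real M)\<close>.\<close>
    also have "\<dots> \<le> (\<Sum>j<M. m\<^sup>2 / real M)"
    proof (rule sum_mono)
      fix j assume "j \<in> {..<M}"
      then have j: "j < M" and i: "\<iota> j < K" and prob: "0 < sampling_prob Q (\<iota> j)" using \<iota> by auto
      define s where "s = sqrt (real M * sampling_prob Q (\<iota> j))"
      have s: "0 < s" using M prob by (simp add: s_def)
      have "(\<Sum>k<N. A $$ (j, k) * x k) = (\<Sum>k<N. Q $$ (\<iota> j, k) * x k) / of_real s"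
        using j by (simp add: A_def sampled_mat_def dimQ s_def sum_divide_distrib)
      also have "(\<Sum>k<N. Q $$ (\<iota> j, k) * x k) = (\<Sum>l<N. B $$ (\<iota> j, l) * e l)"
        unfolding x_def by (rule BQR[OF i, symmetric])
      also have "\<dots> = p (z (\<iota> j)) / of_real (sqrt (real K))"
        using i by (simp add: B_def grid_mat_def p sum_divide_distrib mult.commute)
      finally have Ax: "(\<Sum>k<N. A $$ (j, k) * x k) = p (z (\<iota> j)) / of_real (sqrt (real K) * s)" by simp
      have "vec_index b j = f (z (\<iota> j)) / of_real (sqrt (real K) * s)"
        using j by (simp add: b_def sampled_rhs_def dimQ s_def real_sqrt_mult mult_ac)
      then have "cmod ((\<Sum>k<N. A $$ (j, k) * x k) - vec_index b j)
          = cmod ((p (z (\<iota> j)) - f (z (\<iota> j))) / of_real (sqrt (real K) * s))"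
        unfolding Ax diff_divide_distrib by (simp only:)
      also have "\<dots> = cmod (f (z (\<iota> j)) - p (z (\<iota> j))) / (sqrt (real K) * s)"
        using s by (simp add: norm_divide norm_mult norm_minus_commute)
      also have "\<dots> = cmod (f (z (\<iota> j)) - p (z (\<iota> j))) / sqrt (real K * sampling_prob Q (\<iota> j)) / sqrt (real M)"
        by (simp add: s_def real_sqrt_mult mult_ac)
      also have "\<dots> \<le> m / sqrt (real M)"
        using m[OF i] by (intro divide_right_mono) simp_all
      finally have "(cmod ((\<Sum>k<N. A $$ (j, k) * x k) - vec_index b j))\<^sup>2 \<le> (m / sqrt (real M))\<^sup>2"
        by (intro power_mono) simp_all
      then show "(cmod ((\<Sum>k<N. A $$ (j, k) * x k) - vec_index b j))\<^sup>2 \<le> m\<^sup>2 / real M"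
        by (simp add: power_divide)
    qed
    also have "\<dots> = m\<^sup>2" using M by simp
    finally have 2: "(1 - \<delta>) * sqn N (\<lambda>k. x k - c k) \<le> m\<^sup>2" .
    have "((1 - \<delta>) * L2_norm \<rho> (\<lambda>t. \<Sum>j<N. (e j - d j) * \<psi> j t))\<^sup>2
        = (1 - \<delta>) * ((1 - \<delta>) * (L2_norm \<rho> (\<lambda>t. \<Sum>j<N. (e j - d j) * \<psi> j t))\<^sup>2)"
      by (simp add: power2_eq_square mult_ac)
    also have "\<dots> \<le> (1 - \<delta>) * sqn N (\<lambda>k. x k - c k)"
      using 1 \<delta> by (intro mult_left_mono) simp_all
    also note 2
    finally have "(1 - \<delta>) * L2_norm \<rho> (\<lambda>t. \<Sum>j<N. (e j - d j) * \<psi> j t) \<le> m"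
      using m0 by (rule power2_le_imp_le)
    moreover have pg_eq: "(\<lambda>t. p t - g t) = (\<lambda>t. \<Sum>j<N. (e j - d j) * \<psi> j t)"
      by (simp add: p g_def left_diff_distrib sum_subtractf)
    ultimately have pg: "L2_norm \<rho> (\<lambda>t. p t - g t) \<le> 1 / (1 - \<delta>) * m"
      using \<delta> by (simp add: pos_le_divide_eq mult.commute)
    have si: "square_integrable \<rho> (\<psi> j)" if "j < N" for j
      using that by (rule L2_basisD(2)[OF basis])
    have "(\<lambda>t. f t - p t) = (\<lambda>t. f t + (\<Sum>j<N. (- e j) * \<psi> j t))"
      by (simp add: p sum_negf)
    then have sf: "square_integrable \<rho> (\<lambda>t. f t - p t)"
      by (simp only:) (intro square_integrable_add square_integrable_bounded[OF rho f] square_integrable_sum si)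
    have sg: "square_integrable \<rho> (\<lambda>t. p t - g t)"
      unfolding pg_eq by (intro square_integrable_sum si)
    have "L2_norm \<rho> (\<lambda>t. f t - g t) \<le> L2_norm \<rho> (\<lambda>t. f t - p t) + L2_norm \<rho> (\<lambda>t. p t - g t)"
      using L2_norm_triangle[OF sf sg] by simp
    with pg show ?thesis by (simp add: m_def)
  qed
  moreover have "P \<noteq> {}" unfolding L2_basisD(1)[OF basis] by blast
  ultimately show ?thesis by (intro that cINF_greatest)
qed

section \<open>Tail rates and the joint law\<close>

text \<open>The free parameter of Chernoff's method enters as a scaling of the vectors: it leaves
  \<open>\<kappa> / R\<close> fixed and changes the term \<open>exp R\<close> in the tail
  bounds.\<close>

lemma (in isotropic_vector) isotropic_scale:
  assumes c: "0 \<le> c"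
  shows "isotropic_vector \<mu> N (\<lambda>s k. a s k * of_real (sqrt c)) (c * R) (c * \<kappa>)"
proof
  show "sqn N (\<lambda>k. a s k * of_real (sqrt c)) \<le> c * R" if "s \<in> space \<mu>" for s
    using R[OF that] c by (simp add: sqn_scale mult_left_mono)
  show "(\<lambda>s. a s i * of_real (sqrt c)) \<in> borel_measurable \<mu>" if "i < N" for i
    using meas[OF that] by simp
  show "(\<integral>s. cnj (a s i * of_real (sqrt c)) * (a s k * of_real (sqrt c)) \<partial>\<mu>) = (if i = k then of_real (c * \<kappa>) else 0)"
    if "i < N" "k < N" for i k
  proof -
    have c2: "complex_of_real (sqrt c) * of_real (sqrt c) = of_real c"
      using c by (simp flip: of_real_mult)
    have "cnj (a s i * of_real (sqrt c)) * (a s k * of_real (sqrt c))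
        = (of_real (sqrt c) * of_real (sqrt c)) * (cnj (a s i) * a s k)" for s
      by (simp add: mult_ac)
    then have "(\<integral>s. cnj (a s i * of_real (sqrt c)) * (a s k * of_real (sqrt c)) \<partial>\<mu>)
        = (\<integral>s. of_real c * (cnj (a s i) * a s k) \<partial>\<mu>)"
      by (simp only: c2)
    then show ?thesis using second_moment[OF that] by simp
  qed
qed

text \<open>The scalings \<open>- ln (1 - \<delta>)\<close> and \<open>ln (1 + \<delta>)\<close> are the optimal parameters in the two Chernoff bounds.\<close>

definition lower_event :: "nat \<Rightarrow> nat \<Rightarrow> real \<Rightarrow> real \<Rightarrow> (nat \<Rightarrow> nat \<Rightarrow> complex) \<Rightarrow> bool" where
  "lower_event N M L \<delta> d \<longleftrightarrow>
     lower_certificate N M (- ln (1 - \<delta>)) (- ln (1 - \<delta>) * (real M / L * (1 - \<delta>)))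
       (\<lambda>m k. d m k * of_real (sqrt (- ln (1 - \<delta>))))"

definition upper_event :: "nat \<Rightarrow> nat \<Rightarrow> real \<Rightarrow> real \<Rightarrow> (nat \<Rightarrow> nat \<Rightarrow> complex) \<Rightarrow> bool" where
  "upper_event N M L \<delta> d \<longleftrightarrow>
     upper_certificate N M (ln (1 + \<delta>) * (real M / L * (1 + \<delta>)))
       (\<lambda>m k. d m k * of_real (sqrt (ln (1 + \<delta>))))"

lemma measurable_upper_event:
  assumes "\<And>m i. m < M \<Longrightarrow> i < N \<Longrightarrow> (\<lambda>x. v x m i) \<in> borel_measurable \<Sigma>"
  shows "Measurable.pred \<Sigma> (\<lambda>x. upper_event N M L \<delta> (v x))"
  unfolding upper_event_def
  by (intro measurable_upper_certificate borel_measurable_times assms borel_measurable_const)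

lemma measurable_lower_event:
  assumes "\<And>m i. m < M \<Longrightarrow> i < N \<Longrightarrow> (\<lambda>x. v x m i) \<in> borel_measurable \<Sigma>"
  shows "Measurable.pred \<Sigma> (\<lambda>x. lower_event N M L \<delta> (v x))"
  unfolding lower_event_def
  by (intro measurable_lower_certificate borel_measurable_times assms borel_measurable_const)

lemma frame_sum_scale_left:
  assumes "0 \<le> c"
  shows "frame_sum N M (\<lambda>m k. d m k * of_real (sqrt c)) x = c * frame_sum N M d x"
  using assms by (simp add: frame_sum_def cip_scale_left norm_mult power_mult_distrib sum_distrib_left)

text \<open>For vectors with \<open>\<kappa> = 1 / L\<close> the mean of the sum is
  \<open>real M / L\<close> times the identity, so this is a relative bound. The scaling
  cancels.\<close>

lemma lower_event_bound:
  assumes "lower_event N M L \<delta> d" and \<delta>: "0 < \<delta>" "\<delta> < 1" and d: "\<And>m. m < M \<Longrightarrow> sqn N (d m) \<le> 1"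
  shows "real M / L * (1 - \<delta>) * sqn N x \<le> frame_sum N M d x"
proof -
  define r where "r = - ln (1 - \<delta>)"
  have r: "0 < r" using \<delta> by (simp add: r_def)
  have "sqn N (\<lambda>k. d m k * of_real (sqrt r)) \<le> r" if "m < M" for m
    using mult_left_mono[OF d[OF that], of r] r by (simp add: sqn_scale)
  from lower_certificate_bound[OF assms(1)[unfolded lower_event_def r_def[symmetric]] this]
  have "r * (real M / L * (1 - \<delta>)) * sqn N x \<le> frame_sum N M (\<lambda>m k. d m k * of_real (sqrt r)) x" .
  also have "\<dots> = r * frame_sum N M d x" using r by (intro frame_sum_scale_left) simp
  finally show ?thesis using r by (simp only: mult.assoc mult_le_cancel_left_pos)
qed

lemma upper_event_bound:
  assumes "upper_event N M L \<delta> d" and \<delta>: "0 < \<delta>" and L: "0 < L"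
  shows "frame_sum N M d x \<le> real M / L * (1 + \<delta>) * sqn N x"
proof -
  define r where "r = ln (1 + \<delta>)"
  have r: "0 < r" using \<delta> by (simp add: r_def)
  have "r * frame_sum N M d x = frame_sum N M (\<lambda>m k. d m k * of_real (sqrt r)) x"
    using r by (intro frame_sum_scale_left[symmetric]) simp
  also have "\<dots> \<le> r * (real M / L * (1 + \<delta>)) * sqn N x"
    using r \<delta> L by (intro upper_certificate_bound assms(1)[unfolded upper_event_def r_def[symmetric]]) simp
  finally show ?thesis using r by (simp only: mult.assoc mult_le_cancel_left_pos)
qed

lemma PiM_not_lower_event:
  assumes iso: "isotropic_vector \<mu> N a 1 (1 / L)" and N: "0 < N" and \<delta>: "0 < \<delta>" "\<delta> < 1"
  shows "emeasure (PiM {..<M} (\<lambda>_. \<mu>)) {w \<in> space (PiM {..<M} (\<lambda>_. \<mu>)). \<not> lower_event N M L \<delta> (\<lambda>m. a (w m))}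
    \<le> ennreal (real N * exp (- (real M / L * ((1 - \<delta>) * ln (1 - \<delta>) + \<delta>))))"
proof -
  define r where "r = - ln (1 - \<delta>)"
  have r: "0 < r" "exp (- r) = 1 - \<delta>" using \<delta> by (simp_all add: r_def)
  interpret a: isotropic_vector \<mu> N a 1 "1 / L" by fact
  interpret isotropic_vector \<mu> N "\<lambda>s k. a s k * of_real (sqrt r)" r "r / L"
    using a.isotropic_scale[of r] r by simp
  \<comment> \<open>\<open>exp (- r) = 1 - \<delta>\<close> is the stationarity condition of the
    exponent in \<open>r\<close>; inserting it produces the rate.\<close>
  have "r * (real M / L * (1 - \<delta>)) - real M * (r / L) / r * (1 - exp (- r))
      = - (real M / L * ((1 - \<delta>) * ln (1 - \<delta>) + \<delta>))"
    using r(1) by (simp add: r(2)) (simp add: r_def algebra_simps add_divide_distrib diff_divide_distrib)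
  with PiM_not_lower_certificate[OF N r(1), of M "r * (real M / L * (1 - \<delta>))"]
  show ?thesis by (simp only: lower_event_def r_def[symmetric])
qed

lemma Pi_pmf_not_lower_event:
  assumes iso: "isotropic_vector (measure_pmf p) N a 1 (1 / L)" and N: "0 < N" and \<delta>: "0 < \<delta>" "\<delta> < 1"
  shows "emeasure (measure_pmf (Pi_pmf {..<M} x0 (\<lambda>_. p))) {w. \<not> lower_event N M L \<delta> (\<lambda>m. a (w m))}
    \<le> ennreal (real N * exp (- (real M / L * ((1 - \<delta>) * ln (1 - \<delta>) + \<delta>))))"
proof -
  define r where "r = - ln (1 - \<delta>)"
  have r: "0 < r" "exp (- r) = 1 - \<delta>" using \<delta> by (simp_all add: r_def)
  interpret a: isotropic_vector "measure_pmf p" N a 1 "1 / L" by fact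
  interpret isotropic_vector "measure_pmf p" N "\<lambda>s k. a s k * of_real (sqrt r)" r "r / L"
    using a.isotropic_scale[of r] r by simp
  have "r * (real M / L * (1 - \<delta>)) - real M * (r / L) / r * (1 - exp (- r))
      = - (real M / L * ((1 - \<delta>) * ln (1 - \<delta>) + \<delta>))"
    using r(1) by (simp add: r(2)) (simp add: r_def algebra_simps add_divide_distrib diff_divide_distrib)
  with Pi_pmf_not_certificate(1)[OF refl N r(1), of M x0 "r * (real M / L * (1 - \<delta>))"]
  show ?thesis by (simp only: lower_event_def r_def[symmetric])
qed

lemma Pi_pmf_not_upper_event:
  assumes iso: "isotropic_vector (measure_pmf p) N a 1 (1 / L)" and N: "0 < N" and L: "0 < L" and \<delta>: "0 < \<delta>"
  shows "emeasure (measure_pmf (Pi_pmf {..<M} x0 (\<lambda>_. p))) {w. \<not> upper_event N M L \<delta> (\<lambda>m. a (w m))}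
    \<le> ennreal (real N * exp (- (real M / L * ((1 + \<delta>) * ln (1 + \<delta>) - \<delta>))))"
proof -
  define r where "r = ln (1 + \<delta>)"
  have r: "0 < r" "exp r = 1 + \<delta>" using \<delta> by (simp_all add: r_def)
  interpret a: isotropic_vector "measure_pmf p" N a 1 "1 / L" by fact
  interpret isotropic_vector "measure_pmf p" N "\<lambda>s k. a s k * of_real (sqrt r)" r "r / L"
    using a.isotropic_scale[of r] r by simp
  have "real M * (r / L) / r * (exp r - 1) - r * (real M / L * (1 + \<delta>))
      = - (real M / L * ((1 + \<delta>) * ln (1 + \<delta>) - \<delta>))"
    using r(1) by (simp add: r(2)) (simp add: r_def algebra_simps add_divide_distrib diff_divide_distrib)
  moreover have "0 \<le> r * (real M / L * (1 + \<delta>))" using r L \<delta> by simp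
  ultimately show ?thesis
    using Pi_pmf_not_certificate(2)[OF refl N r(1), of "r * (real M / L * (1 + \<delta>))" M x0]
    by (simp only: upper_event_def r_def[symmetric])
qed

section \<open>Comparison of the two Chernoff rates, and the law of a sampled row\<close>

lemma ln_less_minus_one: "0 < x \<Longrightarrow> x \<noteq> 1 \<Longrightarrow> ln x < x - (1::real)"
  using ln_le_minus_one[of x] ln_eq_minus_one[of x] by fastforce

lemma rate_plus_pos:
  assumes "0 < (\<delta>::real)"
  shows "0 < (1 + \<delta>) * ln (1 + \<delta>) - \<delta>"
proof -
  have "ln (1 / (1 + \<delta>)) < 1 / (1 + \<delta>) - 1"
    using assms by (intro ln_less_minus_one) auto
  then have "- ln (1 + \<delta>) < - \<delta> / (1 + \<delta>)"
    using assms by (simp add: ln_div field_simps)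
  then show ?thesis using assms by (simp add: field_simps)
qed

text \<open>The hypothesis on \<open>M\<close> is stated with the upper rate, while the sample needs
  both tails. The difference of the rates vanishes at \<open>0\<close> and has the nonnegative
  derivative \<open>- ln ((1 - x) * (1 + x))\<close>.\<close>

lemma rate_plus_le_rate_minus:
  assumes "0 \<le> (\<delta>::real)" "\<delta> < 1"
  shows "(1 + \<delta>) * ln (1 + \<delta>) - \<delta> \<le> (1 - \<delta>) * ln (1 - \<delta>) + \<delta>"
proof -
  define g where "g x = (1 - x) * ln (1 - x) + x - ((1 + x) * ln (1 + x) - x)" for x :: real
  have "g 0 \<le> g \<delta>"
  proof (rule DERIV_nonneg_imp_nondecreasing[OF assms(1)])
    fix x assume x: "0 \<le> x" "x \<le> \<delta>"
    then have x1: "x < 1" using assms by simp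
    have "(g has_real_derivative - ln (1 - x) - ln (1 + x)) (at x)"
      unfolding g_def using x x1 by (auto intro!: derivative_eq_intros)
    moreover have "ln (1 - x) + ln (1 + x) = ln ((1 - x) * (1 + x))"
      using x x1 by (simp add: ln_mult)
    moreover have "(1 - x) * (1 + x) \<le> 1" by (simp add: algebra_simps)
    then have "ln ((1 - x) * (1 + x)) \<le> 0" using x x1 by simp
    ultimately show "\<exists>y. (g has_real_derivative y) (at x) \<and> 0 \<le> y" by auto
  qed
  then show ?thesis by (simp add: g_def)
qed

text \<open>A normalised row, drawn with probability proportional to its squared length, has as
  second moment \<open>1 / real N\<close> times the adjoint of \<open>q\<close> times
  \<open>q\<close>. This is the gain from leverage sampling: the bound \<open>1\<close> on the
  length does not depend on \<open>q\<close>. The conjugate offsets the one in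
  \<open>cip\<close>.\<close>

lemma isotropic_sampling:
  fixes q :: "nat \<Rightarrow> nat \<Rightarrow> complex"
  assumes N: "0 < N"
    and orth: "\<And>k l. k < N \<Longrightarrow> l < N \<Longrightarrow> (\<Sum>i<K. cnj (q i k) * q i l) = (if k = l then 1 else 0)"
    and p: "\<And>i. pmf p i = (if i < K then leverage N q i / real N else 0)"
  shows "isotropic_vector (measure_pmf p) N (\<lambda>s k. cnj (q s k) / of_real (sqrt (leverage N q s))) 1 (1 / real N)"
proof
  have lev: "0 \<le> leverage N q s" for s by (simp add: leverage_def sum_nonneg)
  show "sqn N (\<lambda>k. cnj (q s k) / of_real (sqrt (leverage N q s))) \<le> 1" for s
  proof -
    have "sqn N (\<lambda>k. cnj (q s k) / of_real (sqrt (leverage N q s))) = leverage N q s / leverage N q s"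
      using lev[of s] by (simp add: sqn_def norm_divide power_divide flip: sum_divide_distrib) (simp add: leverage_def)
    then show ?thesis by simp
  qed
  fix i k assume i: "i < N" and k: "k < N"
  let ?a = "\<lambda>s k. cnj (q s k) / complex_of_real (sqrt (leverage N q s))"
  have "(\<integral>s. cnj (?a s i) * ?a s k \<partial>measure_pmf p) = (\<Sum>s<K. pmf p s *\<^sub>R (cnj (?a s i) * ?a s k))"
    by (rule integral_measure_pmf) (auto simp: p set_pmf_eq split: if_splits)
  also have "\<dots> = (\<Sum>s<K. cnj (q s k) * q s i / of_real (real N))"
  proof (intro sum.cong refl)
    fix s assume s: "s \<in> {..<K}"
    show "pmf p s *\<^sub>R (cnj (?a s i) * ?a s k) = cnj (q s k) * q s i / of_real (real N)"
    proof (cases "leverage N q s = 0")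
      case True
      \<comment> \<open>A row of leverage \<open>0\<close> vanishes, so both sides are
        \<open>0\<close>.\<close>
      then have "q s k = 0" using k by (auto simp: leverage_def sum_nonneg_eq_0_iff)
      then show ?thesis by simp
    next
      case False
      have "cnj (?a s i) * ?a s k = cnj (q s k) * q s i / of_real (sqrt (leverage N q s) * sqrt (leverage N q s))"
        by (simp add: mult_ac del: real_sqrt_mult_self)
      also have "sqrt (leverage N q s) * sqrt (leverage N q s) = leverage N q s" using lev by simp
      finally show ?thesis using False s by (simp add: p scaleR_conv_of_real)
    qed
  qed
  also have "\<dots> = (if i = k then of_real (1 / real N) else 0)"
    using orth[OF k i] by (simp flip: sum_divide_distrib)
  finally show "(\<integral>s. cnj (?a s i) * ?a s k \<partial>measure_pmf p) = (if i = k then of_real (1 / real N) else 0)" .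
qed simp

section \<open>The sampling kernel and the joint law\<close>

lemma measurable_Pi_pmf_kernel:
  fixes p :: "'w \<Rightarrow> nat pmf" and M :: nat
  assumes meas: "\<And>i. (\<lambda>z. pmf (p z) i) \<in> borel_measurable \<Sigma>"
    and supp: "\<And>z. set_pmf (p z) \<subseteq> {..<K}"
  shows "(\<lambda>z. measure_pmf (Pi_pmf {..<M} (0::nat) (\<lambda>_. p z))) \<in> measurable \<Sigma> (subprob_algebra (count_space UNIV))"
proof (rule measurable_subprob_algebra)
  show "subprob_space (measure_pmf (Pi_pmf {..<M} 0 (\<lambda>_. p z)))" for z
    by (rule measure_pmf.subprob_space_axioms)
  show "sets (measure_pmf (Pi_pmf {..<M} 0 (\<lambda>_. p z))) = sets (count_space UNIV)" for z by simp
  fix A :: "(nat \<Rightarrow> nat) set"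
  \<comment> \<open>All draws lie in the finite set \<open>I\<close>, so the probability of an
    arbitrary set of index functions is a finite sum of products of point masses.\<close>
  define I where "I = PiE_dflt {..<M} (0::nat) (\<lambda>_. {..<K})"
  have fin: "finite (A \<inter> I)" unfolding I_def by (intro finite_Int disjI2 finite_PiE_dflt) auto
  have "emeasure (measure_pmf (Pi_pmf {..<M} 0 (\<lambda>_. p z))) A = (\<Sum>w\<in>A \<inter> I. ennreal (pmf (Pi_pmf {..<M} 0 (\<lambda>_. p z)) w))" for z
  proof -
    have "set_pmf (Pi_pmf {..<M} 0 (\<lambda>_. p z)) \<subseteq> I"
      unfolding I_def using supp[of z] by (subst set_Pi_pmf) (auto simp: PiE_dflt_def)
    then have "A \<inter> set_pmf (Pi_pmf {..<M} 0 (\<lambda>_. p z)) = (A \<inter> I) \<inter> set_pmf (Pi_pmf {..<M} 0 (\<lambda>_. p z))"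
      by blast
    then have "emeasure (measure_pmf (Pi_pmf {..<M} 0 (\<lambda>_. p z))) A = emeasure (measure_pmf (Pi_pmf {..<M} 0 (\<lambda>_. p z))) (A \<inter> I)"
      by (metis emeasure_Int_set_pmf)
    then show ?thesis using fin by (simp add: emeasure_measure_pmf_finite)
  qed
  moreover have "(\<lambda>z. pmf (Pi_pmf {..<M} 0 (\<lambda>_. p z)) w) \<in> borel_measurable \<Sigma>" for w
  proof (cases "\<forall>x. x \<notin> {..<M} \<longrightarrow> w x = 0")
    case True
    have "(\<lambda>z. pmf (Pi_pmf {..<M} 0 (\<lambda>_. p z)) w) = (\<lambda>z. \<Prod>m<M. pmf (p z) (w m))"
      unfolding pmf_Pi[OF finite_lessThan] if_P[OF True] ..
    then show ?thesis by (simp only:) (intro borel_measurable_prod meas)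
  next
    case False
    have "(\<lambda>z. pmf (Pi_pmf {..<M} 0 (\<lambda>_. p z)) w) = (\<lambda>_. 0)"
      unfolding pmf_Pi[OF finite_lessThan] if_not_P[OF False] ..
    then show ?thesis by simp
  qed
  ultimately show "(\<lambda>z. emeasure (measure_pmf (Pi_pmf {..<M} 0 (\<lambda>_. p z))) A) \<in> borel_measurable \<Sigma>"
    by simp
qed

text \<open>This reduces the sampling stage to estimates for each fixed grid.\<close>

lemma two_stage_law:
  fixes \<kappa> :: "'w \<Rightarrow> (nat \<Rightarrow> nat) measure"
  assumes \<kappa>: "\<kappa> \<in> measurable \<Sigma> (subprob_algebra (count_space UNIV))" and ne: "space \<Sigma> \<noteq> {}"
  defines "\<Lambda> \<equiv> \<Sigma> \<bind> (\<lambda>z. \<kappa> z \<bind> (\<lambda>\<iota>. return (\<Sigma> \<Otimes>\<^sub>M count_space UNIV) (z, \<iota>)))"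
  shows "sets \<Lambda> = sets (\<Sigma> \<Otimes>\<^sub>M count_space UNIV)"
    and "E \<in> sets (\<Sigma> \<Otimes>\<^sub>M count_space UNIV) \<Longrightarrow>
      emeasure \<Lambda> E = (\<integral>\<^sup>+z. emeasure (\<kappa> z) {\<iota>. (z, \<iota>) \<in> E} \<partial>\<Sigma>)"
proof -
  let ?N = "\<Sigma> \<Otimes>\<^sub>M count_space (UNIV :: (nat \<Rightarrow> nat) set)"
  have f: "(\<lambda>z. \<kappa> z \<bind> (\<lambda>\<iota>. return ?N (z, \<iota>))) \<in> measurable \<Sigma> (subprob_algebra ?N)"
  proof (rule measurable_bind[OF \<kappa>])
    show "(\<lambda>x. return ?N (fst x, snd x)) \<in> measurable ?N (subprob_algebra ?N)"
      by (simp add: return_measurable)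
  qed
  show "sets \<Lambda> = sets ?N"
    unfolding \<Lambda>_def by (intro sets_bind sets_kernel[OF f] ne)
  assume E: "E \<in> sets ?N"
  have "emeasure \<Lambda> E = (\<integral>\<^sup>+z. emeasure (\<kappa> z \<bind> (\<lambda>\<iota>. return ?N (z, \<iota>))) E \<partial>\<Sigma>)"
    unfolding \<Lambda>_def by (rule emeasure_bind[OF ne f E])
  also have "\<dots> = (\<integral>\<^sup>+z. emeasure (\<kappa> z) {\<iota>. (z, \<iota>) \<in> E} \<partial>\<Sigma>)"
  proof (rule nn_integral_cong)
    fix z assume z: "z \<in> space \<Sigma>"
    have s: "sets (\<kappa> z) = sets (count_space UNIV)" using sets_kernel[OF \<kappa> z] .
    have sp: "space (\<kappa> z) = UNIV" using sets_eq_imp_space_eq[OF s] by simp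
    have g: "(\<lambda>\<iota>. return ?N (z, \<iota>)) \<in> measurable (\<kappa> z) (subprob_algebra ?N)"
      using z by (simp add: measurable_cong_sets[OF s refl] space_subprob_algebra)
        (auto intro!: prob_space_imp_subprob_space prob_space_return simp: space_pair_measure)
    have "emeasure (\<kappa> z \<bind> (\<lambda>\<iota>. return ?N (z, \<iota>))) E = (\<integral>\<^sup>+\<iota>. emeasure (return ?N (z, \<iota>)) E \<partial>\<kappa> z)"
      by (rule emeasure_bind[OF _ g E]) (simp add: sp)
    also have "\<dots> = (\<integral>\<^sup>+\<iota>. indicator {\<iota>. (z, \<iota>) \<in> E} \<iota> \<partial>\<kappa> z)"
      using E by (intro nn_integral_cong) (simp split: split_indicator)
    also have "\<dots> = emeasure (\<kappa> z) {\<iota>. (z, \<iota>) \<in> E}"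
      by (intro nn_integral_indicator) (simp add: s)
    finally show "emeasure (\<kappa> z \<bind> (\<lambda>\<iota>. return ?N (z, \<iota>))) E = emeasure (\<kappa> z) {\<iota>. (z, \<iota>) \<in> E}" .
  qed
  finally show "emeasure \<Lambda> E = (\<integral>\<^sup>+z. emeasure (\<kappa> z) {\<iota>. (z, \<iota>) \<in> E} \<partial>\<Sigma>)" .
qed

section \<open>The random grid\<close>

definition L2_gram :: "'a measure \<Rightarrow> (nat \<Rightarrow> 'a \<Rightarrow> complex) \<Rightarrow> nat \<Rightarrow> nat \<Rightarrow> complex" where
  "L2_gram \<rho> \<psi> j k = (\<integral>x. cnj (\<psi> j x) * \<psi> k x \<partial>\<rho>)"

lemma square_integrable_product:
  assumes "square_integrable \<rho> f" "square_integrable \<rho> g"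
  shows "integrable \<rho> (\<lambda>x. cnj (f x) * g x)"
proof (rule Bochner_Integration.integrable_bound[OF square_integrable_cmod_mult[OF assms]])
  have "f \<in> borel_measurable \<rho>" "g \<in> borel_measurable \<rho>"
    using assms by (simp_all add: square_integrable_def)
  then show "(\<lambda>x. cnj (f x) * g x) \<in> borel_measurable \<rho>"
    by (intro borel_measurable_times measurable_compose[OF _ borel_measurable_cnj])
qed (simp add: norm_mult)

lemma L2_gram_hermitian: "hermitian_on N (L2_gram \<rho> \<psi>)"
  unfolding hermitian_on_def
proof (intro allI impI)
  fix j k
  have "cnj (L2_gram \<rho> \<psi> k j) = (\<integral>x. cnj (cnj (\<psi> k x) * \<psi> j x) \<partial>\<rho>)"
    unfolding L2_gram_def by (rule Bochner_Integration.integral_cnj[symmetric])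
  also have "\<dots> = L2_gram \<rho> \<psi> j k"
    unfolding L2_gram_def by (intro Bochner_Integration.integral_cong refl) simp
  finally show "L2_gram \<rho> \<psi> j k = cnj (L2_gram \<rho> \<psi> k j)" ..
qed

lemma cip_L2_gram:
  assumes si: "\<forall>j<N. square_integrable \<rho> (\<psi> j)"
  shows "cip N x (mapply N (L2_gram \<rho> \<psi>) y)
    = (\<integral>t. cnj (\<Sum>j<N. x j * \<psi> j t) * (\<Sum>k<N. y k * \<psi> k t) \<partial>\<rho>)"
proof -
  have int: "integrable \<rho> (\<lambda>t. cnj (x j) * y k * (cnj (\<psi> j t) * \<psi> k t))" if "j < N" "k < N" for j k
    using that si by (intro integrable_mult_right square_integrable_product) auto
  have "(\<integral>t. cnj (\<Sum>j<N. x j * \<psi> j t) * (\<Sum>k<N. y k * \<psi> k t) \<partial>\<rho>)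
      = (\<integral>t. (\<Sum>j<N. \<Sum>k<N. cnj (x j) * y k * (cnj (\<psi> j t) * \<psi> k t)) \<partial>\<rho>)"
    by (intro Bochner_Integration.integral_cong refl, simp only: cnj_sum complex_cnj_mult sum_product)
      (intro sum.cong refl, simp add: mult_ac)
  also have "\<dots> = (\<Sum>j<N. \<integral>t. (\<Sum>k<N. cnj (x j) * y k * (cnj (\<psi> j t) * \<psi> k t)) \<partial>\<rho>)"
    using int by (intro Bochner_Integration.integral_sum Bochner_Integration.integrable_sum) auto
  also have "\<dots> = (\<Sum>j<N. \<Sum>k<N. \<integral>t. cnj (x j) * y k * (cnj (\<psi> j t) * \<psi> k t) \<partial>\<rho>)"
    using int by (intro sum.cong refl Bochner_Integration.integral_sum) auto
  also have "\<dots> = cip N x (mapply N (L2_gram \<rho> \<psi>) y)"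
    by (simp add: cip_def mapply_def L2_gram_def sum_distrib_left mult_ac)
  finally show ?thesis ..
qed

lemma L2_norm_square:
  assumes si: "\<forall>j<N. square_integrable \<rho> (\<psi> j)"
  shows "cip N x (mapply N (L2_gram \<rho> \<psi>) x) = of_real ((L2_norm \<rho> (\<lambda>t. \<Sum>j<N. x j * \<psi> j t))\<^sup>2)"
proof -
  have "cip N x (mapply N (L2_gram \<rho> \<psi>) x) = (\<integral>t. of_real ((cmod (\<Sum>j<N. x j * \<psi> j t))\<^sup>2) \<partial>\<rho>)"
    unfolding cip_L2_gram[OF si]
    by (intro Bochner_Integration.integral_cong refl) (subst complex_norm_square, rule mult.commute)
  also have "\<dots> = of_real (\<integral>t. (cmod (\<Sum>j<N. x j * \<psi> j t))\<^sup>2 \<partial>\<rho>)"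
    by (rule integral_complex_of_real)
  finally show ?thesis by (simp add: L2_norm_def)
qed

text \<open>Gram--Schmidt in coefficient space. Linear independence up to null sets is positive
  definiteness of \<open>L2_gram\<close>. The basis serves the analysis only; the method works with
  grid values.\<close>

lemma L2_orthonormal_basis:
  assumes basis: "L2_basis \<rho> P N \<psi>"
  obtains t where
    "\<And>k l. k < N \<Longrightarrow> l < N \<Longrightarrow>
      (\<integral>x. cnj (\<Sum>j<N. t k j * \<psi> j x) * (\<Sum>j<N. t l j * \<psi> j x) \<partial>\<rho>) = (if k = l then 1 else 0)"
    "\<And>y. (L2_norm \<rho> (\<lambda>x. \<Sum>j<N. (\<Sum>k<N. t k j * y k) * \<psi> j x))\<^sup>2 = sqn N y"
    "\<And>d. \<exists>y. \<forall>j<N. d j = (\<Sum>k<N. t k j * y k)"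
proof
  have si: "\<forall>j<N. square_integrable \<rho> (\<psi> j)" using L2_basisD(2)[OF basis] by blast
  define G where "G = L2_gram \<rho> \<psi>"
  define t where "t = gram_orthonormal N G N"
  have herm: "hermitian_on N G" unfolding G_def by (rule L2_gram_hermitian)
  have pos: "0 < moment N G x 1" if "sqn N x \<noteq> 0" for x
  proof -
    have "moment N G x 1 = (L2_norm \<rho> (\<lambda>t. \<Sum>j<N. x j * \<psi> j t))\<^sup>2"
      using L2_norm_square[OF si, of x] by (simp add: moment_def G_def)
    moreover have "L2_norm \<rho> (\<lambda>t. \<Sum>j<N. x j * \<psi> j t) \<noteq> 0"
    proof
      assume "L2_norm \<rho> (\<lambda>t. \<Sum>j<N. x j * \<psi> j t) = 0"
      then have "(\<integral>t. (cmod (\<Sum>j<N. x j * \<psi> j t))\<^sup>2 \<partial>\<rho>) = 0"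
        by (simp add: L2_norm_def)
      moreover have "integrable \<rho> (\<lambda>t. (cmod (\<Sum>j<N. x j * \<psi> j t))\<^sup>2)"
        using square_integrable_sum[of N \<rho> \<psi>] si by (simp add: square_integrable_def)
      ultimately have "AE t in \<rho>. (cmod (\<Sum>j<N. x j * \<psi> j t))\<^sup>2 = 0"
        by (subst (asm) integral_nonneg_eq_0_iff_AE) auto
      then have "AE t in \<rho>. (\<Sum>j<N. x j * \<psi> j t) = 0" by simp
      from L2_basisD(3)[OF basis this] have "sqn N x = 0" unfolding sqn_eq_0_iff .
      with that show False ..
    qed
    ultimately show ?thesis by simp
  qed
  have orth: "cip N (t k) (mapply N G (t l)) = (if k = l then 1 else 0)" if "k < N" "l < N" for k l
    unfolding t_def by (rule gram_orthonormal[OF herm pos that])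
  show "(\<integral>x. cnj (\<Sum>j<N. t k j * \<psi> j x) * (\<Sum>j<N. t l j * \<psi> j x) \<partial>\<rho>) = (if k = l then 1 else 0)"
    if "k < N" "l < N" for k l
    using orth[OF that] unfolding G_def cip_L2_gram[OF si] .
  show "(L2_norm \<rho> (\<lambda>x. \<Sum>j<N. (\<Sum>k<N. t k j * y k) * \<psi> j x))\<^sup>2 = sqn N y" for y
  proof -
    have "complex_of_real ((L2_norm \<rho> (\<lambda>x. \<Sum>j<N. (\<Sum>k<N. t k j * y k) * \<psi> j x))\<^sup>2) = of_real (sqn N y)"
      unfolding L2_norm_square[OF si, symmetric] G_def[symmetric]
      by (rule gram_basis_norm[of N t G, OF orth]) simp_all
    then show ?thesis by (simp only: of_real_eq_iff)
  qed
  show "\<exists>y. \<forall>j<N. d j = (\<Sum>k<N. t k j * y k)" for d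
  proof (intro exI allI impI)
    fix j assume "j < N"
    then show "d j = (\<Sum>k<N. t k j * cip N (t k) (mapply N G d))"
      by (intro gram_basis_expand[of N t G j d] orth) auto
  qed
qed

lemma nikolskii_pointwise:
  assumes p: "p \<in> P" and fin: "nikolskii_const \<rho> P \<noteq> \<infinity>" and x: "x \<in> space \<rho>"
  shows "cmod (p x) \<le> enn2real (nikolskii_const \<rho> P) * L2_norm \<rho> p"
proof -
  define C where "C = enn2real (nikolskii_const \<rho> P)"
  have C: "nikolskii_const \<rho> P = ennreal C"
    using fin by (simp add: C_def less_top)
  have nn: "0 \<le> L2_norm \<rho> p" by (simp add: L2_norm_def)
  have "ennreal (cmod (p x)) \<le> sup_norm (space \<rho>) p"
    unfolding sup_norm_def using x by (rule SUP_upper)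
  also have "\<dots> \<le> nikolskii_const \<rho> P * ennreal (L2_norm \<rho> p)"
    by (rule nikolskii_const_bound[OF p fin])
  also have "\<dots> = ennreal (C * L2_norm \<rho> p)"
    using nn by (simp add: C ennreal_mult'')
  finally show ?thesis
    using nn by (simp add: C_def)
qed

lemma grid_frame_bound:
  assumes rho: "prob_space \<rho>" and basis: "L2_basis \<rho> P N \<psi>" and N: "0 < N" and K: "0 < K"
    and fin: "nikolskii_const \<rho> P \<noteq> \<infinity>" and \<delta>: "0 < \<delta>" "\<delta> < 1"
  defines "L \<equiv> (enn2real (nikolskii_const \<rho> P))\<^sup>2"
  obtains Z where "Z \<in> sets (PiM {..<K} (\<lambda>_. \<rho>))" "0 < L"
    "emeasure (PiM {..<K} (\<lambda>_. \<rho>)) (space (PiM {..<K} (\<lambda>_. \<rho>)) - Z)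
      \<le> ennreal (real N * exp (- (real K / L * ((1 - \<delta>) * ln (1 - \<delta>) + \<delta>))))"
    "\<And>z d. z \<in> Z \<Longrightarrow> (1 - \<delta>) * (L2_norm \<rho> (\<lambda>x. \<Sum>j<N. d j * \<psi> j x))\<^sup>2
        \<le> (\<Sum>i<K. (cmod (\<Sum>j<N. grid_mat K N \<psi> z $$ (i, j) * d j))\<^sup>2)"
proof -
  interpret prob_space \<rho> by (rule rho)
  define C where "C = enn2real (nikolskii_const \<rho> P)"
  have L: "L = C\<^sup>2" by (simp add: L_def C_def)
  have C0: "0 \<le> C" by (simp add: C_def)
  note si = L2_basisD(2)[OF basis]
  obtain t where orth: "\<And>k l. k < N \<Longrightarrow> l < N \<Longrightarrow>
      (\<integral>x. cnj (\<Sum>j<N. t k j * \<psi> j x) * (\<Sum>j<N. t l j * \<psi> j x) \<partial>\<rho>) = (if k = l then 1 else 0)"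
    and norm: "\<And>y. (L2_norm \<rho> (\<lambda>x. \<Sum>j<N. (\<Sum>k<N. t k j * y k) * \<psi> j x))\<^sup>2 = sqn N y"
    and expand: "\<And>d. \<exists>y. \<forall>j<N. d j = (\<Sum>k<N. t k j * y k)"
    by (rule L2_orthonormal_basis[OF basis]) (rule that)
  define \<phi> where "\<phi> k x = (\<Sum>j<N. t k j * \<psi> j x)" for k x
  have comb: "(\<Sum>j<N. (\<Sum>k<N. t k j * y k) * \<psi> j x) = (\<Sum>k<N. \<phi> k x * y k)" for x y
    using sum_mult_assoc[of "\<lambda>j. \<psi> j x" "\<lambda>j k. t k j" y "{..<N}" "{..<N}"]
    by (simp add: \<phi>_def mult.commute)
  have \<phi>_le: "sqn N (\<lambda>k. cnj (\<phi> k x)) \<le> C\<^sup>2" if x: "x \<in> space \<rho>" for x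
  proof -
    define s where "s = sqn N (\<lambda>k. cnj (\<phi> k x))"
    \<comment> \<open>The reproducing kernel of \<open>P\<close> at \<open>x\<close>: its value at
      \<open>x\<close> is \<open>s\<close> and its norm is \<open>sqrt s\<close>, so the Nikolskii
      bound reads \<open>s \<le> C * sqrt s\<close>.\<close>
    define p where "p = (\<lambda>u. \<Sum>j<N. (\<Sum>k<N. t k j * cnj (\<phi> k x)) * \<psi> j u)"
    have s: "0 \<le> s" by (simp add: s_def sqn_nonneg)
    have "p \<in> P" unfolding L2_basisD(1)[OF basis] p_def by (intro CollectI exI) (rule refl)
    have "p x = (\<Sum>k<N. \<phi> k x * cnj (\<phi> k x))" unfolding p_def by (rule comb)
    also have "\<dots> = of_real s"
      unfolding s_def sqn_def complex_mod_cnj of_real_sum complex_norm_square ..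
    finally have "cmod (p x) = s" using s by simp
    moreover have "L2_norm \<rho> p = sqrt s"
    proof (rule real_sqrt_unique[symmetric])
      show "(L2_norm \<rho> p)\<^sup>2 = s" unfolding p_def s_def by (rule norm)
    qed (simp add: L2_norm_def)
    ultimately have "s \<le> C * sqrt s"
      using nikolskii_pointwise[OF \<open>p \<in> P\<close> fin x] by (simp add: C_def)
    then have "sqrt s * sqrt s \<le> C * sqrt s" using s by simp
    then have "sqrt s \<le> C"
      using s C0 mult_right_le_imp_le[of "sqrt s" "sqrt s" C] by (cases "s = 0") auto
    then have "(sqrt s)\<^sup>2 \<le> C\<^sup>2" using s by (intro power_mono) simp_all
    then show ?thesis using s by (simp add: s_def)
  qed
  \<comment> \<open>Otherwise \<open>\<phi> 0\<close> would vanish on the whole space, although its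
    norm is \<open>1\<close>.\<close>
  have C: "0 < C"
  proof (rule ccontr)
    assume "\<not> 0 < C"
    then have "C = 0" using C0 by simp
    have "\<phi> 0 x = 0" if "x \<in> space \<rho>" for x
    proof -
      have "sqn N (\<lambda>k. cnj (\<phi> k x)) = 0"
        using \<phi>_le[OF that] sqn_nonneg[of N "\<lambda>k. cnj (\<phi> k x)"] \<open>C = 0\<close> by simp
      then have "cnj (\<phi> 0 x) = 0" using N unfolding sqn_eq_0_iff by blast
      then show ?thesis by simp
    qed
    then have "(\<integral>x. cnj (\<phi> 0 x) * \<phi> 0 x \<partial>\<rho>) = (\<integral>x. 0 \<partial>\<rho>)"
      by (intro Bochner_Integration.integral_cong refl) simp
    then show False using orth[OF N N] by (simp add: \<phi>_def)
  qed
  then have L0: "0 < L" by (simp add: L)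
  \<comment> \<open>Division by \<open>C\<close> brings the length down to at most \<open>1\<close>
    and turns the second moment into \<open>1 / L\<close>. The conjugate again offsets the one in
    \<open>cip\<close>.\<close>
  define a where "a x k = cnj (\<phi> k x) / of_real C" for x k
  have \<phi>_meas: "\<phi> k \<in> borel_measurable \<rho>" for k
    using square_integrable_sum[of N \<rho> \<psi> "t k", OF si] by (simp add: \<phi>_def[abs_def] square_integrable_def)
  have a_le: "sqn N (a x) \<le> 1" if "x \<in> space \<rho>" for x
  proof -
    have "sqn N (a x) = sqn N (\<lambda>k. cnj (\<phi> k x)) / C\<^sup>2"
      by (simp add: sqn_def a_def norm_divide power_divide sum_divide_distrib)
    then show ?thesis using \<phi>_le[OF that] C by simp
  qed
  have a_meas: "(\<lambda>x. a x k) \<in> borel_measurable \<rho>" for k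
    unfolding a_def
    by (intro borel_measurable_divide measurable_compose[OF \<phi>_meas borel_measurable_cnj] borel_measurable_const)
  have iso: "isotropic_vector \<rho> N a 1 (1 / L)"
  proof
    show "sqn N (a x) \<le> 1" if "x \<in> space \<rho>" for x by (rule a_le[OF that])
    show "(\<lambda>x. a x i) \<in> borel_measurable \<rho>" if "i < N" for i by (rule a_meas)
    show "(\<integral>x. cnj (a x i) * a x k \<partial>\<rho>) = (if i = k then of_real (1 / L) else 0)" if "i < N" "k < N" for i k
    proof -
      have "(\<integral>x. cnj (a x i) * a x k \<partial>\<rho>) = (\<integral>x. cnj (\<phi> k x) * \<phi> i x / of_real L \<partial>\<rho>)"
        by (intro Bochner_Integration.integral_cong refl) (simp add: a_def L power2_eq_square)
      also have "\<dots> = (\<integral>x. cnj (\<phi> k x) * \<phi> i x \<partial>\<rho>) / of_real L"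
        by simp
      finally show ?thesis using orth[OF that(2,1)] by (simp add: \<phi>_def)
    qed
  qed
  define Z where "Z = {z \<in> space (PiM {..<K} (\<lambda>_. \<rho>)). lower_event N K L \<delta> (\<lambda>m. a (z m))}"
  show ?thesis
  proof
    have "Measurable.pred (PiM {..<K} (\<lambda>_. \<rho>)) (\<lambda>z. lower_event N K L \<delta> (\<lambda>m. a (z m)))"
      by (intro measurable_lower_event measurable_compose[OF _ a_meas] measurable_component_singleton) simp
    then show "Z \<in> sets (PiM {..<K} (\<lambda>_. \<rho>))" unfolding Z_def by measurable
    show "0 < L" by (rule L0)
    have "space (PiM {..<K} (\<lambda>_. \<rho>)) - Z
        = {z \<in> space (PiM {..<K} (\<lambda>_. \<rho>)). \<not> lower_event N K L \<delta> (\<lambda>m. a (z m))}"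
      by (auto simp: Z_def)
    then show "emeasure (PiM {..<K} (\<lambda>_. \<rho>)) (space (PiM {..<K} (\<lambda>_. \<rho>)) - Z)
      \<le> ennreal (real N * exp (- (real K / L * ((1 - \<delta>) * ln (1 - \<delta>) + \<delta>))))"
      using PiM_not_lower_event[OF iso N \<delta>] by simp
    fix z d assume z: "z \<in> Z"
    from expand[of d] obtain y where y: "\<forall>j<N. d j = (\<Sum>k<N. t k j * y k)" ..
    have dy: "(\<Sum>j<N. d j * \<psi> j x) = (\<Sum>k<N. \<phi> k x * y k)" for x
      unfolding comb[symmetric] by (intro sum.cong refl) (simp only: y[rule_format] lessThan_iff)
    have "(\<lambda>x. \<Sum>j<N. d j * \<psi> j x) = (\<lambda>x. \<Sum>j<N. (\<Sum>k<N. t k j * y k) * \<psi> j x)"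
      unfolding dy comb ..
    then have Ld: "(L2_norm \<rho> (\<lambda>x. \<Sum>j<N. d j * \<psi> j x))\<^sup>2 = sqn N y" by (simp only: norm)
    have zs: "sqn N (a (z m)) \<le> 1" if "m < K" for m
      using z that by (intro a_le) (auto simp: Z_def space_PiM PiE_iff)
    have "real K / L * (1 - \<delta>) * sqn N y \<le> frame_sum N K (\<lambda>m. a (z m)) y"
      by (rule lower_event_bound[OF _ \<delta> zs]) (use z in \<open>auto simp: Z_def\<close>)
    also have "\<dots> = (\<Sum>i<K. (cmod (\<Sum>j<N. d j * \<psi> j (z i)))\<^sup>2 / L)"
      unfolding frame_sum_def
    proof (intro sum.cong refl)
      fix i
      have "cip N (a (z i)) y = (\<Sum>k<N. \<phi> k (z i) * y k) / of_real C"
        by (simp add: cip_def a_def sum_divide_distrib)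
      then show "(cmod (cip N (a (z i)) y))\<^sup>2 = (cmod (\<Sum>j<N. d j * \<psi> j (z i)))\<^sup>2 / L"
        by (simp add: dy norm_divide power_divide L)
    qed
    finally have "real K / L * (1 - \<delta>) * sqn N y \<le> (\<Sum>i<K. (cmod (\<Sum>j<N. d j * \<psi> j (z i)))\<^sup>2) / L"
      by (simp add: sum_divide_distrib)
    then have "(1 - \<delta>) * sqn N y \<le> (\<Sum>i<K. (cmod (\<Sum>j<N. d j * \<psi> j (z i)))\<^sup>2) / real K"
      using mult_right_mono[OF \<open>_ \<le> _ / L\<close>, of "L / real K"] L0 K by simp
    also have "\<dots> = (\<Sum>i<K. (cmod (\<Sum>j<N. grid_mat K N \<psi> z $$ (i, j) * d j))\<^sup>2)"
      unfolding sum_divide_distrib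
    proof (intro sum.cong refl)
      fix i assume "i \<in> {..<K}"
      then have "(\<Sum>j<N. grid_mat K N \<psi> z $$ (i, j) * d j) = (\<Sum>j<N. d j * \<psi> j (z i)) / of_real (sqrt (real K))"
        by (simp add: grid_mat_def sum_divide_distrib mult.commute)
      then show "(cmod (\<Sum>j<N. d j * \<psi> j (z i)))\<^sup>2 / real K = (cmod (\<Sum>j<N. grid_mat K N \<psi> z $$ (i, j) * d j))\<^sup>2"
        by (simp add: norm_divide power_divide)
    qed
    finally show "(1 - \<delta>) * (L2_norm \<rho> (\<lambda>x. \<Sum>j<N. d j * \<psi> j x))\<^sup>2
        \<le> (\<Sum>i<K. (cmod (\<Sum>j<N. grid_mat K N \<psi> z $$ (i, j) * d j))\<^sup>2)"
      unfolding Ld .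
  qed
qed

text \<open>Rows beyond \<open>K\<close> vanish, so that \<open>grid_fun\<close> is measurable in \<open>z\<close> for every index, including those
  for which the extensional function \<open>z\<close> is undefined.\<close>

definition grid_fun :: "nat \<Rightarrow> (nat \<Rightarrow> 'a \<Rightarrow> complex) \<Rightarrow> (nat \<Rightarrow> 'a) \<Rightarrow> nat \<Rightarrow> nat \<Rightarrow> complex" where
  "grid_fun K \<psi> z i j = (if i < K then \<psi> j (z i) / of_real (sqrt (real K)) else 0)"

lemma grid_mat_eq_grid_fun: "i < K \<Longrightarrow> j < N \<Longrightarrow> grid_mat K N \<psi> z $$ (i, j) = grid_fun K \<psi> z i j"
  by (simp add: grid_mat_def grid_fun_def)

section \<open>Full rank and sampling law through the measurable factor\<close>

lemma injective_on_cong: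
  assumes "\<And>i j. i < K \<Longrightarrow> j < N \<Longrightarrow> b i j = b' i j"
  shows "injective_on K N b \<longleftrightarrow> injective_on K N b'"
proof -
  have "(\<forall>i<K. (\<Sum>j<N. b i j * x j) = 0) \<longleftrightarrow> (\<forall>i<K. (\<Sum>j<N. b' i j * x j) = 0)" for x
    using assms by (intro all_cong arg_cong2[where f = "(=)"] sum.cong refl) auto
  then show ?thesis unfolding injective_on_def by (simp only:)
qed

lemma full_col_rank_grid_mat:
  "full_col_rank (grid_mat K N \<psi> z) \<longleftrightarrow> injective_on K N (grid_fun K \<psi> z)"
  "vec_space.rank K (grid_mat K N \<psi> z) = N \<longleftrightarrow> injective_on K N (grid_fun K \<psi> z)"
proof -
  have B: "grid_mat K N \<psi> z \<in> carrier_mat K N" by (simp add: grid_mat_def)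
  show *: "vec_space.rank K (grid_mat K N \<psi> z) = N \<longleftrightarrow> injective_on K N (grid_fun K \<psi> z)"
    unfolding rank_eq_iff_injective_on[OF B] by (rule injective_on_cong) (rule grid_mat_eq_grid_fun)
  show "full_col_rank (grid_mat K N \<psi> z) \<longleftrightarrow> injective_on K N (grid_fun K \<psi> z)"
    unfolding full_col_rank_def using * B by (simp add: grid_mat_def)
qed

lemma qr_unitary_change:
  assumes qr: "reduced_qr B Q R" and B: "B \<in> carrier_mat K N"
    and b: "\<And>i j. i < K \<Longrightarrow> j < N \<Longrightarrow> B $$ (i, j) = b i j" and inj: "injective_on K N b"
  shows "i < K \<Longrightarrow> leverage N (\<lambda>i k. Q $$ (i, k)) i = leverage N (gs_factor K N b) i"
    and "\<exists>y. sqn N y = sqn N x \<and>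
      (\<forall>i<K. (\<Sum>k<N. Q $$ (i, k) * x k) = (\<Sum>l<N. gs_factor K N b i l * y l))"
proof -
  note Q = reduced_qr_entries(3)[OF qr B] and BQR = reduced_qr_entries(6)[OF qr B]
  define q where "q = (\<lambda>i k. Q $$ (i, k))"
  define q0 where "q0 = gs_factor K N b"
  \<comment> \<open>With \<open>T\<close> the matrix of Gram--Schmidt coefficients, the measurable
    factor \<open>B T\<close> equals \<open>Q (R T)\<close>, so \<open>u\<close> is
    \<open>R T\<close>.\<close>
  define u where "u k l = (\<Sum>j<N. R $$ (k, j) * gram_orthonormal N (column_gram K b) N l j)" for k l
  have q: "(\<Sum>i<K. cnj (q i k) * q i l) = (if k = l then 1 else 0)" if "k < N" "l < N" for k l
    unfolding q_def by (rule Q[OF that])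
  have q0: "(\<Sum>i<K. cnj (q0 i k) * q0 i l) = (if k = l then 1 else 0)" if "k < N" "l < N" for k l
    unfolding q0_def by (rule gs_factor_orthonormal[OF inj that])
  have factor: "q0 i l = (\<Sum>k<N. q i k * u k l)" if "i < K" for i l
    unfolding q0_def gs_factor_def q_def u_def BQR[OF that, symmetric]
    using that by (intro sum.cong refl) (simp add: b)
  have uu: "(\<Sum>l<N. u k l * cnj (u m l)) = (if k = m then 1 else 0)" if "k < N" "m < N" for k m
    by (rule orthonormal_factor_unitary[where q = q and q0 = q0 and K = K, OF q q0 factor that])
  show "i < K \<Longrightarrow> leverage N (\<lambda>i k. Q $$ (i, k)) i = leverage N (gs_factor K N b) i"
    using leverage_unitary[of N u q0 i q, OF uu factor] unfolding q_def q0_def by simp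
  obtain y where y: "sqn N y = sqn N x" "\<And>k. k < N \<Longrightarrow> (\<Sum>l<N. u k l * y l) = x k"
    by (rule unitary_change[of N u x, OF uu]) (assumption, assumption, rule that)
  have "(\<Sum>k<N. Q $$ (i, k) * x k) = (\<Sum>l<N. q0 i l * y l)" if "i < K" for i
  proof -
    have "(\<Sum>k<N. Q $$ (i, k) * x k) = (\<Sum>k<N. q i k * (\<Sum>l<N. u k l * y l))"
      by (intro sum.cong refl) (simp add: y(2) q_def)
    also have "\<dots> = (\<Sum>l<N. q0 i l * y l)"
      unfolding sum_mult_assoc by (intro sum.cong refl) (simp add: factor[OF that])
    finally show ?thesis .
  qed
  then show "\<exists>y. sqn N y = sqn N x \<and>
      (\<forall>i<K. (\<Sum>k<N. Q $$ (i, k) * x k) = (\<Sum>l<N. gs_factor K N b i l * y l))"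
    using y(1) unfolding q0_def by blast
qed

text \<open>The law of the indices depends on \<open>qr\<close> only through leverages, and these
  agree for all orthonormal factors. The resulting formula shows the law to be measurable in the
  grid.\<close>

lemma pmf_sampling:
  assumes N: "0 < N" "N \<le> K"
    and qr: "\<And>B. B \<in> carrier_mat K N \<Longrightarrow> vec_space.rank K B = N \<Longrightarrow> reduced_qr B (fst (qr B)) (snd (qr B))"
  shows "pmf (sampling_pmf qr (grid_mat K N \<psi> z)) i =
    (if i < K then
      if injective_on K N (grid_fun K \<psi> z) then leverage N (gs_factor K N (grid_fun K \<psi> z)) i / real N
      else 1 / real K
    else 0)"
proof (cases "injective_on K N (grid_fun K \<psi> z)")
  case True
  define B where "B = grid_mat K N \<psi> z"
  define q where "q = gs_factor K N (grid_fun K \<psi> z)"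
  have B: "B \<in> carrier_mat K N" by (simp add: B_def grid_mat_def)
  have "vec_space.rank K B = N" using True by (simp add: B_def full_col_rank_grid_mat)
  from qr[OF B this] have red: "reduced_qr B (fst (qr B)) (snd (qr B))" .
  have Q: "fst (qr B) \<in> carrier_mat K N" by (rule reduced_qr_entries(1)[OF red B])
  have prob: "sampling_prob (fst (qr B)) i = leverage N q i / real N" if "i < K" for i
    unfolding sampling_prob_eq_leverage[OF Q] q_def
    by (subst qr_unitary_change(1)[OF red B _ True that]) (simp_all add: B_def grid_mat_eq_grid_fun)
  define g where "g i = (if i < K then leverage N q i / real N else 0)" for i
  have g: "0 \<le> g i" for i by (simp add: g_def leverage_def sum_nonneg)
  \<comment> \<open>Total mass \<open>1\<close> is the condition under which
    \<open>embed_pmf\<close> has the prescribed point masses.\<close>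
  have "(\<Sum>i<K. leverage N q i) = real N"
    unfolding q_def by (rule sum_leverage) (rule gs_factor_orthonormal[OF True])
  then have "(\<Sum>i<K. g i) = 1" using N by (simp add: g_def flip: sum_divide_distrib)
  moreover have "(\<integral>\<^sup>+i. ennreal (g i) \<partial>count_space UNIV) = (\<Sum>i<K. ennreal (g i))"
    by (intro nn_integral_count_space') (auto simp: g_def)
  ultimately have "(\<integral>\<^sup>+i. ennreal (g i) \<partial>count_space UNIV) = 1"
    using g by (simp add: sum_ennreal)
  then have "pmf (embed_pmf g) i = g i" for i using g by (intro pmf_embed_pmf) auto
  moreover have "sampling_pmf qr B = embed_pmf g"
    unfolding sampling_pmf_def using True B
    by (auto simp: B_def[symmetric] full_col_rank_grid_mat[of K N \<psi> z, folded B_def] prob g_def[abs_def] cong: if_cong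
        intro!: arg_cong[where f = embed_pmf])
  ultimately show ?thesis using True by (simp add: g_def q_def B_def)
next
  case False
  have "{..<K} \<noteq> {}" using N by (auto simp: lessThan_empty_iff)
  moreover have "dim_row (grid_mat K N \<psi> z) = K" by (simp add: grid_mat_def)
  ultimately show ?thesis
    using False by (simp add: sampling_pmf_def full_col_rank_grid_mat)
qed

section \<open>The sampled matrix\<close>

lemma exp_tail_le:
  assumes "0 < N" "0 < \<gamma>" "0 < c" "ln (c * real N / \<gamma>) \<le> r"
  shows "real N * exp (- r) \<le> \<gamma> / c"
proof -
  have "exp (- r) \<le> exp (- ln (c * real N / \<gamma>))" using assms(4) by simp
  also have "\<dots> = \<gamma> / (c * real N)" using assms by (simp add: exp_minus)
  finally have "real N * exp (- r) \<le> real N * (\<gamma> / (c * real N))"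
    by (intro mult_left_mono) simp_all
  then show ?thesis using assms by simp
qed

text \<open>The value is \<open>0\<close> if the leverage vanishes; such an index is never drawn.\<close>

definition sampling_rows :: "nat \<Rightarrow> (nat \<Rightarrow> nat \<Rightarrow> complex) \<Rightarrow> nat \<Rightarrow> nat \<Rightarrow> complex" where
  "sampling_rows N q s k = cnj (q s k) / of_real (sqrt (leverage N q s))"

text \<open>The factor \<open>q\<close> is a parameter, so that a measurable one can be inserted.
  The first clause excludes indices of weight \<open>0\<close>, at which \<open>A\<close> and
  \<open>b\<close> would involve a division by \<open>0\<close>.\<close>

definition good_sample :: "nat \<Rightarrow> nat \<Rightarrow> nat \<Rightarrow> real \<Rightarrow> (nat \<Rightarrow> nat \<Rightarrow> complex) \<Rightarrow> (nat \<Rightarrow> nat) \<Rightarrow> bool" where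
  "good_sample K N M \<delta> q \<iota> \<longleftrightarrow>
     (\<forall>m<M. \<iota> m < K \<and> 0 < leverage N q (\<iota> m)) \<and>
     upper_event N M (real N) \<delta> (\<lambda>m. sampling_rows N q (\<iota> m)) \<and>
     lower_event N M (real N) \<delta> (\<lambda>m. sampling_rows N q (\<iota> m))"

lemma prob_good_sample:
  fixes q :: "nat \<Rightarrow> nat \<Rightarrow> complex" and M :: nat
  assumes N: "0 < N" and \<gamma>: "0 < \<gamma>" and \<delta>: "0 < \<delta>" "\<delta> < 1"
    and orth: "\<And>k l. k < N \<Longrightarrow> l < N \<Longrightarrow> (\<Sum>i<K. cnj (q i k) * q i l) = (if k = l then 1 else 0)"
    and p: "\<And>i. pmf p i = (if i < K then leverage N q i / real N else 0)"
    and M: "real M \<ge> real N * ln (4 * real N / \<gamma>) * inverse ((1 + \<delta>) * ln (1 + \<delta>) - \<delta>)"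
  shows "1 - \<gamma> / 2 \<le> measure (measure_pmf (Pi_pmf {..<M} 0 (\<lambda>_. p))) {\<iota>. good_sample K N M \<delta> q \<iota>}"
proof -
  define P where "P = Pi_pmf {..<M} (0::nat) (\<lambda>_. p)"
  define U where "U = {\<iota>. \<not> upper_event N M (real N) \<delta> (\<lambda>m. sampling_rows N q (\<iota> m))}"
  define W where "W = {\<iota>. \<not> lower_event N M (real N) \<delta> (\<lambda>m. sampling_rows N q (\<iota> m))}"
  have N': "0 < real N" using N by simp
  have iso: "isotropic_vector (measure_pmf p) N (sampling_rows N q) 1 (1 / real N)"
    unfolding sampling_rows_def[abs_def] by (rule isotropic_sampling[OF N orth p])
  have h: "0 < (1 + \<delta>) * ln (1 + \<delta>) - \<delta>" by (rule rate_plus_pos[OF \<delta>(1)])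
  have r1: "ln (4 * real N / \<gamma>) \<le> real M / real N * ((1 + \<delta>) * ln (1 + \<delta>) - \<delta>)"
  proof -
    have "real N * ln (4 * real N / \<gamma>) \<le> real M * ((1 + \<delta>) * ln (1 + \<delta>) - \<delta>)"
      using M h by (simp add: divide_inverse[symmetric] pos_divide_le_eq)
    then show ?thesis using N' by (simp add: pos_le_divide_eq mult.commute)
  qed
  also have "\<dots> \<le> real M / real N * ((1 - \<delta>) * ln (1 - \<delta>) + \<delta>)"
    using \<delta> by (intro mult_left_mono rate_plus_le_rate_minus) auto
  finally have r2: "ln (4 * real N / \<gamma>) \<le> real M / real N * ((1 - \<delta>) * ln (1 - \<delta>) + \<delta>)" .
  have "emeasure (measure_pmf P) U \<le> ennreal (\<gamma> / 4)"
    unfolding P_def U_def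
    by (rule order_trans[OF Pi_pmf_not_upper_event[OF iso N N' \<delta>(1)] ennreal_leI])
      (rule exp_tail_le[OF N \<gamma> _ r1], simp)
  then have U: "measure (measure_pmf P) U \<le> \<gamma> / 4"
    using \<gamma> by (simp add: measure_pmf.emeasure_eq_measure)
  have "emeasure (measure_pmf P) W \<le> ennreal (\<gamma> / 4)"
    unfolding P_def W_def
    by (rule order_trans[OF Pi_pmf_not_lower_event[OF iso N \<delta>] ennreal_leI])
      (rule exp_tail_le[OF N \<gamma> _ r2], simp)
  then have W: "measure (measure_pmf P) W \<le> \<gamma> / 4"
    using \<gamma> by (simp add: measure_pmf.emeasure_eq_measure)
  define G where "G = {\<iota>. good_sample K N M \<delta> q \<iota>}"
  have supp: "\<iota> m < K \<and> 0 < leverage N q (\<iota> m)" if "\<iota> \<in> set_pmf P" "m < M" for \<iota> m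
  proof -
    have "\<iota> m \<in> set_pmf p"
      using that unfolding P_def by (subst (asm) set_Pi_pmf) (auto simp: PiE_dflt_def)
    then have "pmf p (\<iota> m) \<noteq> 0" by (simp add: set_pmf_iff)
    moreover have "0 \<le> leverage N q (\<iota> m)" by (simp add: leverage_def sum_nonneg)
    ultimately show ?thesis by (auto simp: p split: if_splits)
  qed
  \<comment> \<open>On the support of the draws the first clause of \<open>good_sample\<close> is
    automatic, so only the two tails remain.\<close>
  have "measure (measure_pmf P) (- G) = measure (measure_pmf P) (- G \<inter> set_pmf P)"
    by (simp add: measure_Int_set_pmf)
  also have "\<dots> \<le> measure (measure_pmf P) (U \<union> W)"
    using supp by (intro measure_pmf.finite_measure_mono) (auto simp: G_def U_def W_def good_sample_def)
  also have "\<dots> \<le> measure (measure_pmf P) U + measure (measure_pmf P) W"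
    by (intro measure_Un_le) auto
  also have "\<dots> \<le> \<gamma> / 2" using U W by simp
  finally have "measure (measure_pmf P) (- G) \<le> \<gamma> / 2" .
  then show ?thesis
    using measure_pmf.prob_compl[of G P] by (simp add: P_def[symmetric] G_def[symmetric] Compl_eq_Diff_UNIV)
qed

text \<open>The row index is random but takes countably many values, so measurability for each fixed
  row suffices.\<close>

lemma measurable_good_sample:
  assumes q: "\<And>i k. k < N \<Longrightarrow> (\<lambda>z. q z i k) \<in> borel_measurable \<Sigma>"
  shows "Measurable.pred (\<Sigma> \<Otimes>\<^sub>M count_space UNIV) (\<lambda>x. good_sample K N M \<delta> (q (fst x)) (snd x))"
proof -
  let ?X = "\<Sigma> \<Otimes>\<^sub>M count_space (UNIV :: (nat \<Rightarrow> nat) set)"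
  have index: "(\<lambda>x. snd x m) \<in> measurable ?X (count_space UNIV)" for m
    by (rule measurable_compose[OF measurable_snd]) simp
  have lev: "(\<lambda>z. leverage N (q z) i) \<in> borel_measurable \<Sigma>" for i
    unfolding leverage_def
    by (intro borel_measurable_sum borel_measurable_power measurable_compose[OF _ borel_measurable_norm] q) simp
  have lev': "(\<lambda>x. leverage N (q (fst x)) (snd x m)) \<in> borel_measurable ?X" for m
    by (rule measurable_compose_countable[OF _ index]) (rule measurable_compose[OF measurable_fst lev])
  have rows: "(\<lambda>z. sampling_rows N (q z) i k) \<in> borel_measurable \<Sigma>" if "k < N" for i k
    unfolding sampling_rows_def
    by (intro borel_measurable_divide measurable_compose[OF q[OF that] borel_measurable_cnj]
        measurable_compose[OF _ borel_measurable_of_real] measurable_compose[OF lev borel_measurable_sqrt])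
  have rows': "(\<lambda>x. sampling_rows N (q (fst x)) (snd x m) k) \<in> borel_measurable ?X" if "k < N" for m k
    by (rule measurable_compose_countable[OF _ index]) (rule measurable_compose[OF measurable_fst rows[OF that]])
  have index_less: "Measurable.pred ?X (\<lambda>x. snd x m < K)" for m
    by (rule measurable_compose[OF index]) simp
  have lev_pos: "Measurable.pred ?X (\<lambda>x. 0 < leverage N (q (fst x)) (snd x m))" for m
    by (intro borel_measurable_pred_less lev' borel_measurable_const)
  show ?thesis
    unfolding good_sample_def
    by (intro pred_intros_logic pred_intros_countable index_less lev_pos measurable_upper_event
        measurable_lower_event rows') auto
qed

section \<open>Combination of the grid stage and the sampling stage\<close>

theorem theorem2p1:
  fixes \<Omega> :: "(real ^ 'd) set"
    and \<rho> :: "(real ^ 'd) measure"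
    and P :: "(real ^ 'd \<Rightarrow> complex) set"
    and \<psi> :: "nat \<Rightarrow> real ^ 'd \<Rightarrow> complex"
    and N M K :: nat
    and qr :: "complex mat \<Rightarrow> complex mat \<times> complex mat"
    and \<gamma> \<delta> :: real
  assumes domain: "open \<Omega>" "connected \<Omega>" "\<Omega> \<noteq> {}"
    and rho: "prob_space \<rho>" "sets \<rho> = sets (restrict_space borel \<Omega>)"
    and basis: "1 \<le> N" "L2_basis \<rho> P N \<psi>"
    and sizes: "N \<le> M" "N \<le> K"
    and qr: "\<And>B. B \<in> carrier_mat K N \<Longrightarrow> vec_space.rank K B = N \<Longrightarrow>
               reduced_qr B (fst (qr B)) (snd (qr B))"
    and nonvanishing: "AE z in PiM {..<K} (\<lambda>_. \<rho>). \<forall>i<K. \<exists>p\<in>P. p (z i) \<noteq> 0"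
    and gamma: "0 < \<gamma>" "\<gamma> < 1"
    and delta: "0 < \<delta>" "\<delta> < 1"
    and M_bound: "real M \<ge> real N * ln (4 * real N / \<gamma>) * inverse ((1 + \<delta>) * ln (1 + \<delta>) - \<delta>)"
    and K_bound: "ennreal (real K) \<ge> (nikolskii_const \<rho> P)\<^sup>2 *
               ennreal (ln (2 * real N / \<gamma>) * inverse ((1 - \<delta>) * ln (1 - \<delta>) + \<delta>))"
  shows "\<exists>E \<in> sets (method_law \<rho> \<psi> N K M qr).
           measure (method_law \<rho> \<psi> N K M qr) E \<ge> 1 - \<gamma> \<and>
           (\<forall>(z, \<iota>) \<in> E.
              let B = grid_mat K N \<psi> z; Q = fst (qr B); R = snd (qr B); A = sampled_mat Q M \<iota> in
                vec_space.rank K B = N \<and>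
                condition_number A \<le> ereal (sqrt ((1 + \<delta>) / (1 - \<delta>))) \<and>
                (\<forall>f. bounded_measurable \<rho> f \<longrightarrow>
                   (\<exists>!g. g \<in> method_outputs \<psi> Q R M z \<iota> f) \<and>
                   (\<forall>g \<in> method_outputs \<psi> Q R M z \<iota> f.
                      L2_norm \<rho> (\<lambda>x. f x - g x) \<le>
                        (INF p\<in>P. L2_norm \<rho> (\<lambda>x. f x - p x) +
                           1 / (1 - \<delta>) *
                             (MAX i\<in>{..<K}. cmod (f (z i) - p (z i)) /
                                sqrt (real K * sampling_prob Q i))))))"
proof -
  interpret rho: prob_space \<rho> by (rule rho)
  define \<Sigma> where "\<Sigma> = PiM {..<K} (\<lambda>_. \<rho>)"
  interpret S: prob_space \<Sigma> unfolding \<Sigma>_def by (rule prob_space_PiM) (rule rho)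
  have N: "0 < N" and M: "0 < M" and K: "0 < K" using basis(1) sizes by auto
  have N': "0 < real N" using N by simp
  define rate where "rate = (1 - \<delta>) * ln (1 - \<delta>) + \<delta>"
  have rate: "0 < rate"
    using rate_plus_pos[OF delta(1)] rate_plus_le_rate_minus[of \<delta>] delta by (simp add: rate_def)
  define q where "q z = gs_factor K N (grid_fun K \<psi> z)" for z
  have ln2: "0 < ln (2 * real N / \<gamma>)"
    using basis(1) gamma by (intro ln_gt_zero) (simp add: pos_less_divide_eq)
  \<comment> \<open>An infinite constant would make the lower bound on \<open>K\<close> infinite,
    because its other factor is positive.\<close>
  have fin: "nikolskii_const \<rho> P \<noteq> \<infinity>"
  proof
    assume "nikolskii_const \<rho> P = \<infinity>"
    then have "(nikolskii_const \<rho> P)\<^sup>2 * ennreal (ln (2 * real N / \<gamma>) * inverse rate) = \<infinity>"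
      using ln2 rate by (simp add: ennreal_top_mult power2_eq_square)
    then show False using K_bound by (simp add: rate_def[symmetric] top_unique)
  qed
  define L where "L = (enn2real (nikolskii_const \<rho> P))\<^sup>2"
  obtain Z where Z: "Z \<in> sets \<Sigma>" and L0: "0 < L"
    and probZ: "emeasure \<Sigma> (space \<Sigma> - Z) \<le> ennreal (real N * exp (- (real K / L * rate)))"
    and frame: "\<And>z d. z \<in> Z \<Longrightarrow> (1 - \<delta>) * (L2_norm \<rho> (\<lambda>x. \<Sum>j<N. d j * \<psi> j x))\<^sup>2
        \<le> (\<Sum>i<K. (cmod (\<Sum>j<N. grid_mat K N \<psi> z $$ (i, j) * d j))\<^sup>2)"
    by (rule grid_frame_bound[OF rho(1) basis(2) N K fin delta, folded \<Sigma>_def L_def rate_def]) (rule that)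
  have tail: "ln (2 * real N / \<gamma>) \<le> real K / L * rate"
  proof -
    have "nikolskii_const \<rho> P = ennreal (enn2real (nikolskii_const \<rho> P))"
      using fin by (simp add: less_top)
    then have "(nikolskii_const \<rho> P)\<^sup>2 = ennreal L"
      unfolding L_def by (metis ennreal_power enn2real_nonneg)
    then have "ennreal (L * (ln (2 * real N / \<gamma>) * inverse rate)) \<le> ennreal (real K)"
      using K_bound L0 by (simp add: rate_def ennreal_mult')
    then have "L * (ln (2 * real N / \<gamma>) * inverse rate) \<le> real K" by simp
    then show ?thesis using L0 rate by (simp add: field_simps)
  qed
  have "real N * exp (- (real K / L * rate)) \<le> \<gamma> / 2"
    by (rule exp_tail_le[OF N gamma(1) _ tail]) simp
  from order_trans[OF probZ ennreal_leI[OF this]]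
  have probZ': "emeasure \<Sigma> (space \<Sigma> - Z) \<le> ennreal (\<gamma> / 2)" .
  have "S.prob (space \<Sigma> - Z) \<le> \<gamma> / 2"
    using probZ' gamma by (simp add: S.emeasure_eq_measure)
  then have measZ: "1 - \<gamma> / 2 \<le> S.prob Z" using S.prob_compl[OF Z] by simp
  \<comment> \<open>The lower frame bound forces full rank: a kernel vector of the grid matrix gives
    a function of norm \<open>0\<close>, whose coefficients vanish by linear independence.\<close>
  have inj: "injective_on K N (grid_fun K \<psi> z)" if z: "z \<in> Z" for z
    unfolding injective_on_def
  proof (intro allI impI)
    fix d :: "nat \<Rightarrow> complex" and j
    assume zero: "\<forall>i<K. (\<Sum>j<N. grid_fun K \<psi> z i j * d j) = 0" and j: "j < N"
    have "(\<Sum>i<K. (cmod (\<Sum>j<N. grid_mat K N \<psi> z $$ (i, j) * d j))\<^sup>2) = 0"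
    proof (intro sum.neutral ballI)
      fix i assume i: "i \<in> {..<K}"
      have "(\<Sum>j<N. grid_mat K N \<psi> z $$ (i, j) * d j) = (\<Sum>j<N. grid_fun K \<psi> z i j * d j)"
        using i by (intro sum.cong refl) (simp add: grid_mat_eq_grid_fun)
      also have "\<dots> = 0" using zero i by simp
      finally show "(cmod (\<Sum>j<N. grid_mat K N \<psi> z $$ (i, j) * d j))\<^sup>2 = 0" by simp
    qed
    with frame[OF z, of d] have "(L2_norm \<rho> (\<lambda>x. \<Sum>j<N. d j * \<psi> j x))\<^sup>2 \<le> 0"
      using delta by (simp add: mult_le_0_iff)
    then have "L2_norm \<rho> (\<lambda>x. \<Sum>j<N. d j * \<psi> j x) = 0" by simp
    then have "(\<integral>x. (cmod (\<Sum>j<N. d j * \<psi> j x))\<^sup>2 \<partial>\<rho>) = 0"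
      by (simp add: L2_norm_def)
    moreover have "integrable \<rho> (\<lambda>x. (cmod (\<Sum>j<N. d j * \<psi> j x))\<^sup>2)"
      using square_integrable_sum[of N \<rho> \<psi> d] L2_basisD(2)[OF basis(2)] by (simp add: square_integrable_def)
    ultimately have "AE x in \<rho>. (cmod (\<Sum>j<N. d j * \<psi> j x))\<^sup>2 = 0"
      by (subst (asm) integral_nonneg_eq_0_iff_AE) auto
    then have "AE x in \<rho>. (\<Sum>j<N. d j * \<psi> j x) = 0" by simp
    from L2_basisD(3)[OF basis(2) this] j show "d j = 0" by blast
  qed
  have grid_meas: "(\<lambda>z. grid_fun K \<psi> z i j) \<in> borel_measurable \<Sigma>" if "j < N" for i j
  proof (cases "i < K")
    case True
    have "\<psi> j \<in> borel_measurable \<rho>"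
      using L2_basisD(2)[OF basis(2) that] by (simp add: square_integrable_def)
    then have "(\<lambda>z. \<psi> j (z i)) \<in> borel_measurable \<Sigma>"
      unfolding \<Sigma>_def using True by (intro measurable_compose[OF measurable_component_singleton]) auto
    then show ?thesis using True by (simp add: grid_fun_def)
  qed (simp add: grid_fun_def)
  have q_meas: "(\<lambda>z. q z i k) \<in> borel_measurable \<Sigma>" for i k
  proof (cases "i < K")
    case True
    then show ?thesis unfolding q_def by (intro borel_measurable_gs_factor grid_meas)
  qed (simp add: q_def gs_factor_def grid_fun_def)
  have eq_meas: "Measurable.pred \<Sigma> (\<lambda>z. f z = c)" if "f \<in> borel_measurable \<Sigma>" for f :: "_ \<Rightarrow> complex" and c
    using that by measurable
  have inj_meas: "Measurable.pred \<Sigma> (\<lambda>z. injective_on K N (grid_fun K \<psi> z))"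
    unfolding injective_on_iff_gs_orthonormal gs_orthonormal_def q_def[symmetric]
    by (intro pred_intros_countable pred_intros_logic eq_meas borel_measurable_sum
        borel_measurable_times measurable_compose[OF _ borel_measurable_cnj] q_meas) simp_all
  define p where "p z = sampling_pmf qr (grid_mat K N \<psi> z)" for z
  have pmf_p: "pmf (p z) i = (if i < K then
      if injective_on K N (grid_fun K \<psi> z) then leverage N (q z) i / real N else 1 / real K else 0)" for z i
    unfolding p_def q_def by (rule pmf_sampling[OF N sizes(2) qr])
  define \<kappa> where "\<kappa> z = measure_pmf (Pi_pmf {..<M} (0::nat) (\<lambda>_. p z))" for z
  have kernel: "\<kappa> \<in> measurable \<Sigma> (subprob_algebra (count_space UNIV))"
    unfolding \<kappa>_def[abs_def]
  proof (rule measurable_Pi_pmf_kernel[where K = K])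
    show "set_pmf (p z) \<subseteq> {..<K}" for z
      by (auto simp: set_pmf_iff pmf_p split: if_splits)
    fix i
    have "(\<lambda>z. leverage N (q z) i / real N) \<in> borel_measurable \<Sigma>"
      unfolding leverage_def
      by (intro borel_measurable_divide borel_measurable_sum borel_measurable_power
          measurable_compose[OF _ borel_measurable_norm] q_meas borel_measurable_const)
    then show "(\<lambda>z. pmf (p z) i) \<in> borel_measurable \<Sigma>"
      unfolding pmf_p by (cases "i < K") (simp_all add: measurable_If[OF _ _ inj_meas[unfolded pred_def]])
  qed
  define \<Lambda> where "\<Lambda> = method_law \<rho> \<psi> N K M qr"
  have law: "\<Lambda> = \<Sigma> \<bind> (\<lambda>z. \<kappa> z \<bind> (\<lambda>\<iota>. return (\<Sigma> \<Otimes>\<^sub>M count_space UNIV) (z, \<iota>)))"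
    unfolding \<Lambda>_def method_law_def \<Sigma>_def \<kappa>_def p_def ..
  note sets_law = two_stage_law(1)[OF kernel S.not_empty, folded law]
    and emeasure_law = two_stage_law(2)[OF kernel S.not_empty, folded law]
  \<comment> \<open>Both clauses avoid \<open>qr\<close>, which makes \<open>E\<close>
    measurable.\<close>
  define E where "E = {x \<in> space (\<Sigma> \<Otimes>\<^sub>M count_space UNIV). fst x \<in> Z \<and> good_sample K N M \<delta> (q (fst x)) (snd x)}"
  have E: "E \<in> sets (\<Sigma> \<Otimes>\<^sub>M count_space UNIV)"
    unfolding E_def
  proof (intro sets.sets_Collect_conj)
    have "fst -` Z \<inter> space (\<Sigma> \<Otimes>\<^sub>M count_space (UNIV :: (nat \<Rightarrow> nat) set)) \<in> sets (\<Sigma> \<Otimes>\<^sub>M count_space UNIV)"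
      by (rule measurable_sets[OF measurable_fst Z])
    then show "{x \<in> space (\<Sigma> \<Otimes>\<^sub>M count_space (UNIV :: (nat \<Rightarrow> nat) set)). fst x \<in> Z} \<in> sets (\<Sigma> \<Otimes>\<^sub>M count_space UNIV)"
      by (simp add: vimage_def Int_def conj_commute)
    show "{x \<in> space (\<Sigma> \<Otimes>\<^sub>M count_space UNIV). good_sample K N M \<delta> (q (fst x)) (snd x)} \<in> sets (\<Sigma> \<Otimes>\<^sub>M count_space UNIV)"
      using measurable_good_sample[of N q \<Sigma> K M \<delta>, OF q_meas] by (simp add: pred_def)
  qed
  have orth: "(\<Sum>i<K. cnj (q z i k) * q z i l) = (if k = l then 1 else 0)" if "z \<in> Z" "k < N" "l < N" for z k l
    unfolding q_def by (rule gs_factor_orthonormal[OF inj[OF that(1)] that(2,3)])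
  have sec_le: "ennreal (1 - \<gamma> / 2) * indicator Z z \<le> emeasure (\<kappa> z) {\<iota>. (z, \<iota>) \<in> E}" for z
  \<comment> \<open>Given a grid in \<open>Z\<close>, a good sample has conditional probability at
    least \<open>1 - \<gamma> / 2\<close>, uniformly in the grid.\<close>
  proof (cases "z \<in> Z")
    case True
    then have "z \<in> space \<Sigma>" using Z sets.sets_into_space by blast
    then have "{\<iota>. (z, \<iota>) \<in> E} = {\<iota>. good_sample K N M \<delta> (q z) \<iota>}"
      using True by (simp add: E_def space_pair_measure)
    moreover have "1 - \<gamma> / 2 \<le> measure (\<kappa> z) {\<iota>. good_sample K N M \<delta> (q z) \<iota>}"
      unfolding \<kappa>_def
      by (rule prob_good_sample[OF N gamma(1) delta orth[OF True] _ M_bound]) (simp_all add: pmf_p inj[OF True])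
    ultimately show ?thesis
      using True by (simp add: \<kappa>_def measure_pmf.emeasure_eq_measure ennreal_leI)
  qed simp
  have le1: "emeasure \<Lambda> E \<le> 1"
  proof -
    have "emeasure \<Lambda> E \<le> (\<integral>\<^sup>+z. 1 \<partial>\<Sigma>)"
      unfolding emeasure_law[OF E] \<kappa>_def by (intro nn_integral_mono measure_pmf.emeasure_le_1)
    then show ?thesis by (simp add: S.emeasure_space_1)
  qed
  have "ennreal (1 - \<gamma>) \<le> ennreal ((1 - \<gamma> / 2) * S.prob Z)"
  proof (rule ennreal_leI)
    have "1 - \<gamma> \<le> (1 - \<gamma> / 2) * (1 - \<gamma> / 2)" by (simp add: algebra_simps)
    also have "\<dots> \<le> (1 - \<gamma> / 2) * S.prob Z" using measZ gamma by (intro mult_left_mono) simp_all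
    finally show "1 - \<gamma> \<le> (1 - \<gamma> / 2) * S.prob Z" .
  qed
  also have "\<dots> = (\<integral>\<^sup>+z. ennreal (1 - \<gamma> / 2) * indicator Z z \<partial>\<Sigma>)"
    using Z gamma by (simp add: nn_integral_cmult_indicator S.emeasure_eq_measure ennreal_mult)
  also have "\<dots> \<le> emeasure \<Lambda> E"
    unfolding emeasure_law[OF E] by (intro nn_integral_mono sec_le)
  also have "\<dots> = ennreal (measure \<Lambda> E)"
    using le1 by (intro emeasure_eq_ennreal_measure) (auto simp: top_unique)
  finally have prob: "1 - \<gamma> \<le> measure \<Lambda> E" by (simp add: measure_nonneg)
  let ?err = "\<lambda>Q z f. INF p\<in>P. L2_norm \<rho> (\<lambda>x. f x - p x) +
    1 / (1 - \<delta>) * (MAX i\<in>{..<K}. cmod (f (z i) - p (z i)) / sqrt (real K * sampling_prob Q i))"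
  \<comment> \<open>From here on the argument is deterministic, for a fixed pair in
    \<open>E\<close>.\<close>
  have conclusion: "vec_space.rank K B = N \<and>
      condition_number A \<le> ereal (sqrt ((1 + \<delta>) / (1 - \<delta>))) \<and>
      (\<forall>f. bounded_measurable \<rho> f \<longrightarrow>
         (\<exists>!g. g \<in> method_outputs \<psi> Q R M z \<iota> f) \<and>
         (\<forall>g \<in> method_outputs \<psi> Q R M z \<iota> f.
            L2_norm \<rho> (\<lambda>x. f x - g x) \<le> ?err Q z f))"
    if zE: "(z, \<iota>) \<in> E" and B_def: "B = grid_mat K N \<psi> z" and Q_def: "Q = fst (qr B)"
      and R_def: "R = snd (qr B)" and A_def: "A = sampled_mat Q M \<iota>" for z \<iota> B Q R A
  proof -
    have zZ: "z \<in> Z" and good: "good_sample K N M \<delta> (q z) \<iota>" using zE by (simp_all add: E_def)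
    have injz: "injective_on K N (grid_fun K \<psi> z)" by (rule inj[OF zZ])
    have B: "B \<in> carrier_mat K N" by (simp add: B_def grid_mat_def)
    have rank: "vec_space.rank K B = N"
      unfolding B_def full_col_rank_grid_mat by (rule injz)
    have red: "reduced_qr B Q R" unfolding Q_def R_def by (rule qr[OF B rank])
    have Q: "Q \<in> carrier_mat K N" by (rule reduced_qr_entries(1)[OF red B])
    have entries: "B $$ (i, j) = grid_fun K \<psi> z i j" if "i < K" "j < N" for i j
      unfolding B_def by (rule grid_mat_eq_grid_fun[OF that])
    have prob_Q: "sampling_prob Q i = leverage N (q z) i / real N" if "i < K" for i
      unfolding sampling_prob_eq_leverage[OF Q] q_def
      by (subst qr_unitary_change(1)[OF red B entries injz that]) simp_all
    have \<iota>: "\<iota> j < K \<and> 0 < sampling_prob Q (\<iota> j)" if "j < M" for j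
      using good that N prob_Q by (simp add: good_sample_def)
    have A: "A \<in> carrier_mat M N" using Q by (simp add: A_def sampled_mat_def)
    have iso: "isotropic_vector (measure_pmf (p z)) N (sampling_rows N (q z)) 1 (1 / real N)"
      unfolding sampling_rows_def[abs_def]
      by (rule isotropic_sampling[OF N orth[OF zZ]]) (simp_all add: pmf_p injz)
    have rows: "sqn N (sampling_rows N (q z) s) \<le> 1" for s
      using isotropic_vector.R[OF iso, of s] by simp
    have bounds: "(1 - \<delta>) * sqn N x \<le> (\<Sum>j<M. (cmod (\<Sum>k<N. A $$ (j, k) * x k))\<^sup>2) \<and>
        (\<Sum>j<M. (cmod (\<Sum>k<N. A $$ (j, k) * x k))\<^sup>2) \<le> (1 + \<delta>) * sqn N x" for x
    proof -
      \<comment> \<open>The events control rows of the Gram--Schmidt factor, while \<open>A\<close>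
        is built from \<open>Q\<close>. The unitary change replaces \<open>x\<close> by a vector
        \<open>y\<close> of equal norm with the same grid values.\<close>
      have "\<exists>y. sqn N y = sqn N x \<and>
          (\<forall>i<K. (\<Sum>k<N. Q $$ (i, k) * x k) = (\<Sum>l<N. q z i l * y l))"
        unfolding q_def by (rule qr_unitary_change(2)[OF red B entries injz])
      then obtain y where y: "sqn N y = sqn N x"
        "\<And>i. i < K \<Longrightarrow> (\<Sum>k<N. Q $$ (i, k) * x k) = (\<Sum>l<N. q z i l * y l)"
        by blast
      \<comment> \<open>Since the sampling probability is the leverage divided by \<open>N\<close>,
        a row of \<open>A\<close> is a normalised row of \<open>Q\<close> times
        \<open>sqrt (real N / real M)\<close>.\<close>
      have "(\<Sum>j<M. (cmod (\<Sum>k<N. A $$ (j, k) * x k))\<^sup>2)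
          = (\<Sum>j<M. real N / real M * (cmod (cip N (sampling_rows N (q z) (\<iota> j)) y))\<^sup>2)"
      proof (intro sum.cong refl)
        fix j assume "j \<in> {..<M}"
        then have j: "j < M" by simp
        define s where "s = leverage N (q z) (\<iota> j)"
        have s: "0 < s" and i: "\<iota> j < K" using good j by (simp_all add: good_sample_def s_def)
        have "(\<Sum>k<N. A $$ (j, k) * x k) = (\<Sum>k<N. Q $$ (\<iota> j, k) * x k) / of_real (sqrt (real M * (s / real N)))"
          using j Q by (simp add: A_def sampled_mat_def prob_Q[OF i] s_def sum_divide_distrib)
        also have "\<dots> = (\<Sum>l<N. q z (\<iota> j) l * y l) / of_real (sqrt (real M * (s / real N)))"
          by (simp only: y(2)[OF i])
        finally have "(cmod (\<Sum>k<N. A $$ (j, k) * x k))\<^sup>2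
            = (cmod (\<Sum>l<N. q z (\<iota> j) l * y l))\<^sup>2 / (real M * (s / real N))"
          using s by (simp add: norm_divide power_divide)
        moreover have "cip N (sampling_rows N (q z) (\<iota> j)) y = (\<Sum>l<N. q z (\<iota> j) l * y l) / of_real (sqrt s)"
          by (simp add: cip_def sampling_rows_def s_def sum_divide_distrib)
        then have "(cmod (cip N (sampling_rows N (q z) (\<iota> j)) y))\<^sup>2 = (cmod (\<Sum>l<N. q z (\<iota> j) l * y l))\<^sup>2 / s"
          using s by (simp add: norm_divide power_divide)
        ultimately show "(cmod (\<Sum>k<N. A $$ (j, k) * x k))\<^sup>2
            = real N / real M * (cmod (cip N (sampling_rows N (q z) (\<iota> j)) y))\<^sup>2"
          by simp
      qed
      also have "\<dots> = real N / real M * frame_sum N M (\<lambda>m. sampling_rows N (q z) (\<iota> m)) y"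
        by (simp add: frame_sum_def sum_distrib_left)
      finally have eq: "(\<Sum>j<M. (cmod (\<Sum>k<N. A $$ (j, k) * x k))\<^sup>2)
          = real N / real M * frame_sum N M (\<lambda>m. sampling_rows N (q z) (\<iota> m)) y" .
      have NM: "0 \<le> real N / real M" "real N / real M * (real M / real N) = 1" using N M by simp_all
      have "real M / real N * (1 - \<delta>) * sqn N y \<le> frame_sum N M (\<lambda>m. sampling_rows N (q z) (\<iota> m)) y"
        by (rule lower_event_bound[OF _ delta rows]) (use good in \<open>simp add: good_sample_def\<close>)
      from mult_left_mono[OF this NM(1)]
      have lo: "(1 - \<delta>) * sqn N x \<le> (\<Sum>j<M. (cmod (\<Sum>k<N. A $$ (j, k) * x k))\<^sup>2)"
        unfolding eq y(1) using N M by simp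
      have "frame_sum N M (\<lambda>m. sampling_rows N (q z) (\<iota> m)) y \<le> real M / real N * (1 + \<delta>) * sqn N y"
        by (rule upper_event_bound[OF _ delta(1) N']) (use good in \<open>simp add: good_sample_def\<close>)
      from mult_left_mono[OF this NM(1)]
      have "(\<Sum>j<M. (cmod (\<Sum>k<N. A $$ (j, k) * x k))\<^sup>2) \<le> (1 + \<delta>) * sqn N x"
        unfolding eq y(1) using N M by simp
      with lo show ?thesis ..
    qed
    have cond: "condition_number A \<le> ereal (sqrt ((1 + \<delta>) / (1 - \<delta>)))"
      by (rule condition_number_le[OF A N]) (use delta bounds in auto)
    have injB: "injective_on K N (\<lambda>i j. grid_mat K N \<psi> z $$ (i, j))"
      using rank unfolding rank_eq_iff_injective_on[OF B] unfolding B_def .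
    have error: "\<exists>g. method_outputs \<psi> Q R M z \<iota> f = {g} \<and>
        L2_norm \<rho> (\<lambda>x. f x - g x) \<le> ?err Q z f"
      if f: "bounded_measurable \<rho> f" for f
    proof (rule oversampled_least_squares_error[OF rho(1) N M basis(2) red[unfolded B_def] delta(2) injB frame[OF zZ] \<iota> _ f])
      show "(1 - \<delta>) * sqn N x \<le> (\<Sum>j<M. (cmod (\<Sum>k<N. sampled_mat Q M \<iota> $$ (j, k) * x k))\<^sup>2)" for x
        using bounds[of x] by (simp add: A_def)
    qed (assumption | rule exI conjI)+
    show ?thesis
    proof (intro conjI allI impI rank cond)
      fix f assume f: "bounded_measurable \<rho> f"
      from error[OF f] obtain g where g: "method_outputs \<psi> Q R M z \<iota> f = {g}"
        "L2_norm \<rho> (\<lambda>x. f x - g x) \<le> ?err Q z f"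
        by (elim exE conjE)
      show "\<exists>!g. g \<in> method_outputs \<psi> Q R M z \<iota> f" unfolding g(1) by simp
      show "\<forall>g \<in> method_outputs \<psi> Q R M z \<iota> f. L2_norm \<rho> (\<lambda>x. f x - g x) \<le> ?err Q z f"
        unfolding g(1) using g(2) by simp
    qed
  qed
  show ?thesis
    unfolding Let_def \<Lambda>_def[symmetric]
  proof (intro bexI[of _ E] conjI prob ballI)
    show "E \<in> sets \<Lambda>" unfolding sets_law by (rule E)
  qed (rule case_prodI2, rule conclusion[OF _ refl refl refl refl], simp)
qed

end
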